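(* Let $d\ge1$, let $I_1,\dots,I_d\subset\mathbb R$ be open intervals (bounded or unbounded), $\mathbf I=I_1\times\dots\times I_d$, and let $f\colon\mathbf I\to\mathbb R$ be a function. Let $\boldsymbol\alpha=(\alpha_1,\dots,\alpha_d)\in\mathbf I$ and let $\mathbf n=(n_1,\dots,n_d)\in\mathbb N^d$ be such that $n_i\ge1$ for $i=1,\dots,d$. Then $f$ is box-$\mathbf n$-convex if and only if it is of the form $$f(x_1,\dots,x_d)=W(x_1,\dots,x_d)+\sum_{\mathbf b\in\{L,r\}^d}\int_{\mathbf I}\prod_{j=1}^d\frac{(x_j-u_j)^{n_j-1}}{(n_j-1)!}\chi_{\alpha_j,x_j}^{b_j}(u_j)\,d\mu_{\mathbf b}(u_1,\dots,u_d)$$ for all $(x_1,\dots,x_d)\in\mathbf I$, where $W\colon\mathbf I\to\mathbb R$ is a pseudo-polynomial of degree $(n_1-1,\dots,n_d-1)$ and $\mu_{\mathbf b}$ $(\mathbf b=(b_1,\dots,b_d)\in\{L,r\}^d)$ are Borel measures on $\mathbf I$ such that $\mu_{\mathbf b}(K)<\infty$ for every compact $K\subset\mathbf I$ and, for each $i=1,\dots,d$, if $b_i=L$ then the marginal measure of $\mu_{\mathbf b}$ corresponding to the $i$th coordinate is discrete. (Here $0^0=1$.)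
   Context: $\mathbb N=\{0,1,2,\dots\}$. Divided differences: for a real function $g$ of one variable and pairwise distinct points, $[x_0;g]=g(x_0)$ and $[x_0,\dots,x_n;g]=\dfrac{[x_1,\dots,x_n;g]-[x_0,\dots,x_{n-1};g]}{x_n-x_0}$ for $n\ge1$. Multiple divided differences: for $f\colon\mathbf I\to\mathbb R$, $\mathbf n\in\mathbb N^d$, and vectors $\mathbf x_i=(x_{i0},\dots,x_{in_i})\in I_i^{n_i+1}$ with pairwise distinct coordinates ($i=1,\dots,d$), $[\mathbf x_1;\dots;\mathbf x_d;f]$ is defined by induction on $d$: for $d=1$ it is $[x_{10},\dots,x_{1n_1};f]$; for $d>1$ it is $[x_{d0},\dots,x_{dn_d};g]$, where $g(x)=[\mathbf x_1;\dots;\mathbf x_{d-1};f(\cdot,\dots,\cdot,x)]$ for $x\in I_d$. $f$ is box-$\mathbf n$-convex if $[\mathbf x_1;\dots;\mathbf x_d;f]\ge0$ for all such $\mathbf x_1,\dots,\mathbf x_d$. A pseudo-polynomial of degree $(m_1,\dots,m_d)$ is a function $W(x_1,\dots,x_d)=\sum_{i=1}^d\sum_{k=0}^{m_i}A_{ik}(x_1,\dots,x_{i-1},x_{i+1},\dots,x_d)\,x_i^k$, where $A_{ik}\colon\prod_{j\ne i}I_j\to\mathbb R$ are arbitrary functions (constants if $d=1$). For $x,y\in\mathbb R$: $\chi_{x,y}^L=\mathbf 1_{(-\infty,y)}-\mathbf 1_{(-\infty,x)}$ and $\chi_{x,y}^r=\mathbf 1_{(-\infty,y]}-\mathbf 1_{(-\infty,x]}$.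 Borel measures are nonnegative. The marginal measure of $\mu$ corresponding to the $i$th coordinate is the image of $\mu$ under $(u_1,\dots,u_d)\mapsto u_i$. A measure is discrete if it is concentrated on a countable set. *)

theory Defs
  imports "HOL-Analysis.Analysis"
begin

text \<open>
  Points of \<open>\<real>\<^sup>d\<close> are functions \<open>nat \<Rightarrow> real\<close> that are extensional on \<open>{..<d}\<close>, so the coordinates
  are numbered from 0 to \<open>d - 1\<close> and the box \<open>I\<^sub>1 \<times> \<dots> \<times> I\<^sub>d\<close> is \<open>PiE {..<d} I\<close>.
\<close>

definition box_topology :: "nat \<Rightarrow> (nat \<Rightarrow> real set) \<Rightarrow> (nat \<Rightarrow> real) topology" where
  "box_topology d I = product_topology (\<lambda>i. top_of_set (I i)) {..<d}"

definition box_borel :: "nat \<Rightarrow> (nat \<Rightarrow> real set) \<Rightarrow> (nat \<Rightarrow> real) measure" where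
  "box_borel d I = sigma (PiE {..<d} I) {U. openin (box_topology d I) U}"

lemma topspace_box_topology: "topspace (box_topology d I) = PiE {..<d} I"
  by (simp add: box_topology_def)

primrec divdiff :: "nat \<Rightarrow> (nat \<Rightarrow> real) \<Rightarrow> (real \<Rightarrow> real) \<Rightarrow> real" where
  "divdiff 0 x g = g (x 0)"
| "divdiff (Suc n) x g = (divdiff n (\<lambda>k. x (Suc k)) g - divdiff n x g) / (x (Suc n) - x 0)"

text \<open>
  The recursion starts at dimension 0, where \<open>\<lambda>_. undefined\<close> is the only (empty) point; the case
  \<open>d = 1\<close> is then the ordinary divided difference, see \<open>multi_divdiff_1\<close>.
\<close>

primrec multi_divdiff ::
  "nat \<Rightarrow> (nat \<Rightarrow> nat) \<Rightarrow> (nat \<Rightarrow> nat \<Rightarrow> real) \<Rightarrow> ((nat \<Rightarrow> real) \<Rightarrow> real) \<Rightarrow> real" where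
  "multi_divdiff 0 n X f = f (\<lambda>_. undefined)"
| "multi_divdiff (Suc d) n X f =
     divdiff (n d) (X d) (\<lambda>t. multi_divdiff d n X (\<lambda>u. f (u(d := t))))"

lemma multi_divdiff_1:
  "multi_divdiff 1 n X f = divdiff (n 0) (X 0) (\<lambda>t. f ((\<lambda>_. undefined)(0 := t)))"
  by simp

definition box_convex ::
  "nat \<Rightarrow> (nat \<Rightarrow> real set) \<Rightarrow> (nat \<Rightarrow> nat) \<Rightarrow> ((nat \<Rightarrow> real) \<Rightarrow> real) \<Rightarrow> bool" where
  "box_convex d I n f \<longleftrightarrow>
     (\<forall>X. (\<forall>i<d. inj_on (X i) {..n i} \<and> X i ` {..n i} \<subseteq> I i) \<longrightarrow> 0 \<le> multi_divdiff d n X f)"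

text \<open>
  The coefficient \<open>A i k\<close> sees only the restriction of the point to the coordinates other than
  \<open>i\<close>; for \<open>d = 1\<close> this restriction is the empty point, so \<open>A i k\<close> contributes a constant.
\<close>

definition pseudo_polynomial ::
  "nat \<Rightarrow> (nat \<Rightarrow> real set) \<Rightarrow> (nat \<Rightarrow> nat) \<Rightarrow> ((nat \<Rightarrow> real) \<Rightarrow> real) \<Rightarrow> bool" where
  "pseudo_polynomial d I m W \<longleftrightarrow>
     (\<exists>A :: nat \<Rightarrow> nat \<Rightarrow> (nat \<Rightarrow> real) \<Rightarrow> real. \<forall>x\<in>PiE {..<d} I.
        W x = (\<Sum>i<d. \<Sum>k\<le>m i. A i k (restrict x ({..<d} - {i})) * x i ^ k))"

datatype side = SideL | SideR

primrec chi :: "side \<Rightarrow> real \<Rightarrow> real \<Rightarrow> real \<Rightarrow> real" where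
  "chi SideL x y u = indicator {..<y} u - indicator {..<x} u"
| "chi SideR x y u = indicator {..y} u - indicator {..x} u"

definition marginal :: "nat \<Rightarrow> (nat \<Rightarrow> real) measure \<Rightarrow> real measure" where
  "marginal i M = distr M borel (\<lambda>u. u i)"

definition discrete_measure :: "real measure \<Rightarrow> bool" where
  "discrete_measure M \<longleftrightarrow> (\<exists>C. countable C \<and> emeasure M (space M - C) = 0)"

end

theory Submission
  imports Defs "HOL-Computational_Algebra.Polynomial"
begin

text \<open>
  The argument works modulo the common kernel of the mixed divided differences, which consists of
  the pseudo-polynomials because of Lagrange interpolation in each coordinate. The mixed divided
  difference of the integral is an integral of products of divided differences of truncated powers;
  these are B-splines, hence nonnegative, and this gives sufficiency.

  Necessity is by induction on the sum of the orders. If \<open>n i \<ge> 2\<close>, subtract Lagrange interpolants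
  in all coordinates but \<open>i\<close>: afterwards each section in \<open>x i\<close> is, up to sign, convex of order
  \<open>n i\<close>. Its right derivative is box-convex of the lower order, and the measures representing the
  derivative also represent the function, because a continuous function whose right difference
  quotients tend to 0 off a countable set is constant. If all orders are 1, the mixed differences
  form a finitely additive content on boxes. Choose a countable dense grid in each coordinate that
  contains all discontinuities, cut boxes successively along it, and lay out the resulting cells as
  adjacent intervals of the real line whose lengths are the contents. A point of the line is sent to
  the point to which the cells containing it shrink, and the measures are the images of Lebesgue
  measure under this map, sorted by the sides from which the cells shrink. If the left end points in
  coordinate \<open>i\<close> are eventually constant (side L), then the limit lies on the grid, which is why that
  marginal is discrete.
\<close>

section \<open>Divided differences over finite sets of nodes\<close>

text \<open>A box-convex function need not be regular: a pseudo-polynomial contains arbitrary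
  functions of d - 1 variables, so nothing can be differentiated before enough of that part is
  removed. Interpolation achieves this because its remainder is a product of nodal polynomials and a
  mixed difference. Order 1 has no one-sided continuity at all. For d = 1 and n = 1 the function f
  is merely increasing, and at a jump x the parts f(x) - f(x-) and f(x+) - f(x) are independent.
  Intervals (s, t] see the first as an atom at x, intervals [s, t) the second; this is the origin of
  the sides r and L. The content on boxes is therefore not countably additive in general, and
  countable additivity is inherited from Lebesgue measure on the line instead of being proved for
  the content. Discreteness of the L marginals is also what the induction over the orders needs: the
  right derivative of (x - u)_+ at x = u is 1, the value of the closed indicator, so kernels of side
  L differentiate correctly only off the countable set that carries their mass.\<close>

definition ddw :: "real set \<Rightarrow> real \<Rightarrow> real" where
  "ddw A a = 1 / (\<Prod>b\<in>A - {a}. a - b)"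

text \<open>The Lagrange form of the divided difference. Over a set of nodes symmetry is built in,
  and no enumeration of the nodes has to be carried along.\<close>

definition dd :: "real set \<Rightarrow> (real \<Rightarrow> real) \<Rightarrow> real" where
  "dd A g = (\<Sum>a\<in>A. ddw A a * g a)"

lemma dd_singleton [simp]: "dd {a} g = g a"
  by (simp add: dd_def ddw_def)

lemma dd_cong: "(\<And>a. a \<in> A \<Longrightarrow> g a = h a) \<Longrightarrow> dd A g = dd A h"
  by (simp add: dd_def)

lemma dd_add: "dd A (\<lambda>x. g x + h x) = dd A g + dd A h"
  by (simp add: dd_def ring_distribs sum.distrib)

lemma dd_diff: "dd A (\<lambda>x. g x - h x) = dd A g - dd A h"
  by (simp add: dd_def ring_distribs sum_subtractf)

lemma dd_cmult: "dd A (\<lambda>x. c * g x) = c * dd A g"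
  by (simp add: dd_def sum_distrib_left mult_ac)

lemma dd_sum: "dd A (\<lambda>x. \<Sum>k\<in>K. g k x) = (\<Sum>k\<in>K. dd A (g k))"
  by (simp add: dd_def sum_distrib_left sum.swap[of _ A])

lemma ddw_insert:
  assumes "finite A" "a \<notin> A" "x \<noteq> a"
  shows "ddw (insert a A) x = ddw A x / (x - a)"
proof -
  have "insert a A - {x} = insert a (A - {x})" using assms by auto
  then show ?thesis using assms by (simp add: ddw_def)
qed

lemma ddw_insert_self: "a \<notin> A \<Longrightarrow> ddw (insert a A) a = 1 / (\<Prod>b\<in>A. a - b)"
  by (simp add: ddw_def)

text \<open>Partial fractions of 1 / ((x - a) * (x - b)). As the nodes form a set, any two of them
  can be split off, not only the first and the last.\<close>

lemma dd_rec:
  assumes "finite A" "a \<notin> A" "b \<notin> A" "a \<noteq> b"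
  shows "dd (insert a (insert b A)) g = (dd (insert a A) g - dd (insert b A) g) / (a - b)"
proof -
  have ab: "a - b \<noteq> 0" using assms by simp
  have 1: "(\<Sum>x\<in>A. ddw (insert a (insert b A)) x * g x)
    = (\<Sum>x\<in>A. (ddw (insert a A) x * g x - ddw (insert b A) x * g x) / (a - b))"
  proof (rule sum.cong[OF refl])
    fix x assume x: "x \<in> A"
    then have ne: "x - a \<noteq> 0" "x - b \<noteq> 0" using assms by auto
    have "ddw (insert a (insert b A)) x = ddw A x / (x - b) / (x - a)"
      using assms x by (subst ddw_insert; (subst ddw_insert)?) auto
    moreover have "ddw (insert a A) x = ddw A x / (x - a)" "ddw (insert b A) x = ddw A x / (x - b)"
      using assms x by (auto intro: ddw_insert)
    moreover have "D / (x - b) / (x - a) * g x = (D / (x - a) * g x - D / (x - b) * g x) / (a - b)" for D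
      using ne ab by (simp add: divide_simps) (simp add: algebra_simps)
    ultimately show "ddw (insert a (insert b A)) x * g x
      = (ddw (insert a A) x * g x - ddw (insert b A) x * g x) / (a - b)"
      by simp
  qed
  have 2: "ddw (insert a (insert b A)) a = ddw (insert a A) a / (a - b)"
    by (subst insert_commute, rule ddw_insert) (use assms in auto)
  have 3: "ddw (insert a (insert b A)) b = - ddw (insert b A) b / (a - b)"
    using ddw_insert[of "insert b A" a b] assms ab by (simp add: field_simps)
  show ?thesis
    unfolding dd_def using assms
    by (simp add: 1 2 3 sum_subtractf sum_divide_distrib[symmetric] diff_divide_distrib add_divide_distrib)
qed

lemma dd_rec':
  assumes "finite A" "a \<notin> A" "b \<notin> A" "a \<noteq> b"
  shows "dd (insert a A) g - dd (insert b A) g = (a - b) * dd (insert a (insert b A)) g"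
  using dd_rec[OF assms] assms by simp

lemma divdiff_eq_dd:
  assumes "inj_on x {..n}"
  shows "divdiff n x g = dd (x ` {..n}) g"
  using assms
proof (induction n arbitrary: x)
  case (Suc n)
  have i1: "inj_on (\<lambda>k. x (Suc k)) {..n}"
    using Suc.prems by (auto simp: inj_on_def)
  have i2: "inj_on x {..n}" using Suc.prems by (auto simp: inj_on_def)
  define A where "A = x ` {1..n}"
  have e1: "(\<lambda>k. x (Suc k)) ` {..n} = insert (x (Suc n)) A"
  proof -
    have "(\<lambda>k. x (Suc k)) ` {..n} = x ` (Suc ` {..n})" by (simp add: image_image)
    also have "Suc ` {..n} = insert (Suc n) {1..n}"
      by (auto simp: image_Suc_atMost)
    finally show ?thesis by (simp add: A_def)
  qed
  have e2: "x ` {..n} = insert (x 0) A"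
  proof -
    have "{..n} = insert 0 {1..n}" by auto
    then show ?thesis by (simp add: A_def)
  qed
  have e3: "x ` {..Suc n} = insert (x (Suc n)) (insert (x 0) A)"
    unfolding atMost_Suc using e2 by simp
  have "x (Suc n) \<notin> A" "x 0 \<notin> A" "x (Suc n) \<noteq> x 0"
    using Suc.prems unfolding A_def inj_on_def by force+
  then show ?case
    using dd_rec[of A "x (Suc n)" "x 0" g] Suc.IH[OF i1] Suc.IH[OF i2]
    by (simp only: divdiff.simps e1 e2 e3) (simp add: A_def)
qed simp

text \<open>The factor x - a removes the term at a and cancels one factor in every other weight.
  This is the one case of the Leibniz rule that the proof needs.\<close>

lemma dd_mult_linear:
  assumes "finite A" "a \<in> A"
  shows "dd A (\<lambda>x. (x - a) * g x) = dd (A - {a}) g"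
proof -
  have "dd A (\<lambda>x. (x - a) * g x) = (\<Sum>x\<in>A - {a}. ddw A x * ((x - a) * g x))"
    unfolding dd_def using assms by (simp add: sum.remove)
  also have "\<dots> = (\<Sum>x\<in>A - {a}. ddw (A - {a}) x * g x)"
  proof (rule sum.cong[OF refl])
    fix x assume x: "x \<in> A - {a}"
    have "ddw A x = ddw (A - {a}) x / (x - a)"
      using ddw_insert[of "A - {a}" a x] assms x by (auto simp: insert_absorb)
    then show "ddw A x * ((x - a) * g x) = ddw (A - {a}) x * g x" using x by simp
  qed
  finally show ?thesis by (simp add: dd_def)
qed

lemma dd_const:
  assumes "2 \<le> card A"
  shows "dd A (\<lambda>_. c) = 0"
  using assms
proof (induction "card A" arbitrary: A rule: less_induct)
  case less
  have fin: "finite A" using less.prems card.infinite by fastforce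
  from less.prems obtain a b B where A: "A = insert a (insert b B)" "a \<noteq> b" "a \<notin> B" "b \<notin> B"
    by (metis One_nat_def Suc_1 card_le_Suc_iff insert_iff)
  have finB: "finite B" using fin A by simp
  have ca: "card (insert a B) < card A" "card (insert b B) < card A" using A finB by auto
  show ?case
  proof (cases "B = {}")
    case True
    then show ?thesis using A dd_rec[of "{}" a b] by simp
  next
    case False
    then have "2 \<le> card (insert a B)" "2 \<le> card (insert b B)"
      using A finB by (auto simp: Suc_le_eq card_gt_0_iff)
    then show ?thesis using less.hyps[OF ca(1)] less.hyps[OF ca(2)] A dd_rec[of B a b] finB by simp
  qed
qed

lemma dd_power:
  assumes "k + 2 \<le> card A"
  shows "dd A (\<lambda>x. x ^ k) = 0"
  using assms
proof (induction k arbitrary: A)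
  case 0
  then show ?case using dd_const[of A 1] by simp
next
  case (Suc k)
  have fin: "finite A" using Suc.prems card.infinite by fastforce
  obtain a where a: "a \<in> A" using Suc.prems by fastforce
  have "dd A (\<lambda>x. x ^ Suc k) = dd A (\<lambda>x. (x - a) * x ^ k + a * x ^ k)"
    by (simp add: algebra_simps)
  also have "\<dots> = dd (A - {a}) (\<lambda>x. x ^ k) + a * dd A (\<lambda>x. x ^ k)"
    by (simp add: dd_add dd_cmult dd_mult_linear fin a)
  also have "\<dots> = 0" using Suc.IH[of A] Suc.IH[of "A - {a}"] Suc.prems a fin by simp
  finally show ?case .
qed

lemma dd_polynomial:
  assumes "m + 2 \<le> card A" "\<And>x. x \<in> A \<Longrightarrow> g x = (\<Sum>k\<le>m. c k * x ^ k)"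
  shows "dd A g = 0"
proof -
  have "dd A g = dd A (\<lambda>x. \<Sum>k\<le>m. c k * x ^ k)" using assms by (intro dd_cong)
  also have "\<dots> = (\<Sum>k\<le>m. c k * dd A (\<lambda>x. x ^ k))" by (simp add: dd_sum dd_cmult)
  also have "\<dots> = 0" using assms by (intro sum.neutral ballI) (simp add: dd_power)
  finally show ?thesis .
qed

lemma poly_eq_sum_upto:
  fixes p :: "real poly"
  assumes "degree p \<le> m"
  shows "poly p x = (\<Sum>k\<le>m. coeff p k * x ^ k)"
  unfolding poly_altdef
  by (rule sum.mono_neutral_left) (use assms in \<open>auto simp: coeff_eq_0\<close>)

lemma dd_shifted_power:
  assumes "m + 2 \<le> card A"
  shows "dd A (\<lambda>x. (x - u) ^ m) = 0"
proof (rule dd_polynomial[OF assms])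
  fix x
  have "degree ([:-u, 1:] ^ m) \<le> m" by (simp add: degree_linear_power)
  from poly_eq_sum_upto[OF this, of x]
  show "(x - u) ^ m = (\<Sum>k\<le>m. coeff ([:-u, 1:] ^ m) k * x ^ k)" by (simp add: poly_power)
qed

section \<open>Lagrange interpolation\<close>

definition lagrange :: "real set \<Rightarrow> real \<Rightarrow> real poly" where
  "lagrange T a = (\<Prod>b\<in>T - {a}. smult (1 / (a - b)) [:-b, 1:])"

lemma poly_lagrange: "poly (lagrange T a) t = (\<Prod>b\<in>T - {a}. (t - b) / (a - b))"
  by (simp add: lagrange_def poly_prod diff_divide_distrib)

lemma degree_lagrange:
  assumes "finite T" "a \<in> T"
  shows "degree (lagrange T a) \<le> card T - 1"
proof -
  have "degree (lagrange T a) \<le> (\<Sum>b\<in>T - {a}. degree (smult (1 / (a - b)) [:-b, 1:]))"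
    unfolding lagrange_def by (rule order_trans[OF degree_prod_sum_le]) (use assms in auto)
  also have "\<dots> \<le> (\<Sum>b\<in>T - {a}. 1)"
    by (intro sum_mono) simp
  also have "\<dots> = card T - 1" using assms by simp
  finally show ?thesis .
qed

lemma poly_lagrange_node:
  assumes "finite T" "a \<in> T" "t \<in> T"
  shows "poly (lagrange T a) t = (if a = t then 1 else 0)"
proof (cases "a = t")
  case True
  then show ?thesis by (auto simp: poly_lagrange intro!: prod.neutral)
next
  case False
  then show ?thesis using assms by (auto simp: poly_lagrange intro!: prod_zero bexI[of _ t])
qed

text \<open>The error of Lagrange interpolation is the nodal polynomial times a divided difference
  with one more node: the term at t yields g t, and the terms at the old nodes yield the
  interpolant.\<close>

lemma dd_insert_lagrange:
  assumes "finite T" "t \<notin> T"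
  shows "(\<Prod>b\<in>T. t - b) * dd (insert t T) g = g t - (\<Sum>a\<in>T. poly (lagrange T a) t * g a)"
proof -
  have nz: "(\<Prod>b\<in>T. t - b) \<noteq> 0" using assms by auto
  have "(\<Prod>b\<in>T. t - b) * ddw (insert t T) a = - poly (lagrange T a) t" if "a \<in> T" for a
  proof -
    have ta: "a - t \<noteq> 0" using that assms by auto
    have "ddw (insert t T) a = ddw T a / (a - t)" using assms that by (intro ddw_insert) auto
    moreover have "(\<Prod>b\<in>T. t - b) = (t - a) * (\<Prod>b\<in>T - {a}. t - b)"
      using assms that by (simp add: prod.remove)
    ultimately have "(\<Prod>b\<in>T. t - b) * ddw (insert t T) a
        = (t - a) * (\<Prod>b\<in>T - {a}. t - b) * (ddw T a / (a - t))"
      by simp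
    also have "\<dots> = - ((\<Prod>b\<in>T - {a}. t - b) * ddw T a)" using ta by (simp add: divide_simps) (simp add: algebra_simps)
    also have "\<dots> = - poly (lagrange T a) t" by (simp add: ddw_def poly_lagrange prod_dividef)
    finally show ?thesis .
  qed
  then have "(\<Sum>a\<in>T. (\<Prod>b\<in>T. t - b) * ddw (insert t T) a * g a) = - (\<Sum>a\<in>T. poly (lagrange T a) t * g a)"
    by (simp add: sum_negf[symmetric])
  moreover have "(\<Prod>b\<in>T. t - b) * ddw (insert t T) t = 1"
    using nz assms by (simp add: ddw_insert_self)
  moreover have "(\<Prod>b\<in>T. t - b) * dd (insert t T) g = (\<Prod>b\<in>T. t - b) * ddw (insert t T) t * g t
     + (\<Sum>a\<in>T. (\<Prod>b\<in>T. t - b) * ddw (insert t T) a * g a)"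
    using assms by (simp add: dd_def ring_distribs sum_distrib_left mult.assoc)
  ultimately show ?thesis by simp
qed

text \<open>Interpolate at m fixed nodes of J: the error is a multiple of a divided difference with
  m + 1 nodes, hence 0, and the interpolant is the required polynomial.\<close>

lemma polynomial_of_dd_zero:
  assumes "infinite J" "1 \<le> m" "\<And>B. B \<subseteq> J \<Longrightarrow> card B = Suc m \<Longrightarrow> dd B V = 0"
  shows "\<exists>c. \<forall>v\<in>J. V v = (\<Sum>k\<le>m - 1. c k * v ^ k)"
proof -
  obtain T where T: "T \<subseteq> J" "card T = m" "finite T"
    using infinite_arbitrarily_large[OF assms(1)] by metis
  define c where "c k = (\<Sum>a\<in>T. coeff (lagrange T a) k * V a)" for k
  have "V v = (\<Sum>k\<le>m - 1. c k * v ^ k)" if v: "v \<in> J" for v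
  proof -
    have "V v = (\<Sum>a\<in>T. poly (lagrange T a) v * V a)"
    proof (cases "v \<in> T")
      case True
      have "(\<Sum>a\<in>T. poly (lagrange T a) v * V a) = (\<Sum>a\<in>T. if a = v then V a else 0)"
        using T True by (intro sum.cong) (auto simp: poly_lagrange_node)
      then show ?thesis using True T by simp
    next
      case False
      have "dd (insert v T) V = 0" using assms(3)[of "insert v T"] T v False by simp
      then show ?thesis using dd_insert_lagrange[OF T(3) False, of V] by simp
    qed
    also have "\<dots> = (\<Sum>a\<in>T. (\<Sum>k\<le>m - 1. coeff (lagrange T a) k * v ^ k) * V a)"
      using T degree_lagrange[OF T(3)] by (intro sum.cong refl) (metis poly_eq_sum_upto)
    also have "\<dots> = (\<Sum>k\<le>m - 1. c k * v ^ k)"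
      by (simp add: c_def sum_distrib_right sum_distrib_left sum.swap[of _ T] mult_ac)
    finally show ?thesis .
  qed
  then show ?thesis by blast
qed

section \<open>Truncated powers and B-splines\<close>

text \<open>The side matters only for m = 0, where 0^0 = 1 makes the value at the knot x = u depend
  on it.\<close>

definition trunc_power :: "side \<Rightarrow> nat \<Rightarrow> real \<Rightarrow> real \<Rightarrow> real" where
  "trunc_power b m u x = (x - u) ^ m * (if u < x \<or> b = SideR \<and> u = x then 1 else 0)"

text \<open>For u outside [p, q] the function agrees on A with 0 or with a polynomial of low degree.
  Otherwise split x - u = (x - p) + (p - u); \<open>dd_mult_linear\<close> and the recursion over
  the extreme nodes give the B-spline recurrence, whose weights (q - u) / (q - p) and (u - p) / (q -
  p) are nonnegative.\<close>

lemma dd_trunc_power_nonneg: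
  assumes "card A = m + 2"
  shows "0 \<le> dd A (trunc_power b m u)"
  using assms
proof (induction m arbitrary: A)
  case 0
  then obtain x y where A: "A = {x, y}" "x \<noteq> y" by (metis card_2_iff add_0)
  have *: "dd A g = (g x - g y) / (x - y)" for g :: "real \<Rightarrow> real"
    using dd_rec[of "{}" x y] A by simp
  show ?case unfolding * using A(2)
    by (cases b) (auto simp: trunc_power_def divide_simps)
next
  case (Suc m)
  have fin: "finite A" and ne: "A \<noteq> {}" using Suc.prems card.infinite by fastforce+
  define p q where "p = Min A" and "q = Max A"
  have pq: "p \<in> A" "q \<in> A" "\<And>x. x \<in> A \<Longrightarrow> p \<le> x" "\<And>x. x \<in> A \<Longrightarrow> x \<le> q"
    using fin ne by (auto simp: p_def q_def)
  have "p \<noteq> q"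
  proof
    assume "p = q"
    then have "A \<subseteq> {p}" using pq by fastforce
    then have "card A \<le> 1" using card_mono[of "{p}" A] by simp
    then show False using Suc.prems by simp
  qed
  then have lt: "p < q" using pq by force
  consider "u < p" | "q < u" | "p \<le> u" "u \<le> q" by linarith
  then show ?case
  proof cases
    case 1
    then have "dd A (trunc_power b (Suc m) u) = dd A (\<lambda>x. (x - u) ^ Suc m)"
      using pq by (intro dd_cong) (force simp: trunc_power_def)
    also have "\<dots> = 0" by (rule dd_shifted_power) (use Suc.prems in simp)
    finally show ?thesis by simp
  next
    case 2
    then have "dd A (trunc_power b (Suc m) u) = dd A (\<lambda>x. 0)"
      using pq by (intro dd_cong) (force simp: trunc_power_def)
    then show ?thesis by (simp add: dd_def)
  next
    case 3
    let ?h = "trunc_power b m u"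
    let ?B = "A - {p} - {q}"
    have e: "insert q ?B = A - {p}" "insert p ?B = A - {q}" "insert q (insert p ?B) = A"
      using pq \<open>p \<noteq> q\<close> by auto
    have "dd A (trunc_power b (Suc m) u) = dd A (\<lambda>x. (x - p) * ?h x + (p - u) * ?h x)"
      by (intro dd_cong) (simp add: trunc_power_def algebra_simps)
    also have "\<dots> = dd (A - {p}) ?h + (p - u) * dd A ?h"
      using fin pq by (simp add: dd_add dd_cmult dd_mult_linear)
    also have "dd A ?h = (dd (A - {p}) ?h - dd (A - {q}) ?h) / (q - p)"
      using dd_rec[of ?B q p ?h, unfolded e(3), unfolded e(1,2)] fin \<open>p \<noteq> q\<close> by simp
    also have "dd (A - {p}) ?h + (p - u) * ((dd (A - {p}) ?h - dd (A - {q}) ?h) / (q - p))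
      = ((q - u) * dd (A - {p}) ?h + (u - p) * dd (A - {q}) ?h) / (q - p)"
      using lt by (simp add: field_simps)
    also have "\<dots> \<ge> 0"
      using Suc.IH[of "A - {p}"] Suc.IH[of "A - {q}"] Suc.prems fin pq 3 lt
      by (intro divide_nonneg_pos add_nonneg_nonneg mult_nonneg_nonneg) auto
    finally show ?thesis .
  qed
qed

section \<open>Exchange of nodes\<close>

text \<open>Move the nodes b to \<sigma> b one at a time: each move changes the divided difference
  by (\<sigma> b - b) times one of the next higher order. In the induction C collects the nodes that
  have already moved. The formula turns a sign or a bound in one order into monotonicity or a bound
  one order lower.\<close>

lemma dd_exchange:
  assumes "finite B" "finite C" "inj_on \<sigma> B" "B \<inter> C = {}" "\<sigma> ` B \<inter> C = {}" "\<sigma> ` B \<inter> B = {}"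
  shows "\<exists>D. (\<forall>b\<in>B. D b \<subseteq> B \<union> \<sigma> ` B \<union> C \<and> card (D b) = Suc (card (B \<union> C))) \<and>
    dd (\<sigma> ` B \<union> C) g - dd (B \<union> C) g = (\<Sum>b\<in>B. (\<sigma> b - b) * dd (D b) g)"
  using assms
proof (induction B arbitrary: C rule: finite_induct)
  case (insert b B)
  have nb: "\<sigma> b \<notin> \<sigma> ` B" "\<sigma> b \<notin> B" "\<sigma> b \<noteq> b" "\<sigma> b \<notin> C" "b \<notin> C" "b \<notin> B" "b \<notin> \<sigma> ` B"
    using insert.prems insert.hyps by auto
  have e: "insert b B \<union> C = insert b (B \<union> C)" "\<sigma> ` insert b B \<union> C = \<sigma> ` B \<union> insert (\<sigma> b) C"
    "B \<union> insert (\<sigma> b) C = insert (\<sigma> b) (B \<union> C)"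
    by auto
  have cd: "card (insert b B \<union> C) = Suc (card (B \<union> C))"
    "card (B \<union> insert (\<sigma> b) C) = Suc (card (B \<union> C))"
    unfolding e using nb insert by auto
  have sub: "B \<union> \<sigma> ` B \<union> insert (\<sigma> b) C \<subseteq> insert b B \<union> \<sigma> ` insert b B \<union> C" by auto
  have "\<exists>D. (\<forall>ba\<in>B. D ba \<subseteq> B \<union> \<sigma> ` B \<union> insert (\<sigma> b) C \<and> card (D ba) = Suc (card (B \<union> insert (\<sigma> b) C))) \<and>
    dd (\<sigma> ` B \<union> insert (\<sigma> b) C) g - dd (B \<union> insert (\<sigma> b) C) g = (\<Sum>b\<in>B. (\<sigma> b - b) * dd (D b) g)"
    by (rule insert.IH) (use insert.prems insert.hyps in auto)
  then obtain D where D: "\<And>c. c \<in> B \<Longrightarrow> D c \<subseteq> B \<union> \<sigma> ` B \<union> insert (\<sigma> b) C"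
      "\<And>c. c \<in> B \<Longrightarrow> card (D c) = Suc (card (B \<union> insert (\<sigma> b) C))"
    and eq: "dd (\<sigma> ` B \<union> insert (\<sigma> b) C) g - dd (B \<union> insert (\<sigma> b) C) g = (\<Sum>b\<in>B. (\<sigma> b - b) * dd (D b) g)"
    by auto
  let ?E = "insert (\<sigma> b) (insert b (B \<union> C))"
  have st: "dd (B \<union> insert (\<sigma> b) C) g - dd (insert b B \<union> C) g = (\<sigma> b - b) * dd ?E g"
    unfolding e using dd_rec'[of "B \<union> C" "\<sigma> b" b g] nb insert by auto
  have E: "?E \<subseteq> insert b B \<union> \<sigma> ` insert b B \<union> C" "card ?E = Suc (card (insert b B \<union> C))"
    using nb insert by auto
  have sc: "(\<Sum>c\<in>B. (\<sigma> c - c) * dd ((D(b := ?E)) c) g) = (\<Sum>c\<in>B. (\<sigma> c - c) * dd (D c) g)"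
    using insert.hyps by (intro sum.cong) auto
  show ?case
  proof (intro exI[of _ "D(b := ?E)"] conjI ballI)
    fix c assume "c \<in> insert b B"
    then consider "c = b" | "c \<noteq> b" "c \<in> B" by blast
    then have "(D(b := ?E)) c \<subseteq> insert b B \<union> \<sigma> ` insert b B \<union> C \<and>
      card ((D(b := ?E)) c) = Suc (card (insert b B \<union> C))"
    proof cases
      case 1
      then show ?thesis using E by simp
    next
      case 2
      have "card (D c) = Suc (card (insert b B \<union> C))" using D(2)[OF 2(2)] cd by simp
      then show ?thesis using subset_trans[OF D(1)[OF 2(2)] sub] 2 by simp
    qed
    then show "(D(b := ?E)) c \<subseteq> insert b B \<union> \<sigma> ` insert b B \<union> C"
      and "card ((D(b := ?E)) c) = Suc (card (insert b B \<union> C))"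
      by blast+
  next
    show "dd (\<sigma> ` insert b B \<union> C) g - dd (insert b B \<union> C) g =
        (\<Sum>c\<in>insert b B. (\<sigma> c - c) * dd ((D(b := ?E)) c) g)"
      unfolding e(2) sum.insert[OF insert.hyps] sc eq[symmetric] using st by simp
  qed
qed simp

lemma dd_exchange_disjoint:
  assumes "finite B" "finite E" "card B = card E" "B \<inter> E = {}"
  shows "\<exists>\<sigma> D. bij_betw \<sigma> B E \<and> (\<forall>b\<in>B. D b \<subseteq> B \<union> E \<and> card (D b) = Suc (card B)) \<and>
    dd E g - dd B g = (\<Sum>b\<in>B. (\<sigma> b - b) * dd (D b) g)"
proof -
  obtain \<sigma> where \<sigma>: "bij_betw \<sigma> B E"
    using finite_same_card_bij[OF assms(1-3)] by blast
  then have "\<sigma> ` B = E" "inj_on \<sigma> B" by (auto simp: bij_betw_def)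
  with dd_exchange[of B "{}" \<sigma> g] assms have "\<exists>D. (\<forall>b\<in>B. D b \<subseteq> B \<union> E \<and> card (D b) = Suc (card B)) \<and>
    dd E g - dd B g = (\<Sum>b\<in>B. (\<sigma> b - b) * dd (D b) g)"
    by (simp add: Int_commute)
  with \<sigma> show ?thesis by blast
qed

section \<open>Divided differences in several variables\<close>

text \<open>The index type is left free: it is \<^typ>\<open>real\<close> (a node is its own index) for divided differences
  and \<^typ>\<open>bool\<close> (lower or upper end point) for differences over boxes, which may be degenerate.\<close>

definition mop :: "nat set \<Rightarrow> (nat \<Rightarrow> 'k set) \<Rightarrow> (nat \<Rightarrow> 'k \<Rightarrow> real) \<Rightarrow> (nat \<Rightarrow> 'k \<Rightarrow> real) \<Rightarrow>
    ((nat \<Rightarrow> real) \<Rightarrow> real) \<Rightarrow> (nat \<Rightarrow> real) \<Rightarrow> real" where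
  "mop S K w X f x =
     (\<Sum>k\<in>PiE S K. (\<Prod>i\<in>S. w i (k i)) * f (\<lambda>j. if j \<in> S then X j (k j) else x j))"

lemma mop_empty [simp]: "mop {} K w X f x = f x"
  by (simp add: mop_def)

lemma mop_cong:
  assumes "\<And>k. k \<in> PiE S K \<Longrightarrow>
    f (\<lambda>j. if j \<in> S then X j (k j) else x j) = g (\<lambda>j. if j \<in> S then X j (k j) else y j)"
  shows "mop S K w X f x = mop S K w X g y"
  using assms by (simp add: mop_def)

lemma mop_insert:
  assumes "finite S" "i \<notin> S"
  shows "mop (insert i S) K w X f x = (\<Sum>k\<in>K i. w i k * mop S K w X f (x(i := X i k)))"
proof -
  have 1: "(\<lambda>j. if j \<in> insert i S then X j ((g(i := k)) j) else x j)
    = (\<lambda>j. if j \<in> S then X j (g j) else (x(i := X i k)) j)" for g k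
    using assms by auto
  have 2: "(\<Prod>l\<in>insert i S. w l ((g(i := k)) l)) = w i k * (\<Prod>l\<in>S. w l (g l))" for g k
  proof -
    have "(\<Prod>l\<in>S. w l ((g(i := k)) l)) = (\<Prod>l\<in>S. w l (g l))"
      using assms by (intro prod.cong) auto
    then show ?thesis using assms by simp
  qed
  have "mop (insert i S) K w X f x = (\<Sum>(k, g)\<in>K i \<times> PiE S K.
     (\<Prod>l\<in>insert i S. w l ((g(i := k)) l)) * f (\<lambda>j. if j \<in> insert i S then X j ((g(i := k)) j) else x j))"
    unfolding mop_def PiE_insert_eq
    by (subst sum.reindex[OF inj_combinator[OF assms(2)]]) (simp add: case_prod_unfold)
  also have "\<dots> = (\<Sum>k\<in>K i. \<Sum>g\<in>PiE S K. w i k * ((\<Prod>l\<in>S. w l (g l)) * f (\<lambda>j. if j \<in> S then X j (g j) else (x(i := X i k)) j)))"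
    unfolding 1 2 by (simp add: sum.cartesian_product mult.assoc)
  also have "\<dots> = (\<Sum>k\<in>K i. w i k * mop S K w X f (x(i := X i k)))"
    by (simp add: mop_def sum_distrib_left)
  finally show ?thesis .
qed

lemma mop_upd:
  assumes "i \<notin> S"
  shows "mop S K w X f (x(i := v)) = mop S K w X (\<lambda>u. f (u(i := v))) x"
proof -
  have "(\<lambda>j. if j \<in> S then X j (k j) else (x(i := v)) j) = (\<lambda>j. if j \<in> S then X j (k j) else x j)(i := v)" for k
    using assms by auto
  then show ?thesis by (simp add: mop_def)
qed

lemma mop_sum: "mop S K w X (\<lambda>x. \<Sum>k\<in>L. f k x) x = (\<Sum>k\<in>L. mop S K w X (f k) x)"
  by (simp add: mop_def sum_distrib_left sum.swap[of _ _ L])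

lemma mop_cmult: "mop S K w X (\<lambda>x. c * f x) x = c * mop S K w X f x"
  by (simp add: mop_def sum_distrib_left mult_ac)

lemma mop_add: "mop S K w X (\<lambda>x. f x + g x) x = mop S K w X f x + mop S K w X g x"
  by (simp add: mop_def ring_distribs sum.distrib)

lemma mop_diff: "mop S K w X (\<lambda>x. f x - g x) x = mop S K w X f x - mop S K w X g x"
  by (simp add: mop_def ring_distribs sum_subtractf)

lemma mop_insert':
  assumes "finite S" "i \<notin> S"
  shows "mop (insert i S) K w X f x = mop S K w X (\<lambda>y. \<Sum>k\<in>K i. w i k * f (y(i := X i k))) x"
  unfolding mop_insert[OF assms] mop_upd[OF assms(2)] mop_sum mop_cmult ..

lemma mop_prod:
  assumes "finite S" "\<And>i. i \<in> S \<Longrightarrow> finite (K i)"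
  shows "mop S K w X (\<lambda>x. \<Prod>i\<in>S. g i (x i)) x = (\<Prod>i\<in>S. \<Sum>k\<in>K i. w i k * g i (X i k))"
proof -
  have "mop S K w X (\<lambda>x. \<Prod>i\<in>S. g i (x i)) x = (\<Sum>k\<in>PiE S K. \<Prod>i\<in>S. w i (k i) * g i (X i (k i)))"
    unfolding mop_def by (intro sum.cong refl) (simp add: prod.distrib)
  also have "\<dots> = (\<Prod>i\<in>S. \<Sum>k\<in>K i. w i k * g i (X i k))"
    using prod_sum_PiE[of S K "\<lambda>i k. w i k * g i (X i k)"] assms by simp
  finally show ?thesis .
qed

text \<open>The last argument fixes the coordinates outside S. Keeping it free allows induction over
  S and passage to sections in a single coordinate.\<close>

definition mdd :: "nat set \<Rightarrow> (nat \<Rightarrow> real set) \<Rightarrow> ((nat \<Rightarrow> real) \<Rightarrow> real) \<Rightarrow> (nat \<Rightarrow> real) \<Rightarrow> real" where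
  "mdd S A = mop S A (\<lambda>i. ddw (A i)) (\<lambda>i a. a)"

lemma mdd_empty [simp]: "mdd {} A f x = f x"
  by (simp add: mdd_def)

lemma mdd_insert:
  "finite S \<Longrightarrow> i \<notin> S \<Longrightarrow> mdd (insert i S) A f x = dd (A i) (\<lambda>v. mdd S A f (x(i := v)))"
  by (simp add: mdd_def mop_insert dd_def)

lemma mdd_insert':
  "finite S \<Longrightarrow> i \<notin> S \<Longrightarrow> mdd (insert i S) A f x = mdd S A (\<lambda>y. dd (A i) (\<lambda>v. f (y(i := v)))) x"
  by (simp add: mdd_def mop_insert' dd_def)

lemma mdd_upd: "i \<notin> S \<Longrightarrow> mdd S A f (x(i := v)) = mdd S A (\<lambda>u. f (u(i := v))) x"
  by (simp add: mdd_def mop_upd)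

lemma mdd_sum: "mdd S A (\<lambda>x. \<Sum>k\<in>L. f k x) x = (\<Sum>k\<in>L. mdd S A (f k) x)"
  by (simp add: mdd_def mop_sum)

lemma mdd_cmult: "mdd S A (\<lambda>x. c * f x) x = c * mdd S A f x"
  by (simp add: mdd_def mop_cmult)

lemma mdd_add: "mdd S A (\<lambda>x. f x + g x) x = mdd S A f x + mdd S A g x"
  by (simp add: mdd_def mop_add)

lemma mdd_diff: "mdd S A (\<lambda>x. f x - g x) x = mdd S A f x - mdd S A g x"
  by (simp add: mdd_def mop_diff)

lemma mdd_cong_sets: "(\<And>i. i \<in> S \<Longrightarrow> A i = B i) \<Longrightarrow> mdd S A f x = mdd S B f x"
  unfolding mdd_def mop_def by (intro sum.cong PiE_cong arg_cong2[of _ _ _ _ "(*)"] prod.cong) auto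

lemma mdd_cong:
  assumes "\<And>k. k \<in> PiE S A \<Longrightarrow> f (\<lambda>j. if j \<in> S then k j else x j) = g (\<lambda>j. if j \<in> S then k j else x j)"
  shows "mdd S A f x = mdd S A g x"
  unfolding mdd_def using assms by (intro mop_cong)

text \<open>Extensional points take the value \<open>undefined\<close> outside {..<d}, so with this
  frozen point a mixed difference over {..<d} evaluates f at extensional points only.\<close>

abbreviation pt :: "nat \<Rightarrow> real" where "pt \<equiv> \<lambda>_. undefined"

lemma mdd_cong_box:
  assumes "\<And>x. x \<in> PiE {..<d} I \<Longrightarrow> f x = g x" "\<And>i. i < d \<Longrightarrow> A i \<subseteq> I i"
  shows "mdd {..<d} A f pt = mdd {..<d} A g pt"
proof (rule mdd_cong)
  fix k assume "k \<in> PiE {..<d} A"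
  then have "k j \<in> I j" if "j < d" for j
    using PiE_mem[of k "{..<d}" A j] assms(2)[OF that] that by auto
  then have "(\<lambda>j. if j \<in> {..<d} then k j else undefined) \<in> PiE {..<d} I"
    by (intro PiE_I) simp_all
  then show "f (\<lambda>j. if j \<in> {..<d} then k j else undefined) = g (\<lambda>j. if j \<in> {..<d} then k j else undefined)"
    by (rule assms(1))
qed

lemma multi_divdiff_eq_mdd:
  assumes "\<And>i. i < d \<Longrightarrow> inj_on (X i) {..n i}"
  shows "multi_divdiff d n X f = mdd {..<d} (\<lambda>i. X i ` {..n i}) f pt"
  using assms
proof (induction d arbitrary: f)
  case (Suc d)
  have "{..<Suc d} = insert d {..<d}" by auto
  then have "mdd {..<Suc d} (\<lambda>i. X i ` {..n i}) f pt
    = dd (X d ` {..n d}) (\<lambda>v. mdd {..<d} (\<lambda>i. X i ` {..n i}) (\<lambda>u. f (u(d := v))) pt)"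
    by (simp add: mdd_insert mdd_upd)
  then show ?case using Suc by (simp add: divdiff_eq_dd)
qed simp

definition nodes :: "nat \<Rightarrow> (nat \<Rightarrow> real set) \<Rightarrow> (nat \<Rightarrow> nat) \<Rightarrow> (nat \<Rightarrow> real set) \<Rightarrow> bool" where
  "nodes d I n A \<longleftrightarrow> (\<forall>i<d. A i \<subseteq> I i \<and> card (A i) = Suc (n i))"

lemma nodes_finite: "nodes d I n A \<Longrightarrow> i < d \<Longrightarrow> finite (A i)"
  unfolding nodes_def by (metis card.infinite nat.distinct(1))

lemma box_convex_iff_mdd:
  "box_convex d I n f \<longleftrightarrow> (\<forall>A. nodes d I n A \<longrightarrow> 0 \<le> mdd {..<d} A f pt)"
proof (intro iffI allI impI)
  fix A assume f: "box_convex d I n f" and A: "nodes d I n A"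
  have "\<exists>X. bij_betw X {..n i} (A i)" if "i < d" for i
    using ex_bij_betw_nat_finite[OF nodes_finite[OF A that]] A that
    by (metis nodes_def lessThan_Suc_atMost atLeast0LessThan)
  then obtain X where X: "\<And>i. i < d \<Longrightarrow> bij_betw (X i) {..n i} (A i)" by metis
  have "0 \<le> multi_divdiff d n X f"
    using f X A unfolding box_convex_def nodes_def bij_betw_def by metis
  also have "\<dots> = mdd {..<d} (\<lambda>i. X i ` {..n i}) f pt"
    by (rule multi_divdiff_eq_mdd) (use X in \<open>auto simp: bij_betw_def\<close>)
  also have "\<dots> = mdd {..<d} A f pt"
    by (rule mdd_cong_sets) (use X in \<open>auto simp: bij_betw_def\<close>)
  finally show "0 \<le> mdd {..<d} A f pt" .
next
  assume *: "\<forall>A. nodes d I n A \<longrightarrow> 0 \<le> mdd {..<d} A f pt"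
  show "box_convex d I n f"
    unfolding box_convex_def
  proof (intro allI impI)
    fix X assume X: "\<forall>i<d. inj_on (X i) {..n i} \<and> X i ` {..n i} \<subseteq> I i"
    then have "nodes d I n (\<lambda>i. X i ` {..n i})"
      by (simp add: nodes_def card_image)
    then show "0 \<le> multi_divdiff d n X f"
      using multi_divdiff_eq_mdd[of d X n f] X * by simp
  qed
qed

section \<open>Pseudo-polynomials as the kernel of the mixed differences\<close>

text \<open>Apply the difference in coordinate i first: with the other coordinates fixed, the i-th
  summand is a polynomial in x i of degree at most n i - 1, and n i + 1 nodes annihilate it.\<close>

lemma mdd_pseudo_polynomial:
  assumes W: "pseudo_polynomial d I (\<lambda>i. n i - 1) W" and A: "nodes d I n A"
    and n: "\<And>i. i < d \<Longrightarrow> 1 \<le> n i"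
  shows "mdd {..<d} A W pt = 0"
proof -
  obtain P where P: "\<And>x. x \<in> PiE {..<d} I \<Longrightarrow>
      W x = (\<Sum>i<d. \<Sum>k\<le>n i - 1. P i k (restrict x ({..<d} - {i})) * x i ^ k)"
    using W unfolding pseudo_polynomial_def by auto
  have "mdd {..<d} A W pt = mdd {..<d} A
      (\<lambda>x. \<Sum>i<d. \<Sum>k\<le>n i - 1. P i k (restrict x ({..<d} - {i})) * x i ^ k) pt"
    by (rule mdd_cong_box[OF P]) (use A in \<open>auto simp: nodes_def\<close>)
  also have "\<dots> = (\<Sum>i<d. mdd {..<d} A (\<lambda>x. \<Sum>k\<le>n i - 1. P i k (restrict x ({..<d} - {i})) * x i ^ k) pt)"
    by (rule mdd_sum)
  also have "\<dots> = 0"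
  proof (rule sum.neutral, rule ballI)
    fix i assume i: "i \<in> {..<d}"
    let ?Q = "\<lambda>x. \<Sum>k\<le>n i - 1. P i k (restrict x ({..<d} - {i})) * x i ^ k"
    have "insert i ({..<d} - {i}) = {..<d}" using i by auto
    then have "mdd {..<d} A ?Q pt = mdd ({..<d} - {i}) A (\<lambda>y. dd (A i) (\<lambda>v. ?Q (y(i := v)))) pt"
      using mdd_insert'[of "{..<d} - {i}" i A ?Q pt] by simp
    also have "\<dots> = mdd ({..<d} - {i}) A (\<lambda>y. 0) pt"
    proof (rule mdd_cong)
      fix k
      let ?y = "\<lambda>j. if j \<in> {..<d} - {i} then k j else undefined :: real"
      have r: "restrict (?y(i := v)) ({..<d} - {i}) = restrict ?y ({..<d} - {i})" for v by auto
      show "dd (A i) (\<lambda>v. ?Q (?y(i := v))) = 0"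
      proof (rule dd_polynomial)
        show "n i - 1 + 2 \<le> card (A i)" using A i n[of i] by (auto simp: nodes_def)
        show "?Q (?y(i := v)) = (\<Sum>k\<le>n i - 1. P i k (restrict ?y ({..<d} - {i})) * v ^ k)" for v
          by (simp only: r fun_upd_same)
      qed
    qed
    also have "\<dots> = 0" by (simp add: mdd_def mop_def)
    finally show "mdd {..<d} A ?Q pt = 0" .
  qed
  finally show ?thesis .
qed

text \<open>A coordinate with \<open>T i = {}\<close> is left alone.\<close>

primrec interp_rem :: "(nat \<Rightarrow> real set) \<Rightarrow> nat \<Rightarrow> ((nat \<Rightarrow> real) \<Rightarrow> real) \<Rightarrow> (nat \<Rightarrow> real) \<Rightarrow> real" where
  "interp_rem T 0 g = g"
| "interp_rem T (Suc i) g = (\<lambda>x. interp_rem T i g x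
     - (\<Sum>a\<in>T i. poly (lagrange (T i) a) (x i) * interp_rem T i g (x(i := a))))"

text \<open>Iterate \<open>dd_insert_lagrange\<close> over the coordinates. Where \<open>T i\<close>
  is empty the node set is {x i}, and the difference in that coordinate is mere evaluation.\<close>

lemma interp_rem_eq_mdd:
  assumes "\<And>i. i < m \<Longrightarrow> finite (T i)" "\<And>i. i < m \<Longrightarrow> x i \<notin> T i"
  shows "interp_rem T m g x = (\<Prod>i<m. \<Prod>b\<in>T i. x i - b) * mdd {..<m} (\<lambda>i. insert (x i) (T i)) g x"
  using assms
proof (induction m arbitrary: x)
  case (Suc m)
  let ?A = "\<lambda>i. insert (x i) (T i)"
  have *: "interp_rem T m g (x(m := v)) = (\<Prod>i<m. \<Prod>b\<in>T i. x i - b) * mdd {..<m} ?A g (x(m := v))" for v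
  proof -
    have "interp_rem T m g (x(m := v)) = (\<Prod>i<m. \<Prod>b\<in>T i. (x(m := v)) i - b) *
      mdd {..<m} (\<lambda>i. insert ((x(m := v)) i) (T i)) g (x(m := v))"
      using Suc.prems by (intro Suc.IH) auto
    also have "mdd {..<m} (\<lambda>i. insert ((x(m := v)) i) (T i)) g (x(m := v)) = mdd {..<m} ?A g (x(m := v))"
      by (rule mdd_cong_sets) auto
    also have "(\<Prod>i<m. \<Prod>b\<in>T i. (x(m := v)) i - b) = (\<Prod>i<m. \<Prod>b\<in>T i. x i - b)"
      by (intro prod.cong) auto
    finally show ?thesis .
  qed
  have "interp_rem T (Suc m) g x = (\<Prod>b\<in>T m. x m - b) * dd (?A m) (\<lambda>v. interp_rem T m g (x(m := v)))"
    using dd_insert_lagrange[of "T m" "x m" "\<lambda>v. interp_rem T m g (x(m := v))"] Suc.prems by simp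
  also have "\<dots> = (\<Prod>b\<in>T m. x m - b) * (\<Prod>i<m. \<Prod>b\<in>T i. x i - b) * dd (?A m) (\<lambda>v. mdd {..<m} ?A g (x(m := v)))"
    unfolding * by (simp add: dd_cmult)
  also have "dd (?A m) (\<lambda>v. mdd {..<m} ?A g (x(m := v))) = mdd {..<Suc m} ?A g x"
    using mdd_insert[of "{..<m}" m ?A g x] by (simp add: lessThan_Suc)
  finally show ?case by (simp add: mult_ac)
qed simp

text \<open>Complements the product formula, which excludes the nodes: interpolation is exact at a
  node, and later steps substitute in other coordinates only.\<close>

lemma interp_rem_node:
  assumes "\<And>i. i < m \<Longrightarrow> finite (T i)" "i < m" "x i \<in> T i"
  shows "interp_rem T m g x = 0"
  using assms
proof (induction m arbitrary: x)
  case (Suc m)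
  show ?case
  proof (cases "i < m")
    case True
    then have "interp_rem T m g (x(m := a)) = 0" for a using Suc.prems by (intro Suc.IH) auto
    moreover have "interp_rem T m g x = 0" using Suc.prems True by (intro Suc.IH) auto
    ultimately show ?thesis by simp
  next
    case False
    then have "i = m" using Suc.prems by simp
    then have "(\<Sum>a\<in>T m. poly (lagrange (T m) a) (x m) * interp_rem T m g (x(m := a)))
      = (\<Sum>a\<in>T m. if a = x m then interp_rem T m g x else 0)"
      using Suc.prems by (intro sum.cong) (auto simp: poly_lagrange_node)
    then show ?thesis using Suc.prems \<open>i = m\<close> by simp
  qed
qed simp

lemma pseudo_polynomial_cong:
  "(\<And>x. x \<in> PiE {..<d} I \<Longrightarrow> V x = W x) \<Longrightarrow> pseudo_polynomial d I m V \<longleftrightarrow> pseudo_polynomial d I m W"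
  unfolding pseudo_polynomial_def by (intro ex_cong1 ball_cong) auto

text \<open>The steps of the recursion telescope. Step i subtracts a polynomial in x i of degree at
  most n i - 1; its coefficients do not see x i, since x(i := a) overwrites that coordinate.\<close>

lemma pseudo_polynomial_minus_interp_rem:
  assumes "\<And>i. i < d \<Longrightarrow> finite (T i)" "\<And>i. i < d \<Longrightarrow> card (T i) \<le> n i"
  shows "pseudo_polynomial d I (\<lambda>i. n i - 1) (\<lambda>x. g x - interp_rem T d g x)"
proof -
  have sm: "g x - interp_rem T m g x =
      (\<Sum>i<m. \<Sum>a\<in>T i. poly (lagrange (T i) a) (x i) * interp_rem T i g (x(i := a)))" for m x
    by (induction m) (simp_all del: fun_upd_apply)
  define P where "P i k y = (\<Sum>a\<in>T i. coeff (lagrange (T i) a) k * interp_rem T i g (y(i := a)))" for i k y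
  have "g x - interp_rem T d g x = (\<Sum>i<d. \<Sum>k\<le>n i - 1. P i k (restrict x ({..<d} - {i})) * x i ^ k)"
    if x: "x \<in> PiE {..<d} I" for x
  proof -
    have "(\<Sum>a\<in>T i. poly (lagrange (T i) a) (x i) * interp_rem T i g (x(i := a)))
      = (\<Sum>k\<le>n i - 1. P i k (restrict x ({..<d} - {i})) * x i ^ k)" if i: "i < d" for i
    proof -
      have r: "(restrict x ({..<d} - {i}))(i := a) = x(i := a)" for a
        using x by (auto simp: PiE_def extensional_def restrict_def)
      have "poly (lagrange (T i) a) (x i) = (\<Sum>k\<le>n i - 1. coeff (lagrange (T i) a) k * x i ^ k)"
        if "a \<in> T i" for a
        using degree_lagrange[OF assms(1)[OF i] that] assms(2)[OF i]
        by (intro poly_eq_sum_upto) (meson diff_le_mono order_trans)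
      then have "(\<Sum>a\<in>T i. poly (lagrange (T i) a) (x i) * interp_rem T i g (x(i := a)))
        = (\<Sum>a\<in>T i. (\<Sum>k\<le>n i - 1. coeff (lagrange (T i) a) k * x i ^ k) * interp_rem T i g (x(i := a)))"
        by simp
      also have "\<dots> = (\<Sum>k\<le>n i - 1. P i k (restrict x ({..<d} - {i})) * x i ^ k)"
        by (simp add: P_def r sum_distrib_right sum_distrib_left sum.swap[of _ "T i"] mult_ac)
      finally show ?thesis .
    qed
    then show ?thesis by (simp add: sm)
  qed
  then show ?thesis unfolding pseudo_polynomial_def by blast
qed

text \<open>Interpolate at n i nodes in every coordinate. The remainder vanishes, at nodes by
  \<open>interp_rem_node\<close> and elsewhere as a multiple of a mixed difference; so g is the
  subtracted pseudo-polynomial.\<close>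

lemma pseudo_polynomial_of_mdd_zero:
  assumes inf: "\<And>i. i < d \<Longrightarrow> infinite (I i)"
    and z: "\<And>A. nodes d I n A \<Longrightarrow> mdd {..<d} A g pt = 0"
  shows "pseudo_polynomial d I (\<lambda>i. n i - 1) g"
proof -
  have "\<exists>T. finite T \<and> card T = n i \<and> T \<subseteq> I i" if "i < d" for i
    using infinite_arbitrarily_large[OF inf[OF that]] by blast
  then obtain T where T: "\<And>i. i < d \<Longrightarrow> finite (T i) \<and> card (T i) = n i \<and> T i \<subseteq> I i" by metis
  have "interp_rem T d g x = 0" if x: "x \<in> PiE {..<d} I" for x
  proof (cases "\<exists>i<d. x i \<in> T i")
    case True
    then show ?thesis using interp_rem_node T by metis
  next
    case False
    have "nodes d I n (\<lambda>i. insert (x i) (T i))" using T False x by (auto simp: nodes_def)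
    then have "mdd {..<d} (\<lambda>i. insert (x i) (T i)) g pt = 0" by (rule z)
    moreover have "mdd {..<d} (\<lambda>i. insert (x i) (T i)) g pt = mdd {..<d} (\<lambda>i. insert (x i) (T i)) g x"
      unfolding mdd_def
    proof (rule mop_cong)
      fix k
      have "(\<lambda>j. if j \<in> {..<d} then k j else undefined) = (\<lambda>j. if j \<in> {..<d} then k j else x j)"
        using x by (auto simp: PiE_def extensional_def)
      then show "g (\<lambda>j. if j \<in> {..<d} then k j else undefined) = g (\<lambda>j. if j \<in> {..<d} then k j else x j)"
        by simp
    qed
    moreover have "interp_rem T d g x
        = (\<Prod>i<d. \<Prod>b\<in>T i. x i - b) * mdd {..<d} (\<lambda>i. insert (x i) (T i)) g x"
      by (rule interp_rem_eq_mdd) (use T False in auto)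
    ultimately show ?thesis by simp
  qed
  then have eq: "pseudo_polynomial d I m (\<lambda>x. g x - interp_rem T d g x) \<longleftrightarrow> pseudo_polynomial d I m g" for m
    by (intro pseudo_polynomial_cong) simp
  show ?thesis
    unfolding eq[symmetric] by (rule pseudo_polynomial_minus_interp_rem) (use T in auto)
qed

section \<open>Regularity of functions of higher-order convexity\<close>

lemma dd_translate:
  "dd ((\<lambda>b. b + h) ` B) g = dd B (\<lambda>v. g (v + h))"
proof -
  have inj: "inj_on (\<lambda>b. b + h) B" by (simp add: inj_on_def)
  have "ddw ((\<lambda>b. b + h) ` B) (a + h) = ddw B a" for a
  proof -
    have "(\<lambda>b. b + h) ` B - {a + h} = (\<lambda>b. b + h) ` (B - {a})" by auto
    then show ?thesis
      by (simp add: ddw_def prod.reindex[OF inj_on_subset[OF inj]])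
  qed
  then show ?thesis by (simp add: dd_def sum.reindex[OF inj])
qed

lemma open_interval_cball:
  fixes x :: real
  assumes "open J" "x \<in> J"
  obtains e where "e > 0" "{x - e..x + e} \<subseteq> J"
proof -
  obtain e where "e > 0" "cball x e \<subseteq> J" using assms open_contains_cball by blast
  then show ?thesis using that[of e] by (simp add: cball_eq_atLeastAtMost)
qed

lemma interval_segment:
  fixes a b :: real
  assumes "is_interval J" "a \<in> J" "b \<in> J"
  shows "{a..b} \<subseteq> J"
  using assms mem_is_interval_1_I by (metis atLeastAtMost_iff subsetI)

text \<open>Order 1 means increasing and order 2 convex: the index is the number of nodes minus one,
  so that it agrees with n i.\<close>

definition convex_order :: "real set \<Rightarrow> nat \<Rightarrow> (real \<Rightarrow> real) \<Rightarrow> bool" where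
  "convex_order J m \<phi> \<longleftrightarrow> (\<forall>B. B \<subseteq> J \<and> card B = Suc m \<longrightarrow> 0 \<le> dd B \<phi>)"

lemma obtain_nodes_in:
  assumes "a < (b::real)"
  obtains T where "finite T" "card T = m" "T \<subseteq> {a..<b}"
  using infinite_arbitrarily_large[of "{a..<b}" m] assms by (auto simp: infinite_Ico)

text \<open>By the exchange formula a divided difference with m nodes grows when its nodes are
  replaced by nodes further to the right. On [a, b] it is therefore enclosed by its values at node
  sets P to the left and Q to the right of the interval, for which the open set J has room.\<close>

lemma dd_bounded_top:
  assumes J: "open J" "is_interval J" and cv: "convex_order J m \<phi>"
    and ab: "a \<in> J" "b \<in> J"
  shows "\<exists>L. \<forall>B\<subseteq>{a..b}. card B = m \<longrightarrow> \<bar>dd B \<phi>\<bar> \<le> L"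
proof -
  obtain e where e: "e > 0" "{a - e..a + e} \<subseteq> J" using open_interval_cball J ab by metis
  obtain e' where e': "e' > 0" "{b - e'..b + e'} \<subseteq> J" using open_interval_cball J ab by metis
  obtain P where P: "finite P" "card P = m" "P \<subseteq> {a - e..<a}" using obtain_nodes_in[of "a - e" a] e by auto
  \<comment> \<open>\<open>obtain_nodes_in\<close> admits the left end point; starting at b + e' / 2
    keeps Q strictly to the right of b.\<close>
  obtain Q where Q: "finite Q" "card Q = m" "Q \<subseteq> {b + e' / 2..<b + e'}"
    using obtain_nodes_in[of "b + e' / 2" "b + e'"] e' by auto
  have mono: "dd B \<phi> \<le> dd E \<phi>"
    if BE: "finite B" "finite E" "card B = m" "card E = m" "B \<subseteq> J" "E \<subseteq> J" "\<And>x y. x \<in> B \<Longrightarrow> y \<in> E \<Longrightarrow> x < y" for B E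
  proof -
    have dis: "B \<inter> E = {}" using BE(7) by blast
    obtain \<sigma> D where *: "bij_betw \<sigma> B E" "\<forall>b\<in>B. D b \<subseteq> B \<union> E \<and> card (D b) = Suc (card B)"
      "dd E \<phi> - dd B \<phi> = (\<Sum>b\<in>B. (\<sigma> b - b) * dd (D b) \<phi>)"
      using dd_exchange_disjoint[OF BE(1,2) trans[OF BE(3) BE(4)[symmetric]] dis, of \<phi>]
      by (elim exE conjE) (rule that)
    have "0 \<le> (\<Sum>b\<in>B. (\<sigma> b - b) * dd (D b) \<phi>)"
    proof (intro sum_nonneg mult_nonneg_nonneg)
      fix b assume b: "b \<in> B"
      then show "0 \<le> \<sigma> b - b" using BE(7)[of b "\<sigma> b"] *(1) by (force simp: bij_betw_def)
      have "D b \<subseteq> J" "card (D b) = Suc m" using *(2) b BE by auto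
      then show "0 \<le> dd (D b) \<phi>" using cv by (simp add: convex_order_def)
    qed
    then show ?thesis using *(3) by simp
  qed
  have "\<bar>dd B \<phi>\<bar> \<le> \<bar>dd P \<phi>\<bar> + \<bar>dd Q \<phi>\<bar>" if B: "B \<subseteq> {a..b}" "card B = m" for B
  \<comment> \<open>For m = 0 an infinite B also has cardinality 0; the sum over it is 0 by
    convention.\<close>
  proof (cases "m = 0")
    case True
    then show ?thesis using B P by (cases "finite B") (auto simp: dd_def)
  next
    case False
    then have fin: "finite B" using B card.infinite by fastforce
    have BJ: "B \<subseteq> J" using B interval_segment[OF J(2) ab] by auto
    have "{a - e..<a} \<subseteq> {a - e..a + e}" "{b + e' / 2..<b + e'} \<subseteq> {b - e'..b + e'}"
      using e(1) e'(1) by auto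
    then have PQ: "P \<subseteq> J" "Q \<subseteq> J" using P(3) Q(3) e(2) e'(2) by (meson subset_trans)+
    have "dd P \<phi> \<le> dd B \<phi>"
    proof (rule mono[OF P(1) fin P(2) B(2) PQ(1) BJ])
      fix x y assume "x \<in> P" "y \<in> B"
      then have "x \<in> {a - e..<a}" "y \<in> {a..b}" using P(3) B(1) by blast+
      then show "x < y" by simp
    qed
    moreover have "dd B \<phi> \<le> dd Q \<phi>"
    proof (rule mono[OF fin Q(1) B(2) Q(2) BJ PQ(2)])
      fix x y assume "x \<in> B" "y \<in> Q"
      then have "x \<in> {a..b}" "y \<in> {b + e' / 2..<b + e'}" using Q(3) B(1) by blast+
      then show "x < y" using e'(1) by simp
    qed
    ultimately show ?thesis by linarith
  qed
  then show ?thesis by blast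
qed

text \<open>Downward induction on the number of nodes: compare B with one fixed set T to the left of
  a. The exchange formula brings in differences with one more node on [a - e, b], which is why the
  interval has to vary in the induction.\<close>

lemma dd_bounded:
  assumes J: "open J" "is_interval J" and cv: "convex_order J m \<phi>"
    and j: "1 \<le> j" "j \<le> m"
    and ab: "a \<in> J" "b \<in> J"
  shows "\<exists>L\<ge>0. \<forall>B\<subseteq>{a..b}. card B = j \<longrightarrow> \<bar>dd B \<phi>\<bar> \<le> L"
  using j(2,1) ab
proof (induction j arbitrary: a b rule: inc_induct)
  case base
  then obtain L where "\<forall>B\<subseteq>{a..b}. card B = m \<longrightarrow> \<bar>dd B \<phi>\<bar> \<le> L" using dd_bounded_top[OF J cv] by blast
  then have "\<forall>B\<subseteq>{a..b}. card B = m \<longrightarrow> \<bar>dd B \<phi>\<bar> \<le> \<bar>L\<bar>" using order_trans[OF _ abs_ge_self] by blast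
  then show ?case by (intro exI[of _ "\<bar>L\<bar>"]) simp
next
  case (step j)
  obtain e where e: "e > 0" "{a - e..a + e} \<subseteq> J" using open_interval_cball J step.prems by metis
  obtain T where T: "finite T" "card T = j" "T \<subseteq> {a - e..<a}" using obtain_nodes_in[of "a - e" a] e by auto
  have "\<exists>L\<ge>0. \<forall>B\<subseteq>{a - e..b}. card B = Suc j \<longrightarrow> \<bar>dd B \<phi>\<bar> \<le> L"
    by (rule step.IH) (use e step.prems in auto)
  then obtain L where L: "L \<ge> 0" "\<And>B. B \<subseteq> {a - e..b} \<Longrightarrow> card B = Suc j \<Longrightarrow> \<bar>dd B \<phi>\<bar> \<le> L" by blast
  have "\<bar>dd B \<phi>\<bar> \<le> \<bar>dd T \<phi>\<bar> + j * ((\<bar>b - a\<bar> + e) * L)" if B: "B \<subseteq> {a..b}" "card B = j" for B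
  proof -
    have fin: "finite B" using B(2) step.prems(1) card.infinite by (cases "finite B") auto
    have "B \<noteq> {}" using B(2) step.prems(1) by auto
    then have "{a..b} \<noteq> {}" using B(1) by blast
    then have ab: "a \<le> b" by simp
    have "T \<subseteq> {a - e..b}" by (rule subset_trans[OF T(3)]) (use ab in auto)
    moreover have "B \<subseteq> {a - e..b}" by (rule subset_trans[OF B(1)]) (use e in auto)
    ultimately have TB: "T \<union> B \<subseteq> {a - e..b}" by blast
    have "{a - e..<a} \<inter> {a..b} = {}" by auto
    then have dis: "T \<inter> B = {}" using T(3) B(1) by blast
    obtain \<sigma> D where *: "bij_betw \<sigma> T B" "\<forall>b\<in>T. D b \<subseteq> T \<union> B \<and> card (D b) = Suc (card T)"
      "dd B \<phi> - dd T \<phi> = (\<Sum>b\<in>T. (\<sigma> b - b) * dd (D b) \<phi>)"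
      using dd_exchange_disjoint[OF T(1) fin trans[OF T(2) B(2)[symmetric]] dis, of \<phi>]
      by (elim exE conjE) (rule that)
    have "\<bar>\<Sum>b\<in>T. (\<sigma> b - b) * dd (D b) \<phi>\<bar> \<le> (\<Sum>t\<in>T. (\<bar>b - a\<bar> + e) * L)"
    proof (rule order_trans[OF sum_abs sum_mono])
      fix t assume t: "t \<in> T"
      have "\<sigma> t \<in> B" using *(1) t by (auto simp: bij_betw_def)
      then have "\<sigma> t \<in> {a..b}" "t \<in> {a - e..<a}" using T(3) B(1) t by blast+
      then have "\<bar>\<sigma> t - t\<bar> \<le> \<bar>b - a\<bar> + e" by auto
      moreover have "D t \<subseteq> T \<union> B" "card (D t) = Suc j" using *(2) t T(2) by auto
      then have "\<bar>dd (D t) \<phi>\<bar> \<le> L" using TB by (intro L) auto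
      ultimately show "\<bar>(\<sigma> t - t) * dd (D t) \<phi>\<bar> \<le> (\<bar>b - a\<bar> + e) * L"
        unfolding abs_mult using e by (intro mult_mono) auto
    qed
    then show ?thesis using *(3) T by simp
  qed
  then show ?case using L(1) e(1) by (intro exI[of _ "\<bar>dd T \<phi>\<bar> + j * ((\<bar>b - a\<bar> + e) * L)"]) auto
qed

lemma dd_pair: "x \<noteq> y \<Longrightarrow> dd {x, y} g = (g x - g y) / (x - y)"
  using dd_rec[of "{}" x y g] by simp

lemma convex_order_lipschitz:
  assumes J: "open J" "is_interval J" and cv: "convex_order J m \<phi>" and m: "2 \<le> m"
    and ab: "a \<in> J" "b \<in> J"
  shows "\<exists>L\<ge>0. \<forall>x\<in>{a..b}. \<forall>y\<in>{a..b}. \<bar>\<phi> x - \<phi> y\<bar> \<le> L * \<bar>x - y\<bar>"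
proof -
  obtain L where L: "L \<ge> 0" "\<forall>B\<subseteq>{a..b}. card B = 2 \<longrightarrow> \<bar>dd B \<phi>\<bar> \<le> L"
    using dd_bounded[OF J cv _ m ab] by auto
  have "\<bar>\<phi> x - \<phi> y\<bar> \<le> L * \<bar>x - y\<bar>" if "x \<in> {a..b}" "y \<in> {a..b}" for x y
  proof (cases "x = y")
    case False
    then have "card {x, y} = 2" "{x, y} \<subseteq> {a..b}" using that by auto
    then have "\<bar>dd {x, y} \<phi>\<bar> \<le> L" using L(2) by blast
    then show ?thesis using False by (simp add: dd_pair abs_divide divide_simps)
  qed simp
  then show ?thesis using L by blast
qed

lemma convex_order_continuous:
  assumes J: "open J" "is_interval J" and cv: "convex_order J m \<phi>" and m: "2 \<le> m"
  shows "continuous_on J \<phi>"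
proof -
  have "isCont \<phi> x" if x: "x \<in> J" for x
  proof -
    obtain e where e: "e > 0" "{x - e..x + e} \<subseteq> J" using open_interval_cball J x by metis
    then have "x - e \<in> J" "x + e \<in> J" by auto
    then obtain L where L: "L \<ge> 0" "\<And>y z. y \<in> {x - e..x + e} \<Longrightarrow> z \<in> {x - e..x + e} \<Longrightarrow> \<bar>\<phi> y - \<phi> z\<bar> \<le> L * \<bar>y - z\<bar>"
      using convex_order_lipschitz[OF J cv m] by metis
    have "L-lipschitz_on {x - e..x + e} \<phi>"
      using L by (auto simp: lipschitz_on_def dist_real_def)
    then have "continuous_on {x - e..x + e} \<phi>" by (rule lipschitz_on_continuous_on)
    then show ?thesis using e by (simp add: continuous_on_interior)
  qed
  then show ?thesis by (simp add: continuous_at_imp_continuous_on)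
qed

section \<open>Right difference quotients\<close>

text \<open>Steps 1 / (k + 1) suffice for the one-sided derivatives below, and a sequence of steps
  is what dominated convergence asks for.\<close>

definition rquot :: "(real \<Rightarrow> real) \<Rightarrow> real \<Rightarrow> nat \<Rightarrow> real" where
  "rquot \<phi> x k = (\<phi> (x + 1 / real (Suc k)) - \<phi> x) * real (Suc k)"

lemma inverse_step_tendsto: "(\<lambda>k. 1 / real (Suc k)) \<longlonglongrightarrow> 0"
  using LIMSEQ_inverse_real_of_nat by (simp add: inverse_eq_divide)

lemma eventually_step_mem:
  assumes "open J" "x \<in> J"
  shows "\<forall>\<^sub>F k in sequentially. {x..x + 1 / real (Suc k)} \<subseteq> J"
proof -
  obtain e where e: "e > 0" "{x - e..x + e} \<subseteq> J" using open_interval_cball assms by metis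
  have "\<forall>\<^sub>F k in sequentially. 1 / real (Suc k) < e"
    using inverse_step_tendsto e(1) by (rule order_tendstoD)
  then show ?thesis
  proof eventually_elim
    case (elim k)
    then have "{x..x + 1 / real (Suc k)} \<subseteq> {x - e..x + e}" using e(1) by auto
    then show ?case using e by blast
  qed
qed

text \<open>Divided differences with three nodes are bounded below by some -C, with C = 0 for m = 2.
  Adding C times the step therefore makes the quotients decrease as the step shrinks, and the
  Lipschitz bound keeps them bounded below.\<close>

lemma convex_order_right_derivative:
  assumes J: "open J" "is_interval J" and cv: "convex_order J m \<phi>" and m: "2 \<le> m" and x: "x \<in> J"
  shows "convergent (rquot \<phi> x)"
proof -
  obtain e where e: "e > 0" "{x - e..x + e} \<subseteq> J" using open_interval_cball J x by metis
  then have xe: "x \<in> J" "x + e \<in> J" by auto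
  obtain L where L: "L \<ge> 0" "\<And>y z. y \<in> {x..x + e} \<Longrightarrow> z \<in> {x..x + e} \<Longrightarrow> \<bar>\<phi> y - \<phi> z\<bar> \<le> L * \<bar>y - z\<bar>"
    using convex_order_lipschitz[OF J cv m xe] by metis
  have "\<exists>C\<ge>0. \<forall>B\<subseteq>{x..x + e}. card B = 3 \<longrightarrow> - C \<le> dd B \<phi>"
  proof (cases "m = 2")
    case True
    have "{x..x + e} \<subseteq> J" using e by auto
    then have "- 0 \<le> dd B \<phi>" if "B \<subseteq> {x..x + e}" "card B = 3" for B
      using cv True that by (simp add: convex_order_def)
    then show ?thesis by blast
  next
    case False
    then obtain L where L: "L \<ge> 0" "\<forall>B\<subseteq>{x..x + e}. card B = 3 \<longrightarrow> \<bar>dd B \<phi>\<bar> \<le> L"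
      using dd_bounded[OF J cv _ _ xe, of 3] m by (metis One_nat_def Suc_leI le_neq_implies_less numeral_2_eq_2 numeral_3_eq_3 one_le_numeral)
    have "- L \<le> dd B \<phi>" if "B \<subseteq> {x..x + e}" "card B = 3" for B
      using L(2)[rule_format, of B] that by linarith
    then show ?thesis using L(1) by blast
  qed
  then obtain C where C: "C \<ge> 0" "\<And>B. B \<subseteq> {x..x + e} \<Longrightarrow> card B = 3 \<Longrightarrow> - C \<le> dd B \<phi>" by blast
  define h where "h k = 1 / real (Suc k)" for k
  have hpos: "h k > 0" for k by (simp add: h_def)
  have hdec: "h (Suc k) < h k" for k by (simp add: h_def divide_simps)
  have rq: "rquot \<phi> x k = dd {x + h k, x} \<phi>" for k
    using hpos[of k] by (subst dd_pair) (auto simp: rquot_def h_def)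
  obtain K where K: "\<And>k. k \<ge> K \<Longrightarrow> h k < e"
    using order_tendstoD(2)[OF inverse_step_tendsto e(1)] unfolding eventually_sequentially h_def by blast
  define X where "X k = rquot \<phi> x (k + K) + C * h (k + K)" for k
  have "decseq X"
  proof (rule decseq_SucI)
    fix k
    let ?p = "h (Suc (k + K))" and ?q = "h (k + K)"
    have pq: "0 < ?p" "?p < ?q" "?q < e" using hpos hdec K by auto
    have "dd {x + ?q, x} \<phi> - dd {x + ?p, x} \<phi> = (?q - ?p) * dd (insert (x + ?q) (insert (x + ?p) {x})) \<phi>"
      using dd_rec'[of "{x}" "x + ?q" "x + ?p" \<phi>] pq by simp
    moreover have "- C \<le> dd (insert (x + ?q) (insert (x + ?p) {x})) \<phi>"
      using pq by (intro C) auto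
    then have "(?q - ?p) * (- C) \<le> (?q - ?p) * dd (insert (x + ?q) (insert (x + ?p) {x})) \<phi>"
      using pq by (intro mult_left_mono) auto
    ultimately show "X (Suc k) \<le> X k"
      unfolding X_def rq by (simp add: algebra_simps)
  qed
  moreover have "- L \<le> X k" for k
  proof -
    have pq: "0 < h (k + K)" "h (k + K) < e" using hpos K by auto
    then have "\<bar>\<phi> (x + h (k + K)) - \<phi> x\<bar> \<le> L * h (k + K)" using L(2)[of "x + h (k + K)" x] by simp
    then have "\<bar>rquot \<phi> x (k + K)\<bar> \<le> L"
      unfolding rq using pq(1) by (subst dd_pair) (auto simp: abs_divide divide_simps)
    then show ?thesis unfolding X_def using mult_nonneg_nonneg[OF C(1) less_imp_le[OF pq(1)]] by linarith
  qed
  ultimately obtain l where "X \<longlonglongrightarrow> l" using decseq_convergent by metis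
  moreover have "(\<lambda>k. C * h (k + K)) \<longlonglongrightarrow> C * 0"
    unfolding h_def by (intro tendsto_intros LIMSEQ_ignore_initial_segment inverse_step_tendsto)
  ultimately have "(\<lambda>k. X k - C * h (k + K)) \<longlonglongrightarrow> l - C * 0" by (rule tendsto_diff)
  then have "(\<lambda>k. rquot \<phi> x (k + K)) \<longlonglongrightarrow> l" by (simp add: X_def)
  then show ?thesis using LIMSEQ_offset convergent_def by blast
qed

text \<open>If \<Phi> b < \<Phi> a, uncountably many levels lie between, so some level y is not
  attained on C. At the last point x with \<Phi> x \<ge> y equality holds, hence x is not in C, and
  the positive limit of the quotients produces a later such point.\<close>

lemma increasing_of_right_quotients:
  assumes ab: "a \<le> b" and cont: "continuous_on {a..b} \<Phi>" and C: "countable C"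
    and lim: "\<And>x. x \<in> {a..<b} - C \<Longrightarrow> \<exists>l>0. rquot \<Phi> x \<longlonglongrightarrow> l"
  shows "\<Phi> a \<le> \<Phi> b"
proof (rule ccontr)
  assume "\<not> \<Phi> a \<le> \<Phi> b"
  then have lt: "\<Phi> b < \<Phi> a" by simp
  have "uncountable {\<Phi> b<..<\<Phi> a}" using lt by (rule iffD2[OF uncountable_open_interval])
  then have "\<not> {\<Phi> b<..<\<Phi> a} \<subseteq> \<Phi> ` C" using countable_subset[OF _ countable_image[OF C]] by (rule contrapos_nn)
  then obtain y where "y \<in> {\<Phi> b<..<\<Phi> a}" and y3: "y \<notin> \<Phi> ` C" by (meson subsetI)
  then have y: "\<Phi> b < y" "y < \<Phi> a" "y \<notin> \<Phi> ` C" by simp_all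
  define S where "S = {x \<in> {a..b}. y \<le> \<Phi> x}"
  have "S = {a..b} \<inter> \<Phi> -` {y..}" by (auto simp: S_def)
  then have "closed S" using continuous_closed_preimage[OF cont] by simp
  moreover have "a \<in> S" using ab y by (simp add: S_def)
  moreover have bd: "bdd_above S" by (auto simp: S_def)
  ultimately have xS: "Sup S \<in> S" using closed_contains_Sup by blast
  define x where "x = Sup S"
  have x: "x \<in> {a..b}" "y \<le> \<Phi> x" using xS by (auto simp: S_def x_def)
  have up: "z \<le> x" if "z \<in> S" for z using cSup_upper[OF that bd] by (simp add: x_def)
  have xb: "x < b" using x y by (cases "x = b") auto
  have "\<exists>z\<ge>x. z \<le> b \<and> \<Phi> z = y"
    by (rule IVT2') (use x y xb continuous_on_subset[OF cont] in auto)
  then obtain z where z: "x \<le> z" "z \<le> b" "\<Phi> z = y" by blast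
  then have "z = x" using up[of z] x by (auto simp: S_def)
  then have xy: "\<Phi> x = y" using z by simp
  then have "x \<in> {a..<b} - C" using y x xb by auto
  then obtain l where l: "l > 0" "rquot \<Phi> x \<longlonglongrightarrow> l" using lim by blast
  have "\<forall>\<^sub>F k in sequentially. rquot \<Phi> x k > 0" using order_tendstoD(1)[OF l(2,1)] .
  moreover have "\<forall>\<^sub>F k in sequentially. 1 / real (Suc k) < b - x"
    using order_tendstoD(2)[OF inverse_step_tendsto] xb by simp
  ultimately have "\<forall>\<^sub>F k in sequentially. False"
  proof eventually_elim
    case (elim k)
    then have "\<Phi> (x + 1 / real (Suc k)) > y" using xy by (simp add: rquot_def zero_less_mult_iff)
    then have "x + 1 / real (Suc k) \<in> S" using elim x by (auto simp: S_def intro: add_nonneg_nonneg order_trans)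
    then show False using up by fastforce
  qed
  then show False by simp
qed

text \<open>Both \<Phi> and -\<Phi> become increasing after adding \<epsilon> * x, since the
  quotients then tend to \<epsilon> > 0; finally \<epsilon> tends to 0.\<close>

lemma constant_of_right_quotients:
  assumes J: "is_interval J" and cont: "continuous_on J \<Phi>" and C: "countable C"
    and lim: "\<And>x. x \<in> J - C \<Longrightarrow> rquot \<Phi> x \<longlonglongrightarrow> 0"
    and ab: "a \<in> J" "b \<in> J"
  shows "\<Phi> a = \<Phi> b"
proof -
  have *: "\<Phi> a = \<Phi> b" if ab: "a \<in> J" "b \<in> J" "a \<le> b" for a b
  proof -
    have sub: "{a..b} \<subseteq> J" using interval_segment J ab by blast
    have inc: "s * \<Phi> a + \<epsilon> * a \<le> s * \<Phi> b + \<epsilon> * b" if "\<epsilon> > 0" for s \<epsilon> :: real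
    proof (rule increasing_of_right_quotients[OF ab(3) _ C])
      show "continuous_on {a..b} (\<lambda>x. s * \<Phi> x + \<epsilon> * x)"
        using continuous_on_subset[OF cont sub] by (intro continuous_intros)
      fix x assume "x \<in> {a..<b} - C"
      then have r0: "rquot \<Phi> x \<longlonglongrightarrow> 0" using sub by (intro lim) auto
      have "(\<lambda>k. s * rquot \<Phi> x k + \<epsilon>) \<longlonglongrightarrow> s * 0 + \<epsilon>"
        by (intro tendsto_intros r0)
      moreover have "rquot (\<lambda>x. s * \<Phi> x + \<epsilon> * x) x = (\<lambda>k. s * rquot \<Phi> x k + \<epsilon>)"
        by (auto simp: rquot_def field_simps)
      ultimately have "rquot (\<lambda>x. s * \<Phi> x + \<epsilon> * x) x \<longlonglongrightarrow> s * 0 + \<epsilon>"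
        by simp
      then show "\<exists>l>0. rquot (\<lambda>x. s * \<Phi> x + \<epsilon> * x) x \<longlonglongrightarrow> l" using that by auto
    qed
    have le: "s * \<Phi> a \<le> s * \<Phi> b" for s
    proof (rule field_le_epsilon)
      fix e :: real assume e: "e > 0"
      \<comment> \<open>The summand 1 keeps the denominator positive when a = b.\<close>
      define \<epsilon> where "\<epsilon> = e / (b - a + 1)"
      have "\<epsilon> > 0" "\<epsilon> * (b - a) \<le> e" using e ab(3) by (auto simp: \<epsilon>_def field_simps)
      then show "s * \<Phi> a \<le> s * \<Phi> b + e" using inc[of \<epsilon> s] by (simp add: algebra_simps)
    qed
    show ?thesis using le[of 1] le[of "-1"] by linarith
  qed
  consider "a \<le> b" | "b \<le> a" by linarith
  then show ?thesis
  proof cases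
    case 1
    then show ?thesis by (rule *[OF ab])
  next
    case 2
    then show ?thesis by (rule *[OF ab(2,1), symmetric])
  qed
qed

section \<open>The kernels and their integrals\<close>

lemma space_box_borel [simp]: "space (box_borel d I) = PiE {..<d} I"
  by (simp add: box_borel_def space_measure_of_conv)

lemma open_in_box_borel:
  assumes "openin (box_topology d I) U"
  shows "U \<in> sets (box_borel d I)"
proof -
  have "{U. openin (box_topology d I) U} \<subseteq> Pow (PiE {..<d} I)"
  proof (intro subsetI, unfold mem_Collect_eq Pow_iff)
    fix V assume "openin (box_topology d I) V"
    from openin_subset[OF this] show "V \<subseteq> PiE {..<d} I" by (simp only: topspace_box_topology)
  qed
  then show ?thesis using assms by (simp add: box_borel_def)
qed

lemma continuous_map_box_coordinate:
  assumes "i < d"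
  shows "continuous_map (box_topology d I) euclidean (\<lambda>u. u i)"
proof -
  have "continuous_map (box_topology d I) (top_of_set (I i)) (\<lambda>u. u i)"
    unfolding box_topology_def using assms by (intro continuous_map_product_projection) simp
  then show ?thesis by (simp add: continuous_map_in_subtopology)
qed

lemma openin_box_coordinate:
  assumes "i < d" "open S"
  shows "openin (box_topology d I) {u \<in> PiE {..<d} I. u i \<in> S}"
  using openin_continuous_map_preimage[OF continuous_map_box_coordinate[OF assms(1), of I], of S] assms
  by (simp add: topspace_box_topology)

lemma measurable_box_coordinate [measurable]:
  assumes "i < d"
  shows "(\<lambda>u. u i) \<in> borel_measurable (box_borel d I)"
proof (rule borel_measurableI)
  fix S :: "real set" assume "open S"
  have "(\<lambda>u. u i) -` S \<inter> space (box_borel d I) = {u \<in> PiE {..<d} I. u i \<in> S}" by auto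
  then show "(\<lambda>u. u i) -` S \<inter> space (box_borel d I) \<in> sets (box_borel d I)"
    using open_in_box_borel[OF openin_box_coordinate[OF assms \<open>open S\<close>]] by simp
qed

definition kern :: "side \<Rightarrow> nat \<Rightarrow> real \<Rightarrow> real \<Rightarrow> real \<Rightarrow> real" where
  "kern b m a x u = (x - u) ^ m / fact m * chi b a x u"

definition sides :: "nat \<Rightarrow> (nat \<Rightarrow> side) set" where
  "sides d = PiE {..<d} (\<lambda>_. {SideL, SideR})"

lemma finite_sides: "finite (sides d)"
  by (simp add: sides_def finite_PiE)

definition hrep :: "nat \<Rightarrow> (nat \<Rightarrow> nat) \<Rightarrow> (nat \<Rightarrow> real) \<Rightarrow> ((nat \<Rightarrow> side) \<Rightarrow> (nat \<Rightarrow> real) measure) \<Rightarrow>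
    (nat \<Rightarrow> real) \<Rightarrow> real" where
  "hrep d n \<alpha> \<mu> x = (\<Sum>b\<in>sides d. \<integral>u. (\<Prod>j<d. kern (b j) (n j - 1) (\<alpha> j) (x j) (u j)) \<partial>\<mu> b)"

definition loc_finite_on :: "nat \<Rightarrow> (nat \<Rightarrow> real set) \<Rightarrow> (nat \<Rightarrow> real) measure \<Rightarrow> bool" where
  "loc_finite_on d I M \<longleftrightarrow> space M = PiE {..<d} I \<and> sets M = sets (box_borel d I) \<and>
     (\<forall>K. compactin (box_topology d I) K \<longrightarrow> emeasure M K < \<infinity>)"

definition admissible :: "nat \<Rightarrow> (nat \<Rightarrow> real set) \<Rightarrow> ((nat \<Rightarrow> side) \<Rightarrow> (nat \<Rightarrow> real) measure) \<Rightarrow> bool" where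
  "admissible d I \<mu> \<longleftrightarrow> (\<forall>b\<in>sides d. loc_finite_on d I (\<mu> b) \<and>
     (\<forall>i<d. b i = SideL \<longrightarrow> discrete_measure (marginal i (\<mu> b))))"

lemma chi_eq:
  "chi b a x u = (if u < x \<or> b = SideR \<and> u = x then 1 else 0) - (if u < a \<or> b = SideR \<and> u = a then 1 else 0)"
  by (cases b) (auto simp: indicator_def)

lemma kern_zero: "u \<notin> {min a x..max a x} \<Longrightarrow> kern b m a x u = 0"
  by (auto simp: kern_def chi_eq min_def max_def split: if_splits)

lemma kern_bound: "\<bar>kern b m a x u\<bar> \<le> \<bar>x - a\<bar> ^ m"
proof (cases "u \<in> {min a x..max a x}")
  case True
  then have "\<bar>x - u\<bar> \<le> \<bar>x - a\<bar>" by auto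
  then have "\<bar>x - u\<bar> ^ m \<le> \<bar>x - a\<bar> ^ m" by (intro power_mono) auto
  moreover have "\<bar>chi b a x u\<bar> \<le> 1" by (simp add: chi_eq)
  moreover have "\<bar>x - u\<bar> ^ m / fact m \<le> \<bar>x - u\<bar> ^ m"
    by (simp add: divide_le_eq mult_le_cancel_left1 fact_ge_1)
  ultimately have "\<bar>x - u\<bar> ^ m / fact m * \<bar>chi b a x u\<bar> \<le> \<bar>x - a\<bar> ^ m * 1"
    by (intro mult_mono) auto
  then show ?thesis by (simp add: kern_def abs_mult power_abs)
next
  case False
  then show ?thesis using kern_zero by simp
qed

lemma measurable_kern [measurable]: "kern b m a x \<in> borel_measurable borel"
  unfolding kern_def chi_eq by measurable

text \<open>As a function of x the kernel is a truncated power minus a multiple of (x - u) ^ m. The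
  nodes annihilate the latter, so the base point a leaves no trace in the difference.\<close>

lemma dd_kern_nonneg:
  assumes "card A = Suc (Suc m)"
  shows "0 \<le> dd A (\<lambda>x. kern b m a x u)"
proof -
  define c where "c = (if u < a \<or> b = SideR \<and> u = a then 1 else 0 :: real)"
  have "dd A (\<lambda>x. kern b m a x u) = dd A (\<lambda>x. 1 / fact m * trunc_power b m u x - c / fact m * (x - u) ^ m)"
    by (rule dd_cong) (auto simp: kern_def chi_eq trunc_power_def c_def field_simps)
  also have "\<dots> = 1 / fact m * dd A (trunc_power b m u) - c / fact m * dd A (\<lambda>x. (x - u) ^ m)"
    by (simp only: dd_diff dd_cmult)
  also have "dd A (\<lambda>x. (x - u) ^ m) = 0" by (rule dd_shifted_power) (use assms in simp)
  also have "0 \<le> 1 / fact m * dd A (trunc_power b m u) - c / fact m * 0"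
    using dd_trunc_power_nonneg[of A m b u] assms by simp
  finally show ?thesis .
qed

lemma box_measure_finite:
  assumes M: "loc_finite_on d I M" and pq: "\<And>i. i < d \<Longrightarrow> {p i..q i} \<subseteq> I i"
  shows "PiE {..<d} (\<lambda>i. {p i..q i}) \<in> sets M" "emeasure M (PiE {..<d} (\<lambda>i. {p i..q i})) < \<infinity>"
proof -
  have sp: "space M = PiE {..<d} I" and st [measurable_cong]: "sets M = sets (box_borel d I)"
    using M by (auto simp: loc_finite_on_def)
  have [measurable]: "(\<lambda>u. u i) \<in> borel_measurable M" if "i < d" for i
    using that by measurable
  have eq: "PiE {..<d} (\<lambda>i. {p i..q i}) = {u \<in> space M. \<forall>i\<in>{..<d}. p i \<le> u i \<and> u i \<le> q i}"
    using pq by (auto simp: sp PiE_def Pi_def subset_iff)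
  have "{u \<in> space M. \<forall>i\<in>{..<d}. p i \<le> u i \<and> u i \<le> q i} \<in> sets M"
    by (intro sets.sets_Collect_finite_All) auto
  then show "PiE {..<d} (\<lambda>i. {p i..q i}) \<in> sets M" by (simp add: eq)
  have "compactin (box_topology d I) (PiE {..<d} (\<lambda>i. {p i..q i}))"
    unfolding box_topology_def compactin_PiE using pq by (auto simp: compactin_subtopology)
  then show "emeasure M (PiE {..<d} (\<lambda>i. {p i..q i})) < \<infinity>"
    using M by (auto simp: loc_finite_on_def)
qed

context
  fixes d :: nat and I :: "nat \<Rightarrow> real set" and \<alpha> :: "nat \<Rightarrow> real"
  assumes I: "\<And>i. i < d \<Longrightarrow> open (I i) \<and> is_interval (I i)"
    and \<alpha>: "\<alpha> \<in> PiE {..<d} I"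
begin

lemma measurable_kern_prod:
  assumes "sets M = sets (box_borel d I)" "S \<subseteq> {..<d}"
  shows "(\<lambda>u. \<Prod>j\<in>S. kern (b j) (n j) (\<alpha> j) (x j) (u j)) \<in> borel_measurable M"
proof (rule borel_measurable_prod)
  fix j assume "j \<in> S"
  then have "(\<lambda>u. u j) \<in> borel_measurable (box_borel d I)" using assms by auto
  then have "(\<lambda>u. u j) \<in> borel_measurable M" using assms measurable_cong_sets by blast
  from measurable_compose[OF this measurable_kern]
  show "(\<lambda>u. kern (b j) (n j) (\<alpha> j) (x j) (u j)) \<in> borel_measurable M" .
qed

lemma seg_sub:
  assumes "x \<in> PiE {..<d} I" "j < d"
  shows "{min (\<alpha> j) (x j)..max (\<alpha> j) (x j)} \<subseteq> I j"
proof -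
  have "\<alpha> j \<in> I j" "x j \<in> I j" using \<alpha> assms by auto
  then have "min (\<alpha> j) (x j) \<in> I j" "max (\<alpha> j) (x j) \<in> I j" by (simp_all add: min_def max_def)
  then show ?thesis using interval_segment I[OF assms(2)] by blast
qed

lemma integrable_kern_prod:
  assumes M: "loc_finite_on d I M" and x: "x \<in> PiE {..<d} I"
  shows "integrable M (\<lambda>u. \<Prod>j<d. kern (b j) (n j) (\<alpha> j) (x j) (u j))"
proof (rule integrableI_bounded_set)
  let ?B = "PiE {..<d} (\<lambda>j. {min (\<alpha> j) (x j)..max (\<alpha> j) (x j)})"
  show "?B \<in> sets M" "emeasure M ?B < \<infinity>"
    using box_measure_finite[OF M, of "\<lambda>j. min (\<alpha> j) (x j)" "\<lambda>j. max (\<alpha> j) (x j)"] seg_sub[OF x] by auto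
  show "(\<lambda>u. \<Prod>j<d. kern (b j) (n j) (\<alpha> j) (x j) (u j)) \<in> borel_measurable M"
    by (rule measurable_kern_prod) (use M in \<open>auto simp: loc_finite_on_def\<close>)
  show "AE u in M. u \<in> ?B \<longrightarrow> norm (\<Prod>j<d. kern (b j) (n j) (\<alpha> j) (x j) (u j)) \<le> (\<Prod>j<d. \<bar>x j - \<alpha> j\<bar> ^ n j)"
    unfolding real_norm_def abs_prod by (intro AE_I2 impI prod_mono) (auto intro: kern_bound)
  show "AE u in M. u \<notin> ?B \<longrightarrow> (\<Prod>j<d. kern (b j) (n j) (\<alpha> j) (x j) (u j)) = 0"
  proof (intro AE_I2 impI)
    fix u assume "u \<in> space M" "u \<notin> ?B"
    then have "u \<in> extensional {..<d}" "\<exists>j<d. u j \<notin> {min (\<alpha> j) (x j)..max (\<alpha> j) (x j)}"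
      using M unfolding loc_finite_on_def by (auto simp: PiE_def Pi_def)
    then obtain j where "j < d" "kern (b j) (n j) (\<alpha> j) (x j) (u j) = 0" using kern_zero by metis
    then show "(\<Prod>j<d. kern (b j) (n j) (\<alpha> j) (x j) (u j)) = 0" by auto
  qed
qed

end

lemma mdd_integral:
  assumes "\<And>k. k \<in> PiE S A \<Longrightarrow> integrable M (K (\<lambda>j. if j \<in> S then k j else x j))"
  shows "mdd S A (\<lambda>x. \<integral>u. K x u \<partial>M) x = (\<integral>u. mdd S A (\<lambda>x. K x u) x \<partial>M)"
    and "integrable M (\<lambda>u. mdd S A (\<lambda>x. K x u) x)"
proof -
  show "mdd S A (\<lambda>x. \<integral>u. K x u \<partial>M) x = (\<integral>u. mdd S A (\<lambda>x. K x u) x \<partial>M)"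
    unfolding mdd_def mop_def using assms by (subst Bochner_Integration.integral_sum) auto
  show "integrable M (\<lambda>u. mdd S A (\<lambda>x. K x u) x)"
    unfolding mdd_def mop_def using assms by auto
qed

lemma node_point:
  assumes "nodes d I n A" "k \<in> PiE {..<d} A"
  shows "(\<lambda>j. if j \<in> {..<d} then k j else undefined) \<in> PiE {..<d} I"
proof -
  have "k j \<in> I j" if "j < d" for j
    using PiE_mem[OF assms(2), of j] assms(1) that unfolding nodes_def by auto
  then show ?thesis by (intro PiE_I) simp_all
qed

text \<open>The integrand is a product over the coordinates, so its mixed difference is the product
  of one-dimensional divided differences.\<close>

lemma mdd_hrep:
  assumes I: "\<And>i. i < d \<Longrightarrow> open (I i) \<and> is_interval (I i)"
    and \<alpha>: "\<alpha> \<in> PiE {..<d} I" and adm: "admissible d I \<mu>" and A: "nodes d I n' A"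
  shows "mdd {..<d} A (hrep d n \<alpha> \<mu>) pt =
    (\<Sum>b\<in>sides d. \<integral>u. (\<Prod>j<d. dd (A j) (\<lambda>x. kern (b j) (n j - 1) (\<alpha> j) x (u j))) \<partial>\<mu> b)"
proof -
  have "mdd {..<d} A (hrep d n \<alpha> \<mu>) pt =
    (\<Sum>b\<in>sides d. mdd {..<d} A (\<lambda>x. \<integral>u. (\<Prod>j<d. kern (b j) (n j - 1) (\<alpha> j) (x j) (u j)) \<partial>\<mu> b) pt)"
    unfolding hrep_def by (rule mdd_sum)
  also have "\<dots> = (\<Sum>b\<in>sides d. \<integral>u. (\<Prod>j<d. dd (A j) (\<lambda>x. kern (b j) (n j - 1) (\<alpha> j) x (u j))) \<partial>\<mu> b)"
  proof (rule sum.cong[OF refl])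
    fix b assume b: "b \<in> sides d"
    let ?K = "\<lambda>x u. \<Prod>j<d. kern (b j) (n j - 1) (\<alpha> j) (x j) (u j)"
    have M: "loc_finite_on d I (\<mu> b)" using adm b by (auto simp: admissible_def)
    have "mdd {..<d} A (\<lambda>x. \<integral>u. ?K x u \<partial>\<mu> b) pt = (\<integral>u. mdd {..<d} A (\<lambda>x. ?K x u) pt \<partial>\<mu> b)"
      by (rule mdd_integral) (intro integrable_kern_prod[OF I \<alpha> M] node_point[OF A])
    also have "(\<lambda>u. mdd {..<d} A (\<lambda>x. ?K x u) pt)
        = (\<lambda>u. \<Prod>j<d. dd (A j) (\<lambda>x. kern (b j) (n j - 1) (\<alpha> j) x (u j)))"
      unfolding mdd_def dd_def
      by (intro ext mop_prod[of "{..<d}" A _ "\<lambda>i a. a" "\<lambda>j x. kern (b j) (n j - 1) (\<alpha> j) x (_ j)"])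
        (use nodes_finite[OF A] in auto)
    finally show "mdd {..<d} A (\<lambda>x. \<integral>u. ?K x u \<partial>\<mu> b) pt
      = (\<integral>u. (\<Prod>j<d. dd (A j) (\<lambda>x. kern (b j) (n j - 1) (\<alpha> j) x (u j))) \<partial>\<mu> b)" .
  qed
  finally show ?thesis .
qed

lemma mdd_hrep_nonneg:
  assumes I: "\<And>i. i < d \<Longrightarrow> open (I i) \<and> is_interval (I i)"
    and \<alpha>: "\<alpha> \<in> PiE {..<d} I" and adm: "admissible d I \<mu>" and A: "nodes d I n A"
    and n: "\<And>i. i < d \<Longrightarrow> 1 \<le> n i"
  shows "0 \<le> mdd {..<d} A (hrep d n \<alpha> \<mu>) pt"
proof -
  have "0 \<le> (\<Sum>b\<in>sides d. \<integral>u. (\<Prod>j<d. dd (A j) (\<lambda>x. kern (b j) (n j - 1) (\<alpha> j) x (u j))) \<partial>\<mu> b)"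
  proof (intro sum_nonneg integral_nonneg_AE AE_I2 prod_nonneg)
  fix b u j assume "j \<in> {..<d}"
  then show "0 \<le> dd (A j) (\<lambda>x. kern (b j) (n j - 1) (\<alpha> j) x (u j))"
    using A n[of j] by (intro dd_kern_nonneg) (auto simp: nodes_def)
  qed
  also have "\<dots> = mdd {..<d} A (hrep d n \<alpha> \<mu>) pt"
    by (rule mdd_hrep[OF I \<alpha> adm A, symmetric])
  finally show ?thesis .
qed

section \<open>Continuity and right derivatives of the integrals\<close>

lemma power_diff_le:
  fixes p q :: real
  assumes "\<bar>p\<bar> \<le> D" "\<bar>q\<bar> \<le> D"
  shows "\<bar>p ^ m - q ^ m\<bar> \<le> m * D ^ (m - 1) * \<bar>p - q\<bar>"
proof -
  have "\<bar>\<Sum>i<m. q ^ (m - Suc i) * p ^ i\<bar> \<le> (\<Sum>i<m. D ^ (m - 1))"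
  proof (rule order_trans[OF sum_abs sum_mono])
    fix i assume i: "i \<in> {..<m}"
    have "\<bar>q ^ (m - Suc i) * p ^ i\<bar> \<le> D ^ (m - Suc i) * D ^ i"
      unfolding abs_mult power_abs using assms by (intro mult_mono power_mono) auto
    also have "\<dots> = D ^ (m - 1)" using i by (simp add: power_add[symmetric])
    finally show "\<bar>q ^ (m - Suc i) * p ^ i\<bar> \<le> D ^ (m - 1)" .
  qed
  then have "\<bar>p - q\<bar> * \<bar>\<Sum>i<m. q ^ (m - Suc i) * p ^ i\<bar> \<le> \<bar>p - q\<bar> * (m * D ^ (m - 1))"
    by (intro mult_left_mono) auto
  then show ?thesis unfolding power_diff_sumr2 abs_mult by (simp add: mult_ac)
qed

text \<open>For m \<ge> 1 both (x - u)_+ ^ m and (x - u) ^ m are Lipschitz in x on [a, c]; each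
  accounts for one half of the factor 2. For u outside [a, c] both kernels vanish, hence the
  indicator.\<close>

lemma kern_lipschitz:
  assumes ac: "\<alpha> \<in> {a..c}" "v \<in> {a..c}" "w \<in> {a..c}" and m: "1 \<le> m"
  shows "\<bar>kern b m \<alpha> v u - kern b m \<alpha> w u\<bar> \<le> 2 * real m * (c - a) ^ (m - 1) * \<bar>v - w\<bar> * indicator {a..c} u"
proof (cases "u \<in> {a..c}")
  case True
  define s where "s = (if u < \<alpha> \<or> b = SideR \<and> u = \<alpha> then 1 else 0 :: real)"
  \<comment> \<open>The value at the knot x = u is 0 because m \<ge> 1, so the side survives only in
    s.\<close>
  have eq: "kern b m \<alpha> x u = (max 0 (x - u) ^ m - s * (x - u) ^ m) / fact m" for x
    using m by (auto simp: kern_def chi_eq s_def max_def field_simps)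
  let ?R = "m * (c - a) ^ (m - 1) * \<bar>v - w\<bar>"
  have R0: "0 \<le> ?R" using ac by (intro mult_nonneg_nonneg zero_le_power) auto
  have "\<bar>max 0 (v - u) ^ m - max 0 (w - u) ^ m\<bar> \<le> m * (c - a) ^ (m - 1) * \<bar>max 0 (v - u) - max 0 (w - u)\<bar>"
    by (rule power_diff_le) (use ac True in \<open>auto simp: max_def\<close>)
  also have "\<dots> \<le> ?R"
    using ac by (intro mult_left_mono mult_nonneg_nonneg zero_le_power) auto
  finally have 1: "\<bar>max 0 (v - u) ^ m - max 0 (w - u) ^ m\<bar> \<le> ?R" .
  have "\<bar>(v - u) ^ m - (w - u) ^ m\<bar> \<le> m * (c - a) ^ (m - 1) * \<bar>(v - u) - (w - u)\<bar>"
    by (rule power_diff_le) (use ac True in auto)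
  then have 2: "\<bar>s * (v - u) ^ m - s * (w - u) ^ m\<bar> \<le> ?R"
    using R0 by (simp add: s_def)
  have "\<bar>kern b m \<alpha> v u - kern b m \<alpha> w u\<bar>
     = \<bar>(max 0 (v - u) ^ m - max 0 (w - u) ^ m) - (s * (v - u) ^ m - s * (w - u) ^ m)\<bar> / fact m"
    unfolding eq by (simp add: diff_divide_distrib[symmetric] abs_divide algebra_simps)
  also have "\<dots> \<le> (?R + ?R) / 1"
  proof (rule frac_le)
    show "0 \<le> ?R + ?R" using R0 by linarith
    show "\<bar>(max 0 (v - u) ^ m - max 0 (w - u) ^ m) - (s * (v - u) ^ m - s * (w - u) ^ m)\<bar> \<le> ?R + ?R"
      using 1 2 by linarith
  qed (auto simp: fact_ge_1)
  finally show ?thesis using True by (simp add: mult_ac)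
next
  case False
  have "{min \<alpha> v..max \<alpha> v} \<subseteq> {a..c}" "{min \<alpha> w..max \<alpha> w} \<subseteq> {a..c}" using ac by auto
  then have "u \<notin> {min \<alpha> v..max \<alpha> v}" "u \<notin> {min \<alpha> w..max \<alpha> w}" using False by blast+
  from kern_zero[OF this(1)] kern_zero[OF this(2)] show ?thesis using False by simp
qed

lemma rquot_of_DERIV:
  assumes "(f has_real_derivative D) (at x)"
  shows "rquot f x \<longlonglongrightarrow> D"
proof -
  have "filterlim (\<lambda>k. 1 / real (Suc k)) (at 0) sequentially"
    by (intro filterlim_atI inverse_step_tendsto) auto
  from filterlim_compose[OF assms[unfolded DERIV_def] this]
  have "(\<lambda>k. (f (x + 1 / real (Suc k)) - f x) / (1 / real (Suc k))) \<longlonglongrightarrow> D" .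
  then show ?thesis by (simp add: rquot_def[abs_def])
qed

text \<open>For u = v the first indicator in \<open>chi\<close> is 1 at every point to the right of
  v. At v itself it is 1 for SideR but 0 for SideL, so on side L the knot has to be
  excluded.\<close>

lemma rquot_kern:
  assumes m: "1 \<le> m" and u: "u \<noteq> v \<or> b = SideR"
  shows "rquot (\<lambda>x. kern b m \<alpha> x u) v \<longlonglongrightarrow> kern b (m - 1) \<alpha> v u"
proof -
  have "\<forall>\<^sub>F k in sequentially. chi b \<alpha> (v + 1 / real (Suc k)) u = chi b \<alpha> v u"
  proof (cases "v < u")
    case True
    then have "\<forall>\<^sub>F k in sequentially. 1 / real (Suc k) < u - v"
      using order_tendstoD(2)[OF inverse_step_tendsto] by simp
    then show ?thesis
    proof eventually_elim
      case (elim k)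
      then have "v + 1 / real (Suc k) < u" by simp
      with True show ?case by (simp add: chi_eq)
    qed
  next
    case False
    have "u < v + 1 / real (Suc k)" for k using False by (intro le_less_trans[of u v]) auto
    then have "chi b \<alpha> (v + 1 / real (Suc k)) u = chi b \<alpha> v u" for k
      using False u by (auto simp: chi_eq)
    then show ?thesis by simp
  qed
  then have ev: "\<forall>\<^sub>F k in sequentially. rquot (\<lambda>x. (x - u) ^ m / fact m) v k * chi b \<alpha> v u
      = rquot (\<lambda>x. kern b m \<alpha> x u) v k"
  proof eventually_elim
    case (elim k)
    then show ?case by (simp add: rquot_def kern_def) (simp add: algebra_simps)
  qed
  have fm: "fact m = real m * fact (m - 1)" using m by (simp add: fact_reduce)
  have "((\<lambda>x. (x - u) ^ m / fact m) has_real_derivative (m * (v - u) ^ (m - 1) / fact m)) (at v)"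
    by (auto intro!: derivative_eq_intros)
  then have "((\<lambda>x. (x - u) ^ m / fact m) has_real_derivative ((v - u) ^ (m - 1) / fact (m - 1))) (at v)"
    using m unfolding fm by simp
  from rquot_of_DERIV[OF this]
  have "(\<lambda>k. rquot (\<lambda>x. (x - u) ^ m / fact m) v k * chi b \<alpha> v u) \<longlonglongrightarrow> (v - u) ^ (m - 1) / fact (m - 1) * chi b \<alpha> v u"
    by (rule tendsto_mult_right)
  from Lim_transform_eventually[OF this ev] show ?thesis by (simp add: kern_def)
qed

lemma infinite_open_real:
  fixes J :: "real set"
  assumes "open J" "x \<in> J"
  shows "infinite J"
proof -
  obtain e where "e > 0" "{x - e..x + e} \<subseteq> J" using open_interval_cball assms by metis
  moreover from this have "infinite {x - e..x + e}" by (intro infinite_Icc) simp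
  ultimately show ?thesis by (meson finite_subset)
qed

context
  fixes d :: nat and I :: "nat \<Rightarrow> real set" and \<alpha> :: "nat \<Rightarrow> real"
  assumes I: "\<And>i. i < d \<Longrightarrow> open (I i) \<and> is_interval (I i)"
    and \<alpha>: "\<alpha> \<in> PiE {..<d} I"
begin

lemma kern_prod_lipschitz:
  assumes i: "i < d" "1 \<le> n i" and x: "x \<in> PiE {..<d} I" and ac: "\<alpha> i \<in> {a..c}"
  defines "p \<equiv> \<lambda>j. if j = i then a else min (\<alpha> j) (x j)" and "q \<equiv> \<lambda>j. if j = i then c else max (\<alpha> j) (x j)"
  obtains B where "B \<ge> 0"
    "\<And>v w u. v \<in> {a..c} \<Longrightarrow> w \<in> {a..c} \<Longrightarrow> u \<in> PiE {..<d} I \<Longrightarrow>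
      \<bar>(\<Prod>j<d. kern (b j) (n j) (\<alpha> j) ((x(i := v)) j) (u j)) - (\<Prod>j<d. kern (b j) (n j) (\<alpha> j) ((x(i := w)) j) (u j))\<bar>
        \<le> B * \<bar>v - w\<bar> * indicator (PiE {..<d} (\<lambda>j. {p j..q j})) u"
proof -
  define S where "S = {..<d} - {i}"
  define B1 where "B1 = (\<Prod>j\<in>S. \<bar>x j - \<alpha> j\<bar> ^ n j)"
  define B2 where "B2 = 2 * real (n i) * (c - a) ^ (n i - 1)"
  have B1: "B1 \<ge> 0" unfolding B1_def by (intro prod_nonneg) auto
  have B2: "B2 \<ge> 0" using ac unfolding B2_def by (intro mult_nonneg_nonneg zero_le_power) auto
  define R where "R u = (\<Prod>j\<in>S. kern (b j) (n j) (\<alpha> j) (x j) (u j))" for u :: "nat \<Rightarrow> real"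
  have split: "(\<Prod>j<d. kern (b j) (n j) (\<alpha> j) ((x(i := v)) j) (u j)) = kern (b i) (n i) (\<alpha> i) v (u i) * R u" for v u
  proof -
    have "(\<Prod>j\<in>S. kern (b j) (n j) (\<alpha> j) ((x(i := v)) j) (u j)) = R u"
      unfolding R_def S_def by (intro prod.cong) auto
    then show ?thesis using i by (simp add: prod.remove[of "{..<d}" i] S_def)
  qed
  show thesis
  proof (rule that[of "B1 * B2"])
    show "0 \<le> B1 * B2" using B1 B2 by simp
    fix v w u assume vw: "v \<in> {a..c}" "w \<in> {a..c}" and u: "u \<in> PiE {..<d} I"
    let ?box = "PiE {..<d} (\<lambda>j. {p j..q j})"
    have K: "\<bar>kern (b i) (n i) (\<alpha> i) v (u i) - kern (b i) (n i) (\<alpha> i) w (u i)\<bar> \<le> B2 * \<bar>v - w\<bar> * indicator {a..c} (u i)"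
      unfolding B2_def by (rule kern_lipschitz[OF ac vw i(2)])
    have "\<bar>kern (b i) (n i) (\<alpha> i) v (u i) - kern (b i) (n i) (\<alpha> i) w (u i)\<bar> * \<bar>R u\<bar>
       \<le> B1 * B2 * \<bar>v - w\<bar> * indicator ?box u"
    proof (cases "u \<in> ?box")
      case True
      have "\<bar>R u\<bar> \<le> B1"
        unfolding R_def B1_def abs_prod by (intro prod_mono) (auto intro: kern_bound)
      moreover have "\<bar>kern (b i) (n i) (\<alpha> i) v (u i) - kern (b i) (n i) (\<alpha> i) w (u i)\<bar> \<le> B2 * \<bar>v - w\<bar>"
      proof (rule order_trans[OF K])
        have "B2 * \<bar>v - w\<bar> * indicator {a..c} (u i) \<le> B2 * \<bar>v - w\<bar> * 1"
          using B2 by (intro mult_left_mono) (auto simp: indicator_def)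
        then show "B2 * \<bar>v - w\<bar> * indicator {a..c} (u i) \<le> B2 * \<bar>v - w\<bar>" by simp
      qed
      ultimately have "\<bar>kern (b i) (n i) (\<alpha> i) v (u i) - kern (b i) (n i) (\<alpha> i) w (u i)\<bar> * \<bar>R u\<bar> \<le> (B2 * \<bar>v - w\<bar>) * B1"
        using B2 by (intro mult_mono) auto
      then show ?thesis using True by (simp add: mult_ac)
    next
      case False
      then obtain j where j: "j < d" "u j \<notin> {p j..q j}"
        using u unfolding PiE_def Pi_def by blast
      have "\<bar>kern (b i) (n i) (\<alpha> i) v (u i) - kern (b i) (n i) (\<alpha> i) w (u i)\<bar> * \<bar>R u\<bar> = 0"
      proof (cases "j = i")
        case True
        then have "u i \<notin> {a..c}" using j by (simp add: p_def q_def)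
        then show ?thesis using K by simp
      next
        case False
        then have "kern (b j) (n j) (\<alpha> j) (x j) (u j) = 0" using j by (intro kern_zero) (simp add: p_def q_def)
        moreover have "j \<in> S" "finite S" using j False by (auto simp: S_def)
        ultimately have "R u = 0" unfolding R_def using prod_zero by metis
        then show ?thesis by simp
      qed
      moreover have "0 \<le> B1 * B2 * \<bar>v - w\<bar> * indicator ?box u" using B1 B2 by simp
      ultimately show ?thesis by linarith
    qed
    then show "\<bar>(\<Prod>j<d. kern (b j) (n j) (\<alpha> j) ((x(i := v)) j) (u j)) - (\<Prod>j<d. kern (b j) (n j) (\<alpha> j) ((x(i := w)) j) (u j))\<bar>
        \<le> B1 * B2 * \<bar>v - w\<bar> * indicator ?box u"
      unfolding split left_diff_distrib[symmetric] abs_mult .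
  qed
qed

lemma upd_box: "x \<in> PiE {..<d} I \<Longrightarrow> i < d \<Longrightarrow> v \<in> I i \<Longrightarrow> x(i := v) \<in> PiE {..<d} I"
  by (simp add: PiE_iff extensional_def)

text \<open>A neighbourhood of v and the point \<alpha> i are put into one interval [a, c], so a
  single box of finite measure and a single constant serve all w near v. This is the dominating
  function for continuity and for differentiation under the integral.\<close>

lemma kern_integral_local:
  fixes b :: "nat \<Rightarrow> side"
  assumes i: "i < d" "1 \<le> n i" and x: "x \<in> PiE {..<d} I" and v: "v \<in> I i" and M: "loc_finite_on d I M"
  defines "K \<equiv> \<lambda>w u. \<Prod>j<d. kern (b j) (n j) (\<alpha> j) ((x(i := w)) j) (u j)"
  obtains e B S where "e > 0" "{v - e..v + e} \<subseteq> I i" "B \<ge> 0" "S \<in> sets M" "emeasure M S < \<infinity>"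
    "\<And>w w' u. w \<in> {v - e..v + e} \<Longrightarrow> w' \<in> {v - e..v + e} \<Longrightarrow> u \<in> space M \<Longrightarrow>
       \<bar>K w u - K w' u\<bar> \<le> B * \<bar>w - w'\<bar> * indicator S u"
proof -
  have sp: "space M = PiE {..<d} I" using M by (simp add: loc_finite_on_def)
  obtain e where e: "e > 0" "{v - e..v + e} \<subseteq> I i" using open_interval_cball I[OF i(1)] v by metis
  define a c where "a = min (\<alpha> i) (v - e)" and "c = max (\<alpha> i) (v + e)"
  have \<alpha>i: "\<alpha> i \<in> I i" using \<alpha> i by auto
  have "v - e \<in> I i" "v + e \<in> I i" using e by auto
  then have "a \<in> I i" "c \<in> I i" using \<alpha>i by (simp_all add: a_def c_def min_def max_def)
  then have acI: "{a..c} \<subseteq> I i" using interval_segment I[OF i(1)] by blast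
  have ac: "\<alpha> i \<in> {a..c}" by (simp add: a_def c_def)
  have sub: "{v - e..v + e} \<subseteq> {a..c}" by (auto simp: a_def c_def)
  define p where "p = (\<lambda>j. if j = i then a else min (\<alpha> j) (x j))"
  define q where "q = (\<lambda>j. if j = i then c else max (\<alpha> j) (x j))"
  have pq: "{p j..q j} \<subseteq> I j" if "j < d" for j
    using seg_sub[OF I \<alpha> x that] acI by (simp add: p_def q_def)
  note box = box_measure_finite[OF M pq]
  obtain B where B: "B \<ge> 0" "\<And>v w u. v \<in> {a..c} \<Longrightarrow> w \<in> {a..c} \<Longrightarrow> u \<in> PiE {..<d} I \<Longrightarrow>
      \<bar>K v u - K w u\<bar> \<le> B * \<bar>v - w\<bar> * indicator (PiE {..<d} (\<lambda>j. {p j..q j})) u"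
    using kern_prod_lipschitz[where n = n and i = i and x = x and a = a and c = c and b = b, OF i x ac] unfolding K_def p_def q_def by blast
  show thesis
    by (rule that[OF e B(1) box]) (use sub B(2) sp in auto)
qed

lemma kern_integral_continuous:
  assumes i: "i < d" "1 \<le> n i" and x: "x \<in> PiE {..<d} I" and M: "loc_finite_on d I M"
  shows "continuous_on (I i) (\<lambda>v. \<integral>u. (\<Prod>j<d. kern (b j) (n j) (\<alpha> j) ((x(i := v)) j) (u j)) \<partial>M)"
proof -
  define K where "K = (\<lambda>w u. \<Prod>j<d. kern (b j) (n j) (\<alpha> j) ((x(i := w)) j) (u j))"
  have int: "integrable M (K w)" if "w \<in> I i" for w
    unfolding K_def by (rule integrable_kern_prod[OF I \<alpha> M upd_box[OF x i(1) that]])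
  have "isCont (\<lambda>w. integral\<^sup>L M (K w)) v" if v: "v \<in> I i" for v
  proof -
    obtain e B S where e: "e > 0" "{v - e..v + e} \<subseteq> I i" "B \<ge> 0" and S: "S \<in> sets M" "emeasure M S < \<infinity>"
      and le: "\<And>w w' u. w \<in> {v - e..v + e} \<Longrightarrow> w' \<in> {v - e..v + e} \<Longrightarrow> u \<in> space M \<Longrightarrow>
        \<bar>K w u - K w' u\<bar> \<le> B * \<bar>w - w'\<bar> * indicator S u"
      using kern_integral_local[where n = n and i = i and x = x and v = v and M = M and b = b, OF i x v M] unfolding K_def by blast
    have "(B * measure M S)-lipschitz_on {v - e..v + e} (\<lambda>w. integral\<^sup>L M (K w))"
    proof (rule lipschitz_onI)
      fix w w' assume w: "w \<in> {v - e..v + e}" "w' \<in> {v - e..v + e}"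
      then have wI: "w \<in> I i" "w' \<in> I i" using e by auto
      have "\<bar>integral\<^sup>L M (K w) - integral\<^sup>L M (K w')\<bar> = \<bar>\<integral>u. K w u - K w' u \<partial>M\<bar>"
        using int[OF wI(1)] int[OF wI(2)] by simp
      also have "\<dots> \<le> (\<integral>u. B * \<bar>w - w'\<bar> * indicator S u \<partial>M)"
      proof (rule order_trans[OF integral_abs_bound integral_mono])
        show "integrable M (\<lambda>u. \<bar>K w u - K w' u\<bar>)" using int[OF wI(1)] int[OF wI(2)] by auto
        show "integrable M (\<lambda>u. B * \<bar>w - w'\<bar> * indicator S u)" using S by auto
      qed (rule le[OF w])
      also have "\<dots> = B * measure M S * \<bar>w - w'\<bar>" using S sets.sets_into_space[OF S(1)] by (simp add: Int_absorb2 mult_ac)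
      finally show "dist (integral\<^sup>L M (K w)) (integral\<^sup>L M (K w')) \<le> B * measure M S * dist w w'"
        by (simp add: dist_real_def)
    qed (use e in simp)
    from lipschitz_on_continuous_on[OF this] show ?thesis
      using e(1) by (simp add: continuous_on_interior)
  qed
  then show ?thesis unfolding K_def by (simp add: continuous_at_imp_continuous_on)
qed

text \<open>Dominated convergence. The hypothesis \<open>ae\<close> excludes mass of side L on the
  hyperplane u i = v, where the quotients need not tend to the lower kernel.\<close>

lemma kern_integral_rquot:
  assumes i: "i < d" "1 \<le> n i" and x: "x \<in> PiE {..<d} I" and v: "v \<in> I i" and M: "loc_finite_on d I M"
    and ae: "AE u in M. u i \<noteq> v \<or> b i = SideR"
  shows "rquot (\<lambda>w. \<integral>u. (\<Prod>j<d. kern (b j) (n j) (\<alpha> j) ((x(i := w)) j) (u j)) \<partial>M) v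
     \<longlonglongrightarrow> (\<integral>u. (\<Prod>j<d. kern (b j) ((n(i := n i - 1)) j) (\<alpha> j) ((x(i := v)) j) (u j)) \<partial>M)"
proof -
  define K where "K = (\<lambda>w u. \<Prod>j<d. kern (b j) (n j) (\<alpha> j) ((x(i := w)) j) (u j))"
  define K' where "K' = (\<lambda>u. \<Prod>j<d. kern (b j) ((n(i := n i - 1)) j) (\<alpha> j) ((x(i := v)) j) (u j))"
  have int: "integrable M (K w)" if "w \<in> I i" for w
    unfolding K_def by (rule integrable_kern_prod[OF I \<alpha> M upd_box[OF x i(1) that]])
  have int': "integrable M K'"
    unfolding K'_def by (rule integrable_kern_prod[OF I \<alpha> M upd_box[OF x i(1) v]])
  obtain e B S where e: "e > 0" "{v - e..v + e} \<subseteq> I i" "B \<ge> 0" and S: "S \<in> sets M" "emeasure M S < \<infinity>"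
    and le: "\<And>w w' u. w \<in> {v - e..v + e} \<Longrightarrow> w' \<in> {v - e..v + e} \<Longrightarrow> u \<in> space M \<Longrightarrow>
      \<bar>K w u - K w' u\<bar> \<le> B * \<bar>w - w'\<bar> * indicator S u"
    using kern_integral_local[where n = n and i = i and x = x and v = v and M = M and b = b, OF i x v M] unfolding K_def by blast
  \<comment> \<open>Longer steps might leave I i; only finitely many k are dropped.\<close>
  obtain k0 where k0: "\<And>k. k \<ge> k0 \<Longrightarrow> 1 / real (Suc k) < e"
    using order_tendstoD(2)[OF inverse_step_tendsto e(1)] unfolding eventually_sequentially by blast
  have we: "v + 1 / real (Suc (k + k0)) \<in> {v - e..v + e}" "v \<in> {v - e..v + e}" for k
    using k0[of "k + k0"] e(1) less_imp_le[of 0 "1 / real (Suc (k + k0))"] by (simp_all add: add_increasing2 order_trans[of "v - e" v])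
  have wI: "v + 1 / real (Suc (k + k0)) \<in> I i" for k using we(1) e(2) by blast
  have split: "K w u = kern (b i) (n i) (\<alpha> i) w (u i) * (\<Prod>j\<in>{..<d} - {i}. kern (b j) (n j) (\<alpha> j) (x j) (u j))" for w u
  proof -
    have "(\<Prod>j\<in>{..<d} - {i}. kern (b j) (n j) (\<alpha> j) ((x(i := w)) j) (u j)) = (\<Prod>j\<in>{..<d} - {i}. kern (b j) (n j) (\<alpha> j) (x j) (u j))"
      by (intro prod.cong) auto
    then show ?thesis using i by (simp add: prod.remove[of "{..<d}" i] K_def)
  qed
  have split': "K' u = kern (b i) (n i - 1) (\<alpha> i) v (u i) * (\<Prod>j\<in>{..<d} - {i}. kern (b j) (n j) (\<alpha> j) (x j) (u j))" for u
  proof -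
    have "(\<Prod>j\<in>{..<d} - {i}. kern (b j) ((n(i := n i - 1)) j) (\<alpha> j) ((x(i := v)) j) (u j)) = (\<Prod>j\<in>{..<d} - {i}. kern (b j) (n j) (\<alpha> j) (x j) (u j))"
      by (intro prod.cong) auto
    then show ?thesis using i by (simp add: prod.remove[of "{..<d}" i] K'_def)
  qed
  have "(\<lambda>k. \<integral>u. rquot (\<lambda>w. K w u) v (k + k0) \<partial>M) \<longlonglongrightarrow> integral\<^sup>L M K'"
  proof (rule integral_dominated_convergence[where w = "\<lambda>u. B * indicator S u"])
    show "K' \<in> borel_measurable M" using int' by auto
    show "(\<lambda>u. rquot (\<lambda>w. K w u) v (k + k0)) \<in> borel_measurable M" for k
      unfolding rquot_def using int[OF wI[of k]] int[OF v] by auto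
    show "integrable M (\<lambda>u. B * indicator S u)" using S by auto
    show "AE u in M. (\<lambda>k. rquot (\<lambda>w. K w u) v (k + k0)) \<longlonglongrightarrow> K' u"
      using ae
    proof eventually_elim
      case (elim u)
      let ?R = "\<Prod>j\<in>{..<d} - {i}. kern (b j) (n j) (\<alpha> j) (x j) (u j)"
      have "rquot (\<lambda>w. kern (b i) (n i) (\<alpha> i) w (u i)) v \<longlonglongrightarrow> kern (b i) (n i - 1) (\<alpha> i) v (u i)"
        using rquot_kern[OF i(2)] elim by blast
      then have "(\<lambda>k. rquot (\<lambda>w. kern (b i) (n i) (\<alpha> i) w (u i)) v k * ?R) \<longlonglongrightarrow> K' u"
        unfolding split' by (rule tendsto_mult_right)
      moreover have "(\<lambda>k. rquot (\<lambda>w. kern (b i) (n i) (\<alpha> i) w (u i)) v k * ?R) = rquot (\<lambda>w. K w u) v"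
        by (simp add: rquot_def fun_eq_iff split algebra_simps)
      ultimately show ?case by (simp add: LIMSEQ_ignore_initial_segment)
    qed
    show "AE u in M. norm (rquot (\<lambda>w. K w u) v (k + k0)) \<le> B * indicator S u" for k
    proof (rule AE_I2)
      fix u assume "u \<in> space M"
      let ?h = "1 / real (Suc (k + k0))"
      have "\<bar>K (v + ?h) u - K v u\<bar> \<le> B * \<bar>v + ?h - v\<bar> * indicator S u"
        by (rule le[OF we]) fact
      then have "\<bar>K (v + ?h) u - K v u\<bar> * real (Suc (k + k0)) \<le> B * \<bar>v + ?h - v\<bar> * indicator S u * real (Suc (k + k0))"
        by (rule mult_right_mono) simp
      then show "norm (rquot (\<lambda>w. K w u) v (k + k0)) \<le> B * indicator S u"
        by (simp add: rquot_def abs_mult)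
    qed
  qed
  moreover have "(\<integral>u. rquot (\<lambda>w. K w u) v (k + k0) \<partial>M) = rquot (\<lambda>w. integral\<^sup>L M (K w)) v (k + k0)" for k
    unfolding rquot_def using int[OF wI[of k]] int[OF v] by simp
  ultimately have "(\<lambda>k. rquot (\<lambda>w. integral\<^sup>L M (K w)) v (k + k0)) \<longlonglongrightarrow> integral\<^sup>L M K'" by simp
  from LIMSEQ_offset[OF this] show ?thesis unfolding K_def K'_def .
qed

lemma hrep_continuous:
  assumes adm: "admissible d I \<mu>" and i: "i < d" "2 \<le> n i" and x: "x \<in> PiE {..<d} I"
  shows "continuous_on (I i) (\<lambda>v. hrep d n \<alpha> \<mu> (x(i := v)))"
  unfolding hrep_def
proof (rule continuous_on_sum)
  fix b assume "b \<in> sides d"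
  then have "loc_finite_on d I (\<mu> b)" using adm by (simp add: admissible_def)
  then show "continuous_on (I i) (\<lambda>v. \<integral>u. (\<Prod>j<d. kern (b j) (n j - 1) (\<alpha> j) ((x(i := v)) j) (u j)) \<partial>\<mu> b)"
    by (intro kern_integral_continuous[where n = "\<lambda>j. n j - 1"] i x) (use i in auto)
qed

text \<open>C is the union of countable sets carrying the i-th marginals of the measures with b i =
  SideL. If x i lies outside C, none of these measures charges the hyperplane u i = x i. This is
  where discreteness of the marginals enters.\<close>

lemma hrep_rquot:
  assumes adm: "admissible d I \<mu>" and i: "i < d" "2 \<le> n i"
  obtains C where "countable C"
    "\<And>x. x \<in> PiE {..<d} I \<Longrightarrow> x i \<notin> C \<Longrightarrow>
       rquot (\<lambda>w. hrep d n \<alpha> \<mu> (x(i := w))) (x i) \<longlonglongrightarrow> hrep d (n(i := n i - 1)) \<alpha> \<mu> x"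
proof -
  have "\<exists>C. countable C \<and> (b i = SideL \<longrightarrow> (AE u in \<mu> b. u i \<in> C))" if b: "b \<in> sides d" for b
  proof (cases "b i = SideL")
    case True
    have M: "loc_finite_on d I (\<mu> b)" using adm b by (simp add: admissible_def)
    have "discrete_measure (marginal i (\<mu> b))" using adm b i True by (simp add: admissible_def)
    then obtain C where C: "countable C" "emeasure (distr (\<mu> b) borel (\<lambda>u. u i)) (UNIV - C) = 0"
      by (auto simp: discrete_measure_def marginal_def)
    have meas: "(\<lambda>u. u i) \<in> borel_measurable (\<mu> b)"
      using M measurable_box_coordinate[OF i(1)] measurable_cong_sets[of "\<mu> b" "box_borel d I"]
      by (auto simp: loc_finite_on_def)
    have "C \<in> sets borel" using C(1) by (rule sets.countable[rotated]) auto
    then have "UNIV - C \<in> sets borel" by auto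
    then have e: "emeasure (\<mu> b) ((\<lambda>u. u i) -` (UNIV - C) \<inter> space (\<mu> b)) = 0"
      "(\<lambda>u. u i) -` (UNIV - C) \<inter> space (\<mu> b) \<in> sets (\<mu> b)"
      using C(2) emeasure_distr[OF meas] measurable_sets[OF meas] by auto
    have "AE u in \<mu> b. u i \<in> C"
      by (rule AE_I[OF _ e]) auto
    then show ?thesis using C(1) by blast
  qed auto
  then obtain C where C: "\<And>b. b \<in> sides d \<Longrightarrow> countable (C b)"
    "\<And>b. b \<in> sides d \<Longrightarrow> b i = SideL \<Longrightarrow> AE u in \<mu> b. u i \<in> C b" by metis
  show thesis
  proof (rule that[of "\<Union>b\<in>sides d. C b"])
    show "countable (\<Union>b\<in>sides d. C b)" using C(1) finite_sides countable_finite by (intro countable_UN) auto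
    fix x assume x: "x \<in> PiE {..<d} I" and xi: "x i \<notin> (\<Union>b\<in>sides d. C b)"
    have xiI: "x i \<in> I i" using x i by auto
    have "rquot (\<lambda>w. hrep d n \<alpha> \<mu> (x(i := w))) (x i) = (\<lambda>k. \<Sum>b\<in>sides d.
       rquot (\<lambda>w. \<integral>u. (\<Prod>j<d. kern (b j) (n j - 1) (\<alpha> j) ((x(i := w)) j) (u j)) \<partial>\<mu> b) (x i) k)"
      by (simp add: rquot_def hrep_def fun_eq_iff sum_distrib_right sum_subtractf[symmetric] del: fun_upd_apply)
    moreover have "(\<lambda>k. \<Sum>b\<in>sides d.
       rquot (\<lambda>w. \<integral>u. (\<Prod>j<d. kern (b j) (n j - 1) (\<alpha> j) ((x(i := w)) j) (u j)) \<partial>\<mu> b) (x i) k)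
      \<longlonglongrightarrow> hrep d (n(i := n i - 1)) \<alpha> \<mu> x"
      unfolding hrep_def
    proof (rule tendsto_sum)
      fix b assume b: "b \<in> sides d"
      have M: "loc_finite_on d I (\<mu> b)" using adm b by (simp add: admissible_def)
      have "x i \<notin> C b" using xi b by blast
      have ae: "AE u in \<mu> b. u i \<noteq> x i \<or> b i = SideR"
      proof (cases "b i")
        case SideL
        from C(2)[OF b this] show ?thesis by eventually_elim (use \<open>x i \<notin> C b\<close> in auto)
      qed simp
      have "(\<lambda>j. (n(i := n i - 1)) j - 1) = (\<lambda>j. n j - 1)(i := (n i - 1) - 1)" by auto
      then have eq: "(n(i := n i - 1)) j - 1 = ((\<lambda>j. n j - 1)(i := (n i - 1) - 1)) j" for j by metis
      have xx: "x(i := x i) = x" by simp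
      have "1 \<le> n i - 1" using i by simp
      from kern_integral_rquot[where n = "\<lambda>j. n j - 1" and i = i and x = x and v = "x i" and M = "\<mu> b" and b = b, OF i(1) this x xiI M ae]
      show "(\<lambda>k. rquot (\<lambda>w. \<integral>u. (\<Prod>j<d. kern (b j) (n j - 1) (\<alpha> j) ((x(i := w)) j) (u j)) \<partial>\<mu> b) (x i) k)
         \<longlonglongrightarrow> (\<integral>u. (\<Prod>j<d. kern (b j) ((n(i := n i - 1)) j - 1) (\<alpha> j) (x j) (u j)) \<partial>\<mu> b)"
        unfolding eq xx .
    qed
    ultimately show "rquot (\<lambda>w. hrep d n \<alpha> \<mu> (x(i := w))) (x i) \<longlonglongrightarrow> hrep d (n(i := n i - 1)) \<alpha> \<mu> x"
      by (simp only:)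
  qed
qed

end

section \<open>Lowering the order in one coordinate\<close>

lemma mdd_tendsto:
  assumes "\<And>k. k \<in> PiE S A \<Longrightarrow> ((\<lambda>m. f m (\<lambda>j. if j \<in> S then k j else x j)) \<longlongrightarrow> g (\<lambda>j. if j \<in> S then k j else x j)) F"
  shows "((\<lambda>m. mdd S A (f m) x) \<longlongrightarrow> mdd S A g x) F"
  unfolding mdd_def mop_def by (intro tendsto_sum tendsto_mult_left assms)

lemma dd_tendsto:
  assumes "\<And>a. a \<in> A \<Longrightarrow> ((\<lambda>m. f m a) \<longlongrightarrow> g a) F"
  shows "((\<lambda>m. dd A (f m)) \<longlongrightarrow> dd A g) F"
  unfolding dd_def by (intro tendsto_sum tendsto_mult_left assms)

lemma rquot_mdd:
  assumes "i \<notin> S"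
  shows "rquot (\<lambda>v. mdd S A f (x(i := v))) v k = mdd S A (\<lambda>y. rquot (\<lambda>v. f (y(i := v))) v k) x"
proof -
  have "mdd S A (\<lambda>y. rquot (\<lambda>v. f (y(i := v))) v k) x
    = mdd S A (\<lambda>y. real (Suc k) * (f (y(i := v + 1 / real (Suc k))) - f (y(i := v)))) x"
    by (simp add: rquot_def mult.commute del: fun_upd_apply)
  also have "\<dots> = real (Suc k) * (mdd S A (\<lambda>y. f (y(i := v + 1 / real (Suc k)))) x - mdd S A (\<lambda>y. f (y(i := v))) x)"
    by (simp only: mdd_cmult mdd_diff)
  finally show ?thesis by (simp only: rquot_def mdd_upd[OF assms] mult.commute)
qed

context
  fixes d :: nat and I :: "nat \<Rightarrow> real set" and \<alpha> :: "nat \<Rightarrow> real" and i :: nat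
  assumes I: "\<And>j. j < d \<Longrightarrow> open (I j) \<and> is_interval (I j)"
    and \<alpha>: "\<alpha> \<in> PiE {..<d} I" and i: "i < d"
begin

lemma others: "insert i ({..<d} - {i}) = {..<d}" "i \<notin> {..<d} - {i}" "finite ({..<d} - {i})"
  using i by auto

lemma slice_point:
  assumes "\<And>j. j < d \<Longrightarrow> j \<noteq> i \<Longrightarrow> A j \<subseteq> I j" "k \<in> PiE ({..<d} - {i}) A" "v \<in> I i"
  shows "(\<lambda>j. if j \<in> {..<d} - {i} then k j else pt j)(i := v) \<in> PiE {..<d} I"
proof (rule PiE_I)
  fix j assume j: "j \<in> {..<d}"
  show "((\<lambda>j. if j \<in> {..<d} - {i} then k j else pt j)(i := v)) j \<in> I j"
  proof (cases "j = i")
    case False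
    then have "k j \<in> A j" using j assms(2) by auto
    then show ?thesis using False j assms(1)[of j] by auto
  qed (use assms(3) in simp)
qed (use i in auto)

lemma mdd_slice:
  "mdd {..<d} A f pt = dd (A i) (\<lambda>v. mdd ({..<d} - {i}) A f (pt(i := v)))"
  using mdd_insert[OF others(3,2), of A f pt] unfolding others(1) .

lemma mdd_slice':
  assumes "\<And>j. j < d \<Longrightarrow> j \<noteq> i \<Longrightarrow> A j = A' j" "A' i = B"
  shows "dd B (\<lambda>v. mdd ({..<d} - {i}) A f (pt(i := v))) = mdd {..<d} A' f pt"
proof -
  have "mdd ({..<d} - {i}) A f (pt(i := v)) = mdd ({..<d} - {i}) A' f (pt(i := v))" for v
    by (rule mdd_cong_sets) (use assms in auto)
  then show ?thesis unfolding mdd_slice[of A'] assms(2) by simp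
qed

lemma mdd_slice_rquot:
  assumes A: "\<And>j. j < d \<Longrightarrow> j \<noteq> i \<Longrightarrow> A j \<subseteq> I j" and v: "v \<in> I i"
    and lim: "\<And>x. x \<in> PiE {..<d} I \<Longrightarrow> x i = v \<Longrightarrow> rquot (\<lambda>w. F (x(i := w))) (x i) \<longlonglongrightarrow> g x"
  shows "rquot (\<lambda>w. mdd ({..<d} - {i}) A F (pt(i := w))) v \<longlonglongrightarrow> mdd ({..<d} - {i}) A g (pt(i := v))"
proof -
  have "(\<lambda>k. mdd ({..<d} - {i}) A (\<lambda>y. rquot (\<lambda>w. F (y(i := w))) v k) pt)
      \<longlonglongrightarrow> mdd ({..<d} - {i}) A (\<lambda>y. g (y(i := v))) pt"
  proof (rule mdd_tendsto)
    fix k assume k: "k \<in> PiE ({..<d} - {i}) A"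
    let ?y = "\<lambda>j. if j \<in> {..<d} - {i} then k j else pt j"
    have "?y(i := v) \<in> PiE {..<d} I" by (rule slice_point[OF A k v])
    from lim[OF this] show "rquot (\<lambda>w. F (?y(i := w))) v \<longlonglongrightarrow> g (?y(i := v))" by simp
  qed
  then show ?thesis using rquot_mdd[OF others(2), of A F pt v] mdd_upd[OF others(2), of A g pt v]
    by presburger
qed

lemma mdd_slice_continuous:
  assumes A: "\<And>j. j < d \<Longrightarrow> j \<noteq> i \<Longrightarrow> A j \<subseteq> I j"
    and c: "\<And>x. x \<in> PiE {..<d} I \<Longrightarrow> continuous_on (I i) (\<lambda>w. F (x(i := w)))"
  shows "continuous_on (I i) (\<lambda>w. mdd ({..<d} - {i}) A F (pt(i := w)))"
  unfolding mdd_upd[OF others(2)] unfolding mdd_def mop_def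
proof (intro continuous_on_sum continuous_on_mult_left)
  fix k assume k: "k \<in> PiE ({..<d} - {i}) A"
  let ?y = "\<lambda>j. if j \<in> {..<d} - {i} then k j else pt j"
  have "\<alpha> i \<in> I i" using \<alpha> i by auto
  from slice_point[OF A k this] have "?y(i := \<alpha> i) \<in> PiE {..<d} I" by simp
  from c[OF this] show "continuous_on (I i) (\<lambda>w. F (?y(i := w)))" by simp
qed

text \<open>The divided difference of the right quotients over A i is, up to the factor 1 / h, the
  change of a divided difference when all nodes move by h. The exchange formula turns this change
  into h times a sum of differences with one more node, which are nonnegative; the limit preserves
  the sign.\<close>

lemma box_convex_of_right_derivative:
  assumes n: "2 \<le> n i"
    and F: "\<And>A. nodes d I n A \<Longrightarrow> 0 \<le> mdd {..<d} A F pt"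
    and lim: "\<And>x. x \<in> PiE {..<d} I \<Longrightarrow> rquot (\<lambda>w. F (x(i := w))) (x i) \<longlonglongrightarrow> g x"
  shows "box_convex d I (n(i := n i - 1)) g"
  unfolding box_convex_iff_mdd
proof (intro allI impI)
  fix A assume A: "nodes d I (n(i := n i - 1)) A"
  have AI: "A j \<subseteq> I j" if "j < d" for j using A that by (simp add: nodes_def)
  have cA: "card (A i) = n i" using A i n by (simp add: nodes_def)
  have finA: "finite (A i)" using nodes_finite[OF A i] .
  define \<psi> where "\<psi> v = mdd ({..<d} - {i}) A F (pt(i := v))" for v
  define h where "h k = 1 / real (Suc k)" for k
  have h0: "h k > 0" for k by (simp add: h_def)
  have "(\<lambda>k. dd (A i) (\<lambda>v. rquot \<psi> v k)) \<longlonglongrightarrow> dd (A i) (\<lambda>v. mdd ({..<d} - {i}) A g (pt(i := v)))"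
  proof (rule dd_tendsto)
    fix v assume "v \<in> A i"
    then have "v \<in> I i" using AI[OF i] by blast
    from mdd_slice_rquot[where A = A and F = F and g = g, OF AI this lim]
    show "rquot \<psi> v \<longlonglongrightarrow> mdd ({..<d} - {i}) A g (pt(i := v))"
      unfolding \<psi>_def by simp
  qed
  then have l: "(\<lambda>k. dd (A i) (\<lambda>v. rquot \<psi> v k)) \<longlonglongrightarrow> mdd {..<d} A g pt"
    unfolding mdd_slice[of A g] .
  have ev1: "\<forall>\<^sub>F k in sequentially. \<forall>a\<in>A i. {a..a + 1 / real (Suc k)} \<subseteq> I i"
    using AI[OF i] I[OF i] by (intro eventually_ball_finite finA ballI eventually_step_mem) auto
  \<comment> \<open>The exchange formula requires the shifted nodes to avoid the old ones, which
    holds for all small steps.\<close>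
  have ev2: "\<forall>\<^sub>F k in sequentially. \<forall>a\<in>A i. \<forall>b\<in>A i. a + 1 / real (Suc k) \<noteq> b"
  proof (intro eventually_ball_finite finA ballI)
    fix a b
    show "\<forall>\<^sub>F k in sequentially. a + 1 / real (Suc k) \<noteq> b"
    proof (cases "a < b")
      case True
      then have "\<forall>\<^sub>F k in sequentially. 1 / real (Suc k) < b - a"
        using order_tendstoD(2)[OF inverse_step_tendsto] by simp
      then show ?thesis by eventually_elim simp
    next
      case False
      have "a + 1 / real (Suc k) \<noteq> b" for k using False h0[of k] unfolding h_def by linarith
      then show ?thesis by simp
    qed
  qed
  have "\<forall>\<^sub>F k in sequentially. 0 \<le> dd (A i) (\<lambda>v. rquot \<psi> v k)"
    using ev1 ev2
  proof eventually_elim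
    case (elim k)
    let ?s = "\<lambda>b. b + h k"
    have "?s b \<in> I i" if "b \<in> A i" for b
    proof -
      have "?s b \<in> {b..b + 1 / real (Suc k)}" using h0[of k] by (simp add: h_def)
      then show ?thesis using elim(1) that by blast
    qed
    then have sI: "?s ` A i \<subseteq> I i" by blast
    have "?s b \<notin> A i" if "b \<in> A i" for b
      using elim(2)[rule_format, OF that, of "?s b"] unfolding h_def by blast
    then have dis: "?s ` A i \<inter> A i = {}" by blast
    have inj: "inj_on ?s (A i)" by (simp add: inj_on_def)
    obtain D where D: "\<forall>b\<in>A i. D b \<subseteq> A i \<union> ?s ` A i \<union> {} \<and> card (D b) = Suc (card (A i \<union> {}))"
      and eq: "dd (?s ` A i \<union> {}) \<psi> - dd (A i \<union> {}) \<psi> = (\<Sum>b\<in>A i. (?s b - b) * dd (D b) \<psi>)"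
      using dd_exchange[of "A i" "{}" ?s \<psi>, OF finA finite.emptyI inj Int_empty_right Int_empty_right dis]
      by (elim exE conjE) (rule that)
    have "0 \<le> dd (D b) \<psi>" if b: "b \<in> A i" for b
    proof -
      have "D b \<subseteq> A i \<union> ?s ` A i" using D b by simp
      then have Db: "D b \<subseteq> I i" using AI[OF i] sI by (meson Un_least subset_trans)
      have "card (D b) = Suc (card (A i \<union> {}))" using D b by blast
      then have "card (D b) = Suc (n i)" using cA by simp
      note Db = Db this
      have "dd (D b) \<psi> = mdd {..<d} (A(i := D b)) F pt"
        unfolding \<psi>_def by (rule mdd_slice') auto
      moreover have "nodes d I n (A(i := D b))"
        using A Db by (auto simp: nodes_def)
      ultimately show ?thesis using F by simp
    qed
    then have "0 \<le> (\<Sum>b\<in>A i. (?s b - b) * dd (D b) \<psi>)"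
      using h0[of k] by (intro sum_nonneg mult_nonneg_nonneg) auto
    then have "0 \<le> dd (A i) (\<lambda>v. \<psi> (v + h k)) - dd (A i) \<psi>"
      using eq by (simp add: dd_translate)
    then have "0 \<le> real (Suc k) * dd (A i) (\<lambda>v. \<psi> (v + h k) - \<psi> v)"
      by (simp add: dd_diff)
    then show ?case
      by (simp add: rquot_def h_def dd_cmult[symmetric] mult.commute)
  qed
  then show "0 \<le> mdd {..<d} A g pt"
    using tendsto_lowerbound[OF l] by simp
qed

text \<open>Since T i is empty, the nodal factor C does not involve x i, and the section is C times
  a mixed difference of f in the other coordinates. The sign of C depends on x, which is harmless
  because only the regularity of sections is used. If some x j is a node, the section
  vanishes.\<close>

lemma interp_rem_slice_convex:
  assumes f: "box_convex d I n f"
    and T: "T i = {}" "\<And>j. j < d \<Longrightarrow> j \<noteq> i \<Longrightarrow> finite (T j) \<and> card (T j) = n j \<and> T j \<subseteq> I j"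
    and x: "x \<in> PiE {..<d} I"
  shows "\<exists>s\<in>{1, -1}. convex_order (I i) (n i) (\<lambda>v. s * interp_rem T d f (x(i := v)))"
proof -
  have fin: "finite (T j)" if "j < d" for j using T that by (cases "j = i") auto
  show ?thesis
  proof (cases "\<exists>j<d. x j \<in> T j")
    case True
    then obtain j where j: "j < d" "x j \<in> T j" "j \<noteq> i" using T(1) by auto
    have "interp_rem T d f (x(i := v)) = 0" for v
      by (rule interp_rem_node[where i = j]) (use fin j in auto)
    then show ?thesis by (intro bexI[of _ 1]) (simp_all add: convex_order_def dd_def del: fun_upd_apply)
  next
    case False
    define C where "C = (\<Prod>j<d. \<Prod>b\<in>T j. x j - b)"
    define A where "A = (\<lambda>j. insert (x j) (T j))"
    have eq: "interp_rem T d f (x(i := v)) = C * mdd ({..<d} - {i}) A f (pt(i := v))" for v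
    proof -
      let ?x = "x(i := v)"
      have "interp_rem T d f ?x = (\<Prod>j<d. \<Prod>b\<in>T j. ?x j - b) * mdd {..<d} (\<lambda>j. insert (?x j) (T j)) f ?x"
        by (rule interp_rem_eq_mdd) (use fin False T(1) in auto)
      also have "(\<Prod>j<d. \<Prod>b\<in>T j. ?x j - b) = C"
        unfolding C_def by (intro prod.cong) (use T(1) in auto)
      also have "mdd {..<d} (\<lambda>j. insert (?x j) (T j)) f ?x
          = dd {v} (\<lambda>w. mdd ({..<d} - {i}) (\<lambda>j. insert (?x j) (T j)) f (?x(i := w)))"
        using mdd_insert[OF others(3,2), of "\<lambda>j. insert (?x j) (T j)" f ?x] T(1) unfolding others(1) by simp
      also have "\<dots> = mdd ({..<d} - {i}) (\<lambda>j. insert (?x j) (T j)) f ?x" by simp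
      also have "\<dots> = mdd ({..<d} - {i}) A f ?x"
        by (rule mdd_cong_sets) (auto simp: A_def)
      also have "\<dots> = mdd ({..<d} - {i}) A f (pt(i := v))"
        unfolding mdd_def
      proof (rule mop_cong)
        fix k
        have "(\<lambda>j. if j \<in> {..<d} - {i} then k j else ?x j) = (\<lambda>j. if j \<in> {..<d} - {i} then k j else (pt(i := v)) j)"
          using x by (auto simp: PiE_def extensional_def)
        then show "f (\<lambda>j. if j \<in> {..<d} - {i} then k j else ?x j) = f (\<lambda>j. if j \<in> {..<d} - {i} then k j else (pt(i := v)) j)"
          by (rule arg_cong)
      qed
      finally show ?thesis .
    qed
    have nn: "0 \<le> dd B (\<lambda>v. mdd ({..<d} - {i}) A f (pt(i := v)))" if B: "B \<subseteq> I i" "card B = Suc (n i)" for B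
    proof -
      have "dd B (\<lambda>v. mdd ({..<d} - {i}) A f (pt(i := v))) = mdd {..<d} (A(i := B)) f pt"
        by (rule mdd_slice') auto
      moreover have "nodes d I n (A(i := B))"
        unfolding nodes_def
      proof (intro allI impI)
        fix j assume j: "j < d"
        show "(A(i := B)) j \<subseteq> I j \<and> card ((A(i := B)) j) = Suc (n j)"
        proof (cases "j = i")
          case jn: False
          have "x j \<notin> T j" "x j \<in> I j" using False j x by auto
          then show ?thesis using T(2)[OF j jn] jn by (simp add: A_def)
        qed (use B in simp)
      qed
      ultimately show ?thesis using f unfolding box_convex_iff_mdd by simp
    qed
    define s where "s = (if 0 \<le> C then 1 else -1 :: real)"
    have "0 \<le> s * C" by (simp add: s_def)
    have "convex_order (I i) (n i) (\<lambda>v. s * interp_rem T d f (x(i := v)))"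
      unfolding convex_order_def
    proof (intro allI impI)
      fix B assume B: "B \<subseteq> I i \<and> card B = Suc (n i)"
      have "dd B (\<lambda>v. s * interp_rem T d f (x(i := v))) = (s * C) * dd B (\<lambda>v. mdd ({..<d} - {i}) A f (pt(i := v)))"
        unfolding eq mult.assoc[symmetric] by (rule dd_cmult)
      then show "0 \<le> dd B (\<lambda>v. s * interp_rem T d f (x(i := v)))"
        using nn[of B] B \<open>0 \<le> s * C\<close> by simp
    qed
    then show ?thesis by (auto simp: s_def split: if_splits)
  qed
qed

text \<open>Let E be the difference of F and the candidate integral, and E' that of their right
  derivatives. Lower-order mixed differences of E' vanish, so its partial difference V in the other
  coordinates is a polynomial of degree at most n i - 2. V is the right derivative, off C, of the
  continuous \<Phi> formed in the same way from E. Hence \<Phi> is a polynomial of degree at most n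
  i - 1, which n i + 1 nodes annihilate.\<close>

lemma representation_step:
  assumes f: "box_convex d I n f" and n: "\<And>j. j < d \<Longrightarrow> 1 \<le> n j" and ni: "2 \<le> n i"
    and IH: "\<And>g. box_convex d I (n(i := n i - 1)) g \<Longrightarrow> \<exists>\<mu>. admissible d I \<mu> \<and>
      (\<forall>A. nodes d I (n(i := n i - 1)) A \<longrightarrow> mdd {..<d} A g pt = mdd {..<d} A (hrep d (n(i := n i - 1)) \<alpha> \<mu>) pt)"
  shows "\<exists>\<mu>. admissible d I \<mu> \<and> (\<forall>A. nodes d I n A \<longrightarrow> mdd {..<d} A f pt = mdd {..<d} A (hrep d n \<alpha> \<mu>) pt)"
proof -
  let ?n' = "n(i := n i - 1)" and ?S = "{..<d} - {i}"
  have Ii: "open (I i)" "is_interval (I i)" using I[OF i] by auto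
  have \<alpha>I: "\<alpha> j \<in> I j" if "j < d" for j using \<alpha> that by auto
  have "\<exists>T. finite T \<and> card T = n j \<and> T \<subseteq> I j" if "j < d" for j
    using infinite_arbitrarily_large[OF infinite_open_real] I[OF that] \<alpha>I[OF that] by metis
  then obtain T' where T': "\<And>j. j < d \<Longrightarrow> finite (T' j) \<and> card (T' j) = n j \<and> T' j \<subseteq> I j" by metis
  define T where "T = T'(i := {})"
  have T: "T i = {}" "\<And>j. j < d \<Longrightarrow> j \<noteq> i \<Longrightarrow> finite (T j) \<and> card (T j) = n j \<and> T j \<subseteq> I j"
    using T' by (auto simp: T_def)
  define F where "F = interp_rem T d f"
  have pp: "pseudo_polynomial d I (\<lambda>i. n i - 1) (\<lambda>x. f x - F x)"
    unfolding F_def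
  proof (rule pseudo_polynomial_minus_interp_rem)
    fix j assume "j < d"
    then show "finite (T j)" "card (T j) \<le> n j" using T by (cases "j = i"; simp)+
  qed
  \<comment> \<open>F differs from f by a pseudo-polynomial, so it may replace f in every mixed
    difference of order n.\<close>
  have fF: "mdd {..<d} A F pt = mdd {..<d} A f pt" if "nodes d I n A" for A
    using mdd_pseudo_polynomial[OF pp that n] by (simp add: mdd_diff)
  have conv: "convergent (rquot (\<lambda>w. F (x(i := w))) v)" and cont: "continuous_on (I i) (\<lambda>w. F (x(i := w)))"
    if x: "x \<in> PiE {..<d} I" and v: "v \<in> I i" for x v
  proof -
    obtain s where s: "s \<in> {1, -1}" "convex_order (I i) (n i) (\<lambda>v. s * F (x(i := v)))"
      using interp_rem_slice_convex[OF f T x] unfolding F_def by blast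
    have ss: "s * (s * y) = y" for y using s(1) by auto
    have "continuous_on (I i) (\<lambda>v. s * (s * F (x(i := v))))"
      by (intro continuous_on_mult_left convex_order_continuous[OF Ii s(2) ni])
    then show "continuous_on (I i) (\<lambda>w. F (x(i := w)))" by (simp only: ss)
    have "convergent (rquot (\<lambda>v. s * F (x(i := v))) v)"
      by (rule convex_order_right_derivative[OF Ii s(2) ni v])
    then obtain l where "rquot (\<lambda>v. s * F (x(i := v))) v \<longlonglongrightarrow> l" by (auto simp: convergent_def)
    then have "(\<lambda>k. s * rquot (\<lambda>v. s * F (x(i := v))) v k) \<longlonglongrightarrow> s * l" by (rule tendsto_mult_left)
    moreover have "s * rquot (\<lambda>v. s * F (x(i := v))) v k = rquot (\<lambda>w. F (x(i := w))) v k" for k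
      using s(1) by (auto simp: rquot_def algebra_simps)
    ultimately show "convergent (rquot (\<lambda>w. F (x(i := w))) v)" by (auto simp: convergent_def)
  qed
  define g where "g x = lim (rquot (\<lambda>w. F (x(i := w))) (x i))" for x
  have limg: "rquot (\<lambda>w. F (x(i := w))) (x i) \<longlonglongrightarrow> g x" if "x \<in> PiE {..<d} I" for x
    unfolding g_def using conv[OF that] that i by (simp add: convergent_LIMSEQ_iff[symmetric] PiE_mem)
  have "box_convex d I ?n' g"
  proof (rule box_convex_of_right_derivative[where n = n and F = F and g = g, OF ni _ limg])
    fix A assume "nodes d I n A"
    then show "0 \<le> mdd {..<d} A F pt" using fF f by (simp add: box_convex_iff_mdd)
  qed
  from IH[OF this] obtain \<mu> where adm: "admissible d I \<mu>"
    and eq: "\<And>A. nodes d I ?n' A \<Longrightarrow> mdd {..<d} A g pt = mdd {..<d} A (hrep d ?n' \<alpha> \<mu>) pt" by blast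
  obtain C where C: "countable C" and limh: "\<And>x. x \<in> PiE {..<d} I \<Longrightarrow> x i \<notin> C \<Longrightarrow>
       rquot (\<lambda>w. hrep d n \<alpha> \<mu> (x(i := w))) (x i) \<longlonglongrightarrow> hrep d ?n' \<alpha> \<mu> x"
    using hrep_rquot[where \<mu> = \<mu> and i = i and n = n and d = d and I = I and \<alpha> = \<alpha>, OF I \<alpha> adm i ni] by blast
  have "mdd {..<d} A f pt = mdd {..<d} A (hrep d n \<alpha> \<mu>) pt" if A: "nodes d I n A" for A
  proof -
    have AI: "A j \<subseteq> I j" if "j < d" for j using A that by (simp add: nodes_def)
    define E where "E x = F x - hrep d n \<alpha> \<mu> x" for x
    define E' where "E' x = g x - hrep d ?n' \<alpha> \<mu> x" for x
    define \<Phi> where "\<Phi> v = mdd ?S A E (pt(i := v))" for v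
    define V where "V v = mdd ?S A E' (pt(i := v))" for v
    have contE: "continuous_on (I i) (\<lambda>w. E (x(i := w)))" if "x \<in> PiE {..<d} I" for x
      unfolding E_def using cont[OF that \<alpha>I[OF i]] hrep_continuous[where \<mu> = \<mu> and i = i and n = n and d = d and I = I and \<alpha> = \<alpha> and x = x, OF I \<alpha> adm i ni that]
      by (intro continuous_on_diff) auto
    have limE: "rquot (\<lambda>w. E (x(i := w))) (x i) \<longlonglongrightarrow> E' x" if "x \<in> PiE {..<d} I" "x i \<notin> C" for x
    proof -
      have "rquot (\<lambda>w. E (x(i := w))) (x i) = (\<lambda>k. rquot (\<lambda>w. F (x(i := w))) (x i) k - rquot (\<lambda>w. hrep d n \<alpha> \<mu> (x(i := w))) (x i) k)"
        by (simp add: rquot_def E_def fun_eq_iff algebra_simps del: fun_upd_apply)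
      then show ?thesis unfolding E'_def using tendsto_diff[OF limg limh] that by simp
    qed
    have "\<exists>c. \<forall>v\<in>I i. V v = (\<Sum>k\<le>n i - 1 - 1. c k * v ^ k)"
    proof (rule polynomial_of_dd_zero)
      show "infinite (I i)" using infinite_open_real[OF Ii(1) \<alpha>I[OF i]] .
      show "1 \<le> n i - 1" using ni by simp
      fix B assume B: "B \<subseteq> I i" "card B = Suc (n i - 1)"
      have "nodes d I ?n' (A(i := B))"
        using A B by (auto simp: nodes_def)
      then have "mdd {..<d} (A(i := B)) E' pt = 0"
        unfolding E'_def mdd_diff using eq by simp
      moreover have "dd B V = mdd {..<d} (A(i := B)) E' pt"
        unfolding V_def by (rule mdd_slice') auto
      ultimately show "dd B V = 0" by simp
    qed
    then obtain c where c: "\<And>v. v \<in> I i \<Longrightarrow> V v = (\<Sum>k\<le>n i - 2. c k * v ^ k)"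
      by (auto simp: numeral_2_eq_2)
    \<comment> \<open>A primitive of the polynomial V, so that the right quotients of \<Phi> - P
      tend to 0 off C.\<close>
    define P where "P v = (\<Sum>k\<le>n i - 2. c k / real (Suc k) * v ^ Suc k)" for v
    have P': "(P has_real_derivative (\<Sum>k\<le>n i - 2. c k * v ^ k)) (at v)" for v
      unfolding P_def
    proof (rule DERIV_sum)
      fix k
      have "((\<lambda>v. c k / real (Suc k) * v ^ Suc k) has_real_derivative c k / real (Suc k) * (real (Suc k) * v ^ k)) (at v)"
        by (rule DERIV_cmult) (use DERIV_pow[of "Suc k" v] in simp)
      then show "((\<lambda>v. c k / real (Suc k) * v ^ Suc k) has_real_derivative c k * v ^ k) (at v)" by simp
    qed
    have const: "\<Phi> v - P v = \<Phi> (\<alpha> i) - P (\<alpha> i)" if v: "v \<in> I i" for v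
    proof (rule constant_of_right_quotients[OF Ii(2) _ C _ v \<alpha>I[OF i], of "\<lambda>v. \<Phi> v - P v"])
      have "continuous_on (I i) \<Phi>"
        unfolding \<Phi>_def using AI contE by (intro mdd_slice_continuous) auto
      moreover have "continuous_on (I i) P" using P' DERIV_isCont continuous_at_imp_continuous_on by blast
      ultimately show "continuous_on (I i) (\<lambda>v. \<Phi> v - P v)" by (intro continuous_on_diff)
      fix x assume x: "x \<in> I i - C"
      have "rquot \<Phi> x \<longlonglongrightarrow> V x"
        unfolding \<Phi>_def V_def using x AI by (intro mdd_slice_rquot limE) auto
      moreover have "rquot P x \<longlonglongrightarrow> V x" using rquot_of_DERIV[OF P', of x] c[of x] x by simp
      ultimately have "(\<lambda>k. rquot \<Phi> x k - rquot P x k) \<longlonglongrightarrow> V x - V x" by (rule tendsto_diff)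
      moreover have "(\<lambda>k. rquot \<Phi> x k - rquot P x k) = rquot (\<lambda>v. \<Phi> v - P v) x"
        by (simp add: rquot_def fun_eq_iff algebra_simps)
      ultimately show "rquot (\<lambda>v. \<Phi> v - P v) x \<longlonglongrightarrow> 0" by simp
    qed
    have cA: "card (A i) = Suc (n i)" using A i by (simp add: nodes_def)
    have "mdd {..<d} A E pt = dd (A i) \<Phi>"
      unfolding \<Phi>_def by (rule mdd_slice)
    also have "\<dots> = dd (A i) (\<lambda>v. P v + (\<Phi> (\<alpha> i) - P (\<alpha> i)))"
    proof (rule dd_cong)
      fix v assume "v \<in> A i"
      then have "v \<in> I i" using AI[OF i] by blast
      from const[OF this] show "\<Phi> v = P v + (\<Phi> (\<alpha> i) - P (\<alpha> i))" by linarith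
    qed
    also have "\<dots> = (\<Sum>k\<le>n i - 2. c k / real (Suc k) * dd (A i) (\<lambda>v. v ^ Suc k)) + dd (A i) (\<lambda>v. \<Phi> (\<alpha> i) - P (\<alpha> i))"
      unfolding P_def dd_add dd_sum dd_cmult ..
    also have "\<dots> = 0"
    proof -
      have "dd (A i) (\<lambda>v. \<Phi> (\<alpha> i) - P (\<alpha> i)) = 0" using cA ni by (intro dd_const) simp
      moreover have "dd (A i) (\<lambda>v. v ^ Suc k) = 0" if "k \<le> n i - 2" for k
        using cA ni that by (intro dd_power) simp
      ultimately show ?thesis by simp
    qed
    finally show ?thesis
      using fF[OF A] unfolding E_def mdd_diff by simp
  qed
  with adm show ?thesis by blast
qed

end

section \<open>Additive contents on boxes\<close>

text \<open>If the limits of the end points differed, some cut point between them would lie strictly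
  inside every interval.\<close>

lemma nested_intervals_limit:
  fixes s t :: "nat \<Rightarrow> real"
  assumes s: "incseq s" and t: "decseq t" and lt: "\<And>k. s k < t k"
    and dense: "\<And>x y. s 0 \<le> x \<Longrightarrow> x < y \<Longrightarrow> y \<le> t 0 \<Longrightarrow> \<exists>e k. x < e \<and> e < y \<and> \<not> (s k < e \<and> e < t k)"
  obtains T where "s \<longlonglongrightarrow> T" "t \<longlonglongrightarrow> T" "\<And>k. s k \<le> T" "\<And>k. T \<le> t k"
proof -
  have "s k \<le> t 0" for k using lt[of k] decseqD[OF t, of 0 k] by linarith
  then obtain S where S: "s \<longlonglongrightarrow> S" "\<And>k. s k \<le> S" using incseq_convergent[OF s] by metis
  have "s 0 \<le> t k" for k using lt[of k] incseqD[OF s, of 0 k] by linarith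
  then obtain U where U: "t \<longlonglongrightarrow> U" "\<And>k. U \<le> t k" using decseq_convergent[OF t] by metis
  have SU: "S \<le> U" by (rule LIMSEQ_le[OF S(1) U(1)]) (use lt less_imp_le in blast)
  have "\<not> S < U"
  proof
    assume "S < U"
    then obtain e k where "S < e" "e < U" "\<not> (s k < e \<and> e < t k)"
      using dense[of S U] S(2)[of 0] U(2)[of 0] by blast
    then show False using S(2)[of k] U(2)[of k] by linarith
  qed
  then have "U = S" using SU by simp
  then show thesis using that S U by blast
qed

text \<open>If the left end points reach T, the intervals shrink towards T from the right and T
  behaves like a point of [s, t); otherwise all left end points stay below T and it behaves like a
  point of (s, t]. Once a has been used as a cut, T and this alternative decide on which side of a
  the interval lies.\<close>

lemma nested_intervals_side:
  fixes s t :: "nat \<Rightarrow> real"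
  assumes s: "incseq s" and t: "decseq t" and lt: "\<And>k. s k < t k"
    and T: "\<And>k. s k \<le> T" "\<And>k. T \<le> t k" and a: "\<not> (s K < a \<and> a < t K)"
  shows "a \<le> s K \<longleftrightarrow> (if \<exists>k. s k = T then a \<le> T else a < T)"
    and "t K \<le> a \<longleftrightarrow> (if \<exists>k. s k = T then T < a else T \<le> a)"
proof -
  show 1: "a \<le> s K \<longleftrightarrow> (if \<exists>k. s k = T then a \<le> T else a < T)"
  proof (cases "\<exists>k. s k = T")
    case True
    then obtain k where k: "s k = T" ..
    have "T < t K"
    proof (cases "K \<le> k")
      case True
      then show ?thesis using lt[of k] k decseqD[OF t] by fastforce
    next
      case False
      then have "s K = T" using incseqD[OF s, of k K] k T(1)[of K] by simp
      then show ?thesis using lt[of K] by simp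
    qed
    then show ?thesis using True a T(1)[of K] by auto
  next
    case False
    then have "s K < T" using T(1)[of K] by (metis less_eq_real_def)
    then show ?thesis using False a T(2)[of K] by auto
  qed
  have "t K \<le> a \<longleftrightarrow> \<not> a \<le> s K" using a lt[of K] by auto
  then show "t K \<le> a \<longleftrightarrow> (if \<exists>k. s k = T then T < a else T \<le> a)"
    unfolding 1 by auto
qed

section \<open>Cutting boxes into cells\<close>

type_synonym cell = "(nat \<Rightarrow> real) \<times> (nat \<Rightarrow> real) \<times> real"

text \<open>The coordinatewise projection of a onto the box [s, t]. For a \<le> b the projections of
  a and b span the intersection of [a, b] and [s, t]; if it is empty, they agree in some coordinate
  and the content is 0.\<close>

definition clip :: "(nat \<Rightarrow> real) \<Rightarrow> (nat \<Rightarrow> real) \<Rightarrow> (nat \<Rightarrow> real) \<Rightarrow> nat \<Rightarrow> real" where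
  "clip s t a = (\<lambda>i. max (s i) (min (t i) (a i)))"

text \<open>Additivity is required for every e, not only between s i and t i: alternating sums of a
  function satisfy it, and increments of a face can then be computed without case
  distinctions.\<close>

locale box_content =
  fixes d :: nat and I :: "nat \<Rightarrow> real set" and \<alpha> :: "nat \<Rightarrow> real"
    and c :: "(nat \<Rightarrow> real) \<Rightarrow> (nat \<Rightarrow> real) \<Rightarrow> real"
  assumes d: "1 \<le> d"
    and I: "\<And>i. i < d \<Longrightarrow> open (I i) \<and> is_interval (I i)"
    and \<alpha>: "\<alpha> \<in> PiE {..<d} I"
    and c_cong: "\<And>s t s' t'. (\<And>i. i < d \<Longrightarrow> s i = s' i \<and> t i = t' i) \<Longrightarrow> c s t = c s' t'"
    and c_add: "\<And>i s t e. i < d \<Longrightarrow> c s t = c s (t(i := e)) + c (s(i := e)) t"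
    and c_nonneg: "\<And>s t. (\<And>i. i < d \<Longrightarrow> s i \<in> I i \<and> t i \<in> I i \<and> s i \<le> t i) \<Longrightarrow> 0 \<le> c s t"
begin

lemma c_degenerate:
  assumes "i < d" "s i = t i"
  shows "c s t = 0"
proof -
  have "t(i := t i) = t" "s(i := t i) = s" using assms(2) by auto
  then show ?thesis using c_add[OF assms(1), of s t "t i"] by simp
qed

definition subbox :: "(nat \<Rightarrow> real) \<Rightarrow> (nat \<Rightarrow> real) \<Rightarrow> bool" where
  "subbox s t \<longleftrightarrow> (\<forall>i<d. s i \<in> I i \<and> t i \<in> I i \<and> s i \<le> t i)"

lemma subbox_nonneg: "subbox s t \<Longrightarrow> 0 \<le> c s t"
  by (rule c_nonneg) (simp add: subbox_def)

lemma between: "i < d \<Longrightarrow> x \<in> I i \<Longrightarrow> y \<in> I i \<Longrightarrow> x \<le> z \<Longrightarrow> z \<le> y \<Longrightarrow> z \<in> I i"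
  using I[of i] mem_is_interval_1_I by blast

lemma subbox_split:
  assumes "subbox s t" "i < d" "s i \<le> e" "e \<le> t i"
  shows "subbox s (t(i := e))" "subbox (s(i := e)) t"
  using assms between[of i "s i" "t i" e] by (auto simp: subbox_def)

text \<open>Enlarge one coordinate at a time, m counting the enlarged ones; each enlargement adds
  two boxes of nonnegative content.\<close>

lemma c_mono:
  assumes st: "subbox s t" and pq: "\<And>i. i < d \<Longrightarrow> p i \<in> I i \<and> q i \<in> I i \<and> p i \<le> s i \<and> t i \<le> q i"
  shows "c s t \<le> c p q"
proof -
  have "c s t \<le> c (\<lambda>i. if i < m then p i else s i) (\<lambda>i. if i < m then q i else t i)" if "m \<le> d" for m
    using that
  proof (induction m)
    case (Suc m)
    let ?s = "\<lambda>i. if i < m then p i else s i" and ?t = "\<lambda>i. if i < m then q i else t i"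
    let ?s' = "\<lambda>i. if i < Suc m then p i else s i" and ?t' = "\<lambda>i. if i < Suc m then q i else t i"
    have m: "m < d" using Suc by simp
    have sb: "s i \<in> I i \<and> t i \<in> I i \<and> s i \<le> t i" if "i < d" for i using st that by (simp add: subbox_def)
    have sb2: "p i \<le> q i" if "i < d" for i using sb[OF that] pq[OF that] by linarith
    have e1: "?s' = ?s(m := p m)" "?t' = ?t(m := q m)" by (auto simp: less_Suc_eq)
    have "c ?s' ?t' = c ?s' (?t'(m := s m)) + c (?s'(m := s m)) ?t'" by (rule c_add[OF m])
    also have "c (?s'(m := s m)) ?t' = c (?s'(m := s m)) (?t'(m := t m)) + c ((?s'(m := s m))(m := t m)) ?t'"
      by (rule c_add[OF m])
    also have "c (?s'(m := s m)) (?t'(m := t m)) = c ?s ?t"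
      by (rule c_cong) (auto simp: less_Suc_eq)
    moreover have "0 \<le> c ?s' (?t'(m := s m))"
      by (rule subbox_nonneg) (use pq sb sb2 m in \<open>auto simp: subbox_def less_Suc_eq\<close>)
    moreover have "0 \<le> c ((?s'(m := s m))(m := t m)) ?t'"
      by (rule subbox_nonneg) (use pq sb sb2 m in \<open>auto simp: subbox_def less_Suc_eq\<close>)
    ultimately show ?case using Suc by linarith
  qed simp
  from this[of d] have "c s t \<le> c (\<lambda>i. if i < d then p i else s i) (\<lambda>i. if i < d then q i else t i)" by simp
  also have "\<dots> = c p q" by (rule c_cong) simp
  finally show ?thesis .
qed

lemma clip_nonneg:
  assumes "subbox s t" "subbox a b"
  shows "0 \<le> c (clip s t a) (clip s t b)"
proof (rule c_nonneg)
  fix j assume j: "j < d"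
  then have "s j \<in> I j" "t j \<in> I j" "s j \<le> t j" "a j \<le> b j" using assms by (auto simp: subbox_def)
  then show "clip s t a j \<in> I j \<and> clip s t b j \<in> I j \<and> clip s t a j \<le> clip s t b j"
    using between[OF j, of "s j" "t j"] by (auto simp: clip_def)
qed

text \<open>A cut of [s, t] at e also cuts the intersection with [a, b]; if e is not strictly
  between a i and b i, one of the two pieces is degenerate.\<close>

lemma clip_add:
  assumes i: "i < d" and e: "s i \<le> e" "e \<le> t i" and ab: "a i \<le> b i"
  shows "c (clip s t a) (clip s t b) = c (clip s (t(i := e)) a) (clip s (t(i := e)) b)
    + c (clip (s(i := e)) t a) (clip (s(i := e)) t b)"
proof -
  let ?u = "clip s t a" and ?v = "clip s t b"
  have eq: "clip s (t(i := e)) a = ?u(i := max (s i) (min e (a i)))"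
    "clip s (t(i := e)) b = ?v(i := max (s i) (min e (b i)))"
    "clip (s(i := e)) t a = ?u(i := max e (min (t i) (a i)))"
    "clip (s(i := e)) t b = ?v(i := max e (min (t i) (b i)))"
    by (auto simp: clip_def)
  consider "b i \<le> e" | "e \<le> a i" | "a i \<le> e" "e \<le> b i" by linarith
  then show ?thesis
  proof cases
    case 1
    have "?u(i := max (s i) (min e (a i))) = ?u" "?v(i := max (s i) (min e (b i))) = ?v"
      using 1 e ab by (auto simp: clip_def)
    moreover have "c (?u(i := max e (min (t i) (a i)))) (?v(i := max e (min (t i) (b i)))) = 0"
      by (rule c_degenerate[OF i]) (use 1 e ab in auto)
    ultimately show ?thesis unfolding eq by simp
  next
    case 2
    have "?u(i := max e (min (t i) (a i))) = ?u" "?v(i := max e (min (t i) (b i))) = ?v"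
      using 2 e ab by (auto simp: clip_def)
    moreover have "c (?u(i := max (s i) (min e (a i)))) (?v(i := max (s i) (min e (b i)))) = 0"
      by (rule c_degenerate[OF i]) (use 2 e ab in auto)
    ultimately show ?thesis unfolding eq by simp
  next
    case 3
    have "?u(i := max (s i) (min e (a i))) = ?u" "?v(i := max (s i) (min e (b i))) = ?v(i := e)"
      "?u(i := max e (min (t i) (a i))) = ?u(i := e)" "?v(i := max e (min (t i) (b i))) = ?v"
      using 3 e ab by (auto simp: clip_def)
    then show ?thesis unfolding eq using c_add[OF i, of ?u ?v e] by simp
  qed
qed

text \<open>The third component of a cell is the left end point of the interval \<open>[r, r + c s t)\<close> of the line
  that is assigned to the box \<open>[s, t)\<close>; the step keeps the half whose interval contains \<open>\<omega>\<close>.\<close>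

definition step :: "nat \<times> real \<Rightarrow> real \<Rightarrow> cell \<Rightarrow> cell" where
  "step x \<omega> = (\<lambda>(s, t, r). let i = fst x; e = snd x in
     if s i < e \<and> e < t i
     then let r' = r + c s (t(i := e)) in
       if \<omega> < r' then (s, t(i := e), r) else (s(i := e), t, r')
     else (s, t, r))"

definition descend :: "(nat \<times> real) list \<Rightarrow> real \<Rightarrow> cell \<Rightarrow> cell" where
  "descend ls \<omega> = fold (\<lambda>x. step x \<omega>) ls"

text \<open>The interval of a cut box is the disjoint union of the intervals of its halves, and on
  each of them the remaining descent starts afresh. Both inductions below rest on this
  identity.\<close>

lemma descend_split:
  fixes r :: real
  assumes st: "subbox s t" and i: "i < d" and e: "s i < e" "e < t i"
  defines "r' \<equiv> r + c s (t(i := e))"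
  shows "{\<omega> \<in> {r..<r + c s t}. P (descend ((i, e) # ls) \<omega> (s, t, r))} =
      {\<omega> \<in> {r..<r + c s (t(i := e))}. P (descend ls \<omega> (s, t(i := e), r))} \<union>
      {\<omega> \<in> {r'..<r' + c (s(i := e)) t}. P (descend ls \<omega> (s(i := e), t, r'))}"
proof -
  have "c s t = c s (t(i := e)) + c (s(i := e)) t" by (rule c_add[OF i])
  moreover have "0 \<le> c s (t(i := e))" "0 \<le> c (s(i := e)) t"
    using subbox_split[OF st i] e by (auto intro: subbox_nonneg)
  ultimately show ?thesis
    using e by (auto simp: descend_def step_def r'_def Let_def)
qed

lemma descend_skip:
  "\<not> (s i < e \<and> e < t i) \<Longrightarrow> descend ((i, e) # ls) \<omega> (s, t, r) = descend ls \<omega> (s, t, r)"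
  by (auto simp: descend_def step_def)

text \<open>Finitely many cuts produce finitely many cells, each attained on an interval of the
  line. This is why P can be arbitrary.\<close>

lemma descend_sets:
  assumes "subbox s t" "fst ` set ls \<subseteq> {..<d}"
  shows "{\<omega> \<in> {r..<r + c s t}. P (descend ls \<omega> (s, t, r))} \<in> sets lborel"
  using assms
proof (induction ls arbitrary: s t r)
  case Nil
  then show ?case by (cases "P (s, t, r)") (auto simp: descend_def)
next
  case (Cons x ls)
  obtain i e where x: "x = (i, e)" by fastforce
  have i: "i < d" and ls: "fst ` set ls \<subseteq> {..<d}" using Cons.prems x by auto
  show ?case
  proof (cases "s i < e \<and> e < t i")
    case True
    then show ?thesis unfolding x using descend_split[OF Cons.prems(1) i]
        subbox_split[OF Cons.prems(1) i] Cons.IH[OF _ ls] by auto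
  next
    case False
    then show ?thesis unfolding x descend_skip[where s = s and t = t and i = i and e = e, OF False] using Cons.IH[OF Cons.prems(1) ls] by simp
  qed
qed

definition inside :: "(nat \<Rightarrow> real) \<Rightarrow> (nat \<Rightarrow> real) \<Rightarrow> cell \<Rightarrow> bool" where
  "inside a b = (\<lambda>(s, t, r). \<forall>i<d. a i \<le> s i \<and> t i \<le> b i)"

text \<open>When all faces of [a, b] that cross the box have been used as cuts, every final cell
  lies in [a, b] or meets it in a degenerate box. By \<open>clip_add\<close> the lengths of the
  former add up to the content of the intersection.\<close>

lemma descend_emeasure:
  assumes "subbox s t" "fst ` set ls \<subseteq> {..<d}" and ab: "subbox a b"
    and "\<And>i. i < d \<Longrightarrow> s i < a i \<Longrightarrow> a i < t i \<Longrightarrow> (i, a i) \<in> set ls"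
    and "\<And>i. i < d \<Longrightarrow> s i < b i \<Longrightarrow> b i < t i \<Longrightarrow> (i, b i) \<in> set ls"
  shows "emeasure lborel {\<omega> \<in> {r..<r + c s t}. inside a b (descend ls \<omega> (s, t, r))}
    = ennreal (c (clip s t a) (clip s t b))"
  using assms(1,2,4,5)
proof (induction ls arbitrary: s t r)
  case Nil
  have abi: "a i \<le> b i" if "i < d" for i using ab that by (simp add: subbox_def)
  have sti: "s i \<le> t i" if "i < d" for i using Nil.prems(1) that by (simp add: subbox_def)
  have na: "a i \<le> s i \<or> t i \<le> a i" and nb: "b i \<le> s i \<or> t i \<le> b i" if "i < d" for i
  proof -
    have "\<not> (s i < a i \<and> a i < t i)" "\<not> (s i < b i \<and> b i < t i)"
      using Nil.prems(3)[OF that] Nil.prems(4)[OF that] by auto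
    then show "a i \<le> s i \<or> t i \<le> a i" "b i \<le> s i \<or> t i \<le> b i" by linarith+
  qed
  show ?case
  proof (cases "inside a b (s, t, r)")
    case True
    have "c (clip s t a) (clip s t b) = c s t"
    proof (rule c_cong)
      fix i assume i: "i < d"
      then have "a i \<le> s i" "t i \<le> b i" using True by (auto simp: inside_def)
      then show "clip s t a i = s i \<and> clip s t b i = t i" using sti[OF i] by (auto simp: clip_def)
    qed
    moreover have "{\<omega> \<in> {r..<r + c s t}. inside a b (descend [] \<omega> (s, t, r))} = {r..<r + c s t}"
      using True by (auto simp: descend_def)
    ultimately show ?thesis using subbox_nonneg[OF Nil.prems(1)] by simp
  next
    case False
    then obtain i where i: "i < d" "\<not> (a i \<le> s i \<and> t i \<le> b i)" by (auto simp: inside_def)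
    have "clip s t a i = clip s t b i"
      using na[OF i(1)] nb[OF i(1)] abi[OF i(1)] sti[OF i(1)] i(2) by (auto simp: clip_def)
    then have "c (clip s t a) (clip s t b) = 0" by (rule c_degenerate[OF i(1)])
    then show ?thesis using False by (simp add: descend_def)
  qed
next
  case (Cons x ls)
  obtain i e where x: "x = (i, e)" by fastforce
  have i: "i < d" and ls: "fst ` set ls \<subseteq> {..<d}" using Cons.prems x by auto
  have abi: "a i \<le> b i" using ab i by (simp add: subbox_def)
  show ?case
  proof (cases "s i < e \<and> e < t i")
    case True
    then have e: "s i \<le> e" "e \<le> t i" by auto
    note sp = subbox_split[OF Cons.prems(1) i e]
    define r' where "r' = r + c s (t(i := e))"
    let ?L = "{\<omega> \<in> {r..<r + c s (t(i := e))}. inside a b (descend ls \<omega> (s, t(i := e), r))}"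
    let ?R = "{\<omega> \<in> {r'..<r' + c (s(i := e)) t}. inside a b (descend ls \<omega> (s(i := e), t, r'))}"
    have L: "emeasure lborel ?L = ennreal (c (clip s (t(i := e)) a) (clip s (t(i := e)) b))"
    proof (rule Cons.IH[OF sp(1) ls])
      fix j assume j: "j < d"
      show "(j, a j) \<in> set ls" if "s j < a j" "a j < (t(i := e)) j"
        using Cons.prems(3)[OF j] that True unfolding x by (cases "j = i") auto
      show "(j, b j) \<in> set ls" if "s j < b j" "b j < (t(i := e)) j"
        using Cons.prems(4)[OF j] that True unfolding x by (cases "j = i") auto
    qed
    have R: "emeasure lborel ?R = ennreal (c (clip (s(i := e)) t a) (clip (s(i := e)) t b))"
    proof (rule Cons.IH[OF sp(2) ls])
      fix j assume j: "j < d"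
      show "(j, a j) \<in> set ls" if "(s(i := e)) j < a j" "a j < t j"
        using Cons.prems(3)[OF j] that True unfolding x by (cases "j = i") auto
      show "(j, b j) \<in> set ls" if "(s(i := e)) j < b j" "b j < t j"
        using Cons.prems(4)[OF j] that True unfolding x by (cases "j = i") auto
    qed
    have "{\<omega> \<in> {r..<r + c s t}. inside a b (descend (x # ls) \<omega> (s, t, r))} = ?L \<union> ?R"
      unfolding x r'_def using True by (intro descend_split[OF Cons.prems(1) i]) auto
    moreover have "emeasure lborel (?L \<union> ?R) = emeasure lborel ?L + emeasure lborel ?R"
      by (intro plus_emeasure[symmetric] descend_sets sp ls) (auto simp: r'_def)
    ultimately show ?thesis
      unfolding L R clip_add[where i = i and s = s and t = t and a = a and b = b, OF i e abi] using clip_nonneg[OF sp(1) ab] clip_nonneg[OF sp(2) ab] by (simp add: ennreal_plus)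
  next
    case False
    have "emeasure lborel {\<omega> \<in> {r..<r + c s t}. inside a b (descend ls \<omega> (s, t, r))}
      = ennreal (c (clip s t a) (clip s t b))"
      by (rule Cons.IH[OF Cons.prems(1) ls]) (use Cons.prems(3,4) False in \<open>auto simp: x\<close>)
    then show ?thesis unfolding x descend_skip[where s = s and t = t and i = i and e = e, OF False] .
  qed
qed

end

section \<open>Exhaustion of the whole box and its layout on the line\<close>

text \<open>The rationals in E make the cuts dense, so that cells shrink to points. \<sigma>
  enumerates all cuts, possibly with repetitions.\<close>

locale box_split = box_content +
  fixes E :: "nat \<Rightarrow> real set" and \<sigma> :: "nat \<Rightarrow> nat \<times> real"
  assumes E: "\<And>i. i < d \<Longrightarrow> countable (E i) \<and> E i \<subseteq> I i \<and> I i \<inter> \<rat> \<subseteq> E i"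
    and \<sigma>: "range \<sigma> = Sigma {..<d} E"
begin

lemma \<sigma>_mem: "fst (\<sigma> k) < d" "snd (\<sigma> k) \<in> E (fst (\<sigma> k))"
  using \<sigma> by (metis SigmaE2 lessThan_iff prod.collapse rangeI)+

text \<open>The whole box need not have finite content. It is exhausted from \<open>\<alpha>\<close> by moving one face at a
  time; each move adds a single box, the peel.\<close>

definition grow :: "nat \<times> real \<Rightarrow> (nat \<Rightarrow> real) \<times> (nat \<Rightarrow> real) \<Rightarrow> (nat \<Rightarrow> real) \<times> (nat \<Rightarrow> real)" where
  "grow x = (\<lambda>(s, t). let i = fst x; e = snd x in
     if e < s i then (s(i := e), t) else if t i < e then (s, t(i := e)) else (s, t))"

text \<open>An idle move peels off the degenerate box (s, s); its content is 0, so its interval on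
  the line is empty.\<close>

definition peel :: "nat \<times> real \<Rightarrow> (nat \<Rightarrow> real) \<times> (nat \<Rightarrow> real) \<Rightarrow> (nat \<Rightarrow> real) \<times> (nat \<Rightarrow> real)" where
  "peel x = (\<lambda>(s, t). let i = fst x; e = snd x in
     if e < s i then (s(i := e), t(i := s i)) else if t i < e then (s(i := t i), t(i := e)) else (s, s))"

primrec envelope :: "nat \<Rightarrow> (nat \<Rightarrow> real) \<times> (nat \<Rightarrow> real)" where
  "envelope 0 = (\<alpha>, \<alpha>)"
| "envelope (Suc q) = grow (\<sigma> q) (envelope q)"

abbreviation "lo q \<equiv> fst (envelope q)"
abbreviation "hi q \<equiv> snd (envelope q)"

definition "lo' q = fst (peel (\<sigma> q) (envelope q))"
definition "hi' q = snd (peel (\<sigma> q) (envelope q))"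
text \<open>By \<open>C_Suc\<close> the q-th peel occupies the interval [C q, C (Suc q)) of the
  line, so \<open>shell\<close> recovers the peel from a point.\<close>

definition "C q = c (lo q) (hi q)"

lemma envelope_mem: "i < d \<Longrightarrow> lo q i \<in> insert (\<alpha> i) (E i) \<and> hi q i \<in> insert (\<alpha> i) (E i) \<and> lo q i \<le> hi q i"
proof (induction q)
  case (Suc q)
  then show ?case using \<sigma>_mem[of q]
    by (auto simp: grow_def Let_def case_prod_beta split: if_splits)
qed simp

lemma grid_in_I: "i < d \<Longrightarrow> insert (\<alpha> i) (E i) \<subseteq> I i"
  using E \<alpha> by auto

lemma envelope_subbox: "subbox (lo q) (hi q)"
  unfolding subbox_def using envelope_mem grid_in_I by blast

lemma peel_mem: "i < d \<Longrightarrow> lo' q i \<in> insert (\<alpha> i) (E i) \<and> hi' q i \<in> insert (\<alpha> i) (E i) \<and> lo' q i \<le> hi' q i"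
  using envelope_mem[of i q] \<sigma>_mem[of q]
  by (auto simp: lo'_def hi'_def peel_def Let_def case_prod_beta split: if_splits)

lemma peel_subbox: "subbox (lo' q) (hi' q)"
  unfolding subbox_def using peel_mem grid_in_I by blast

text \<open>Seen from the new envelope, growing is a cut at the former face into the old envelope
  and the peel, so \<open>clip_add\<close> applies.\<close>

lemma envelope_clip_add:
  assumes ab: "\<And>i. i < d \<Longrightarrow> a i \<le> b i"
  shows "c (clip (lo (Suc q)) (hi (Suc q)) a) (clip (lo (Suc q)) (hi (Suc q)) b) =
    c (clip (lo q) (hi q) a) (clip (lo q) (hi q) b) + c (clip (lo' q) (hi' q) a) (clip (lo' q) (hi' q) b)"
proof -
  obtain i e where x: "\<sigma> q = (i, e)" by fastforce
  have i: "i < d" using \<sigma>_mem(1)[of q] x by simp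
  obtain s t where st: "envelope q = (s, t)" by fastforce
  have le: "s i \<le> t i" using envelope_mem[OF i, of q] st by simp
  consider "e < s i" | "t i < e" | "s i \<le> e" "e \<le> t i" by linarith
  then show ?thesis
  proof cases
    case 1
    then show ?thesis
      using clip_add[where i = i and s = "s(i := e)" and t = t and a = a and b = b and e = "s i", OF i _ _ ab[OF i]] le
      by (simp add: st x grow_def peel_def lo'_def hi'_def)
  next
    case 2
    then show ?thesis
      using clip_add[where i = i and s = s and t = "t(i := e)" and a = a and b = b and e = "t i", OF i _ _ ab[OF i]] le
      by (simp add: st x grow_def peel_def lo'_def hi'_def)
  next
    case 3
    have "c (clip s s a) (clip s s b) = 0" by (rule c_degenerate[OF i]) (simp add: clip_def)
    then show ?thesis using 3 by (simp add: st x grow_def peel_def lo'_def hi'_def)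
  qed
qed

lemma C_Suc: "C (Suc q) = C q + c (lo' q) (hi' q)"
proof -
  obtain i e where x: "\<sigma> q = (i, e)" by fastforce
  have i: "i < d" using \<sigma>_mem(1)[of q] x by simp
  obtain s t where st: "envelope q = (s, t)" by fastforce
  have le: "s i \<le> t i" using envelope_mem[OF i, of q] st by simp
  consider "e < s i" | "t i < e" | "s i \<le> e" "e \<le> t i" by linarith
  then show ?thesis
  proof cases
    case 1
    then show ?thesis
      using c_add[OF i, of "s(i := e)" t "s i"]
      by (simp add: st x grow_def peel_def lo'_def hi'_def C_def)
  next
    case 2
    then show ?thesis
      using c_add[OF i, of s "t(i := e)" "t i"] le
      by (simp add: st x grow_def peel_def lo'_def hi'_def C_def)
  next
    case 3
    have "c s s = 0" by (rule c_degenerate[OF i]) simp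
    then show ?thesis using 3 by (simp add: st x grow_def peel_def lo'_def hi'_def C_def)
  qed
qed

lemma C_0: "C 0 = 0"
  using c_degenerate[of 0 \<alpha> \<alpha>] d by (simp add: C_def)

lemma C_mono: "incseq C"
  by (rule incseq_SucI) (use C_Suc subbox_nonneg[OF peel_subbox] in auto)

definition shell :: "real \<Rightarrow> nat" where
  "shell \<omega> = (LEAST q. \<omega> < C (Suc q))"

lemma shell_eq:
  assumes "C q \<le> \<omega>" "\<omega> < C (Suc q)"
  shows "shell \<omega> = q"
  unfolding shell_def
proof (rule Least_equality)
  fix r assume "\<omega> < C (Suc r)"
  then have "\<not> Suc r \<le> q" using incseqD[OF C_mono, of "Suc r" q] assms by linarith
  then show "q \<le> r" by simp
qed (rule assms)

definition valid :: "real set" where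
  "valid = (\<Union>N. {0..<C N})"

lemma valid_shell:
  assumes "\<omega> \<in> valid"
  shows "C (shell \<omega>) \<le> \<omega>" "\<omega> < C (Suc (shell \<omega>))"
proof -
  obtain N where N: "0 \<le> \<omega>" "\<omega> < C N" using assms by (auto simp: valid_def)
  have "N \<noteq> 0" using N C_0 by (intro notI) simp
  then have ex: "\<omega> < C (Suc (N - 1))" using N by simp
  show "\<omega> < C (Suc (shell \<omega>))" unfolding shell_def using ex by (rule LeastI)
  show "C (shell \<omega>) \<le> \<omega>"
  proof (cases "shell \<omega>")
    case 0
    then show ?thesis using C_0 N by simp
  next
    case (Suc r)
    then have "\<not> \<omega> < C (Suc r)" using not_less_Least[of r "\<lambda>q. \<omega> < C (Suc q)"] by (simp add: shell_def)
    then show ?thesis using Suc by simp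
  qed
qed

definition cell :: "nat \<Rightarrow> real \<Rightarrow> cell" where
  "cell k \<omega> = descend (map \<sigma> [0..<k]) \<omega> (lo' (shell \<omega>), hi' (shell \<omega>), C (shell \<omega>))"

lemma cell_0: "cell 0 \<omega> = (lo' (shell \<omega>), hi' (shell \<omega>), C (shell \<omega>))"
  by (simp add: cell_def descend_def)

lemma cell_Suc: "cell (Suc k) \<omega> = step (\<sigma> k) \<omega> (cell k \<omega>)"
  by (simp add: cell_def descend_def)

lemma list_fst: "fst ` set (map \<sigma> [0..<k]) \<subseteq> {..<d}"
  using \<sigma>_mem(1) by auto

lemma level_split:
  "{\<omega> \<in> {0..<C (Suc N)}. P (cell k \<omega>)} = {\<omega> \<in> {0..<C N}. P (cell k \<omega>)} \<union>
    {\<omega> \<in> {C N..<C N + c (lo' N) (hi' N)}. P (descend (map \<sigma> [0..<k]) \<omega> (lo' N, hi' N, C N))}"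
proof -
  have le: "0 \<le> C N" "C N \<le> C (Suc N)"
    using C_0 incseqD[OF C_mono, of 0 N] incseqD[OF C_mono, of N "Suc N"] by auto
  have eq: "P (cell k \<omega>) = P (descend (map \<sigma> [0..<k]) \<omega> (lo' N, hi' N, C N))"
    if "\<omega> \<in> {C N..<C (Suc N)}" for \<omega>
    using shell_eq[of N \<omega>] that by (simp add: cell_def)
  have "{\<omega> \<in> {0..<C (Suc N)}. P (cell k \<omega>)} = {\<omega> \<in> {0..<C N}. P (cell k \<omega>)} \<union>
      {\<omega> \<in> {C N..<C (Suc N)}. P (cell k \<omega>)}"
    using le by auto
  also have "{\<omega> \<in> {C N..<C (Suc N)}. P (cell k \<omega>)}
      = {\<omega> \<in> {C N..<C (Suc N)}. P (descend (map \<sigma> [0..<k]) \<omega> (lo' N, hi' N, C N))}"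
    by (rule Collect_cong, rule conj_cong[OF refl eq])
  finally show ?thesis unfolding C_Suc .
qed

lemma level_sets: "{\<omega> \<in> {0..<C N}. P (cell k \<omega>)} \<in> sets lborel"
proof (induction N)
  case 0
  then show ?case by (simp add: C_0)
next
  case (Suc N)
  show ?case unfolding level_split using Suc descend_sets[OF peel_subbox list_fst] by (intro sets.Un)
qed

lemma valid_sets: "{\<omega> \<in> valid. P (cell k \<omega>)} \<in> sets lborel"
proof -
  have "{\<omega> \<in> valid. P (cell k \<omega>)} = (\<Union>N. {\<omega> \<in> {0..<C N}. P (cell k \<omega>)})" by (auto simp: valid_def)
  then show ?thesis using level_sets by auto
qed

text \<open>[0, C N) is the part of the line that belongs to the N-th envelope, hence the clipping
  to that envelope. The induction adds one peel at a time.\<close>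

lemma level_emeasure:
  assumes ab: "subbox a b" and k: "\<And>i. i < d \<Longrightarrow> (i, a i) \<in> \<sigma> ` {..<k} \<and> (i, b i) \<in> \<sigma> ` {..<k}"
  shows "emeasure lborel {\<omega> \<in> {0..<C N}. inside a b (cell k \<omega>)} = ennreal (c (clip (lo N) (hi N) a) (clip (lo N) (hi N) b))"
proof (induction N)
  case 0
  have "c (clip \<alpha> \<alpha> a) (clip \<alpha> \<alpha> b) = 0" using d by (intro c_degenerate[of 0]) (auto simp: clip_def)
  then show ?case by (simp add: C_0)
next
  case (Suc N)
  let ?A = "{\<omega> \<in> {0..<C N}. inside a b (cell k \<omega>)}"
  let ?B = "{\<omega> \<in> {C N..<C N + c (lo' N) (hi' N)}. inside a b (descend (map \<sigma> [0..<k]) \<omega> (lo' N, hi' N, C N))}"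
  have st: "set (map \<sigma> [0..<k]) = \<sigma> ` {..<k}" by (simp add: lessThan_atLeast0)
  have B: "emeasure lborel ?B = ennreal (c (clip (lo' N) (hi' N) a) (clip (lo' N) (hi' N) b))"
  proof (rule descend_emeasure[OF peel_subbox list_fst ab])
    fix i assume "i < d"
    then show "(i, a i) \<in> set (map \<sigma> [0..<k])" "(i, b i) \<in> set (map \<sigma> [0..<k])"
      unfolding st using k by simp_all
  qed
  have "emeasure lborel (?A \<union> ?B) = emeasure lborel ?A + emeasure lborel ?B"
  proof (rule plus_emeasure[symmetric])
    show "?A \<in> sets lborel" by (rule level_sets)
    show "?B \<in> sets lborel" by (rule descend_sets[OF peel_subbox list_fst])
    show "?A \<inter> ?B = {}" by auto
  qed
  moreover have "c (clip (lo (Suc N)) (hi (Suc N)) a) (clip (lo (Suc N)) (hi (Suc N)) b) =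
    c (clip (lo N) (hi N) a) (clip (lo N) (hi N) b) + c (clip (lo' N) (hi' N) a) (clip (lo' N) (hi' N) b)"
    by (rule envelope_clip_add) (use ab in \<open>simp add: subbox_def\<close>)
  ultimately show ?case
    unfolding level_split Suc.IH B using clip_nonneg[OF envelope_subbox ab] clip_nonneg[OF peel_subbox ab] by (simp add: ennreal_plus)
qed

lemma envelope_grows: "lo (Suc q) i \<le> lo q i" "hi q i \<le> hi (Suc q) i"
  by (auto simp: grow_def case_prod_beta Let_def)

lemma envelope_covers:
  assumes "i < d" "e \<in> E i"
  shows "\<exists>N. \<forall>M\<ge>N. lo M i \<le> e \<and> e \<le> hi M i"
proof -
  have "(i, e) \<in> range \<sigma>" unfolding \<sigma> using assms by simp
  then obtain N where N: "(i, e) = \<sigma> N" by (elim rangeE)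
  have le: "lo N i \<le> hi N i" using envelope_mem[OF assms(1)] by simp
  have "lo (Suc N + k) i \<le> e \<and> e \<le> hi (Suc N + k) i" for k
  proof (induction k)
    case 0
    show ?case using N[symmetric] le by (simp add: grow_def case_prod_beta Let_def)
  next
    case (Suc k)
    have "Suc N + Suc k = Suc (Suc N + k)" by simp
    then show ?case
      using Suc order_trans[OF envelope_grows(1)[of "Suc N + k" i], of e]
        order_trans[OF _ envelope_grows(2)[of "Suc N + k" i], of e] by (simp only:)
  qed
  then have "lo M i \<le> e \<and> e \<le> hi M i" if "Suc N \<le> M" for M
    using that le_add_diff_inverse[of "Suc N" M] by metis
  then show ?thesis by blast
qed

text \<open>Let N tend to infinity with k fixed: the envelopes eventually contain the grid box
  [a, b], and the clipping disappears.\<close>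

lemma valid_emeasure:
  assumes ab: "subbox a b" and E': "\<And>i. i < d \<Longrightarrow> a i \<in> E i \<and> b i \<in> E i"
    and k: "\<And>i. i < d \<Longrightarrow> (i, a i) \<in> \<sigma> ` {..<k} \<and> (i, b i) \<in> \<sigma> ` {..<k}"
  shows "emeasure lborel {\<omega> \<in> valid. inside a b (cell k \<omega>)} = ennreal (c a b)"
proof -
  let ?A = "\<lambda>N. {\<omega> \<in> {0..<C N}. inside a b (cell k \<omega>)}"
  have U: "{\<omega> \<in> valid. inside a b (cell k \<omega>)} = (\<Union>N. ?A N)" by (auto simp: valid_def)
  have "incseq ?A"
  proof (rule incseq_SucI)
    fix N show "?A N \<subseteq> ?A (Suc N)" using incseqD[OF C_mono, of N "Suc N"] by auto
  qed
  then have lim: "(\<lambda>N. emeasure lborel (?A N)) \<longlonglongrightarrow> emeasure lborel (\<Union>N. ?A N)"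
    using level_sets by (intro Lim_emeasure_incseq) auto
  have "\<forall>\<^sub>F N in sequentially. \<forall>i\<in>{..<d}. (lo N i \<le> a i \<and> a i \<le> hi N i) \<and> (lo N i \<le> b i \<and> b i \<le> hi N i)"
  proof (intro eventually_ball_finite ballI finite_lessThan)
    fix i assume "i \<in> {..<d}"
    then have i: "i < d" by simp
    have ev: "\<forall>\<^sub>F N in sequentially. lo N i \<le> e \<and> e \<le> hi N i" if "e \<in> E i" for e
      using envelope_covers[OF i that] unfolding eventually_sequentially .
    show "\<forall>\<^sub>F N in sequentially. (lo N i \<le> a i \<and> a i \<le> hi N i) \<and> (lo N i \<le> b i \<and> b i \<le> hi N i)"
      using E'[OF i] by (intro eventually_conj[OF ev ev]) auto
  qed
  then have "\<forall>\<^sub>F N in sequentially. emeasure lborel (?A N) = ennreal (c a b)"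
  proof eventually_elim
    case (elim N)
    have "c (clip (lo N) (hi N) a) (clip (lo N) (hi N) b) = c a b"
      by (rule c_cong) (use elim in \<open>auto simp: clip_def\<close>)
    then show ?case using level_emeasure[OF ab k] by simp
  qed
  then have "(\<lambda>N. emeasure lborel (?A N)) \<longlonglongrightarrow> ennreal (c a b)" by (rule tendsto_eventually)
  from LIMSEQ_unique[OF lim this] show ?thesis unfolding U .
qed

end

section \<open>The measures of a content\<close>

lemma rational_bracket:
  fixes x :: real
  assumes "open U" "x \<in> U"
  obtains p q where "p \<in> \<rat>" "q \<in> \<rat>" "p < x" "x < q" "{p..q} \<subseteq> U"
proof -
  obtain e where e: "e > 0" "{x - e..x + e} \<subseteq> U" using open_interval_cball assms by metis
  obtain p where p: "p \<in> \<rat>" "x - e < p" "p < x" using Rats_dense_in_real[of "x - e" x] e by auto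
  obtain q where q: "q \<in> \<rat>" "x < q" "q < x + e" using Rats_dense_in_real[of x "x + e"] e by auto
  have "{p..q} \<subseteq> {x - e..x + e}" using p q by auto
  then show thesis using that p q e by blast
qed

text \<open>\<open>box_borel\<close> is generated by all open sets, not by boxes. Every open set is
  a countable union of boxes with rational corners, which reduces measurability to the
  coordinates.\<close>

lemma measurable_box_borel:
  assumes g: "g \<in> space M \<rightarrow> PiE {..<d} I"
    and m: "\<And>i. i < d \<Longrightarrow> (\<lambda>\<omega>. g \<omega> i) \<in> borel_measurable M"
    and I: "\<And>i. i < d \<Longrightarrow> open (I i)"
  shows "g \<in> measurable M (box_borel d I)"
  unfolding box_borel_def
proof (rule measurable_measure_of)
  show "{U. openin (box_topology d I) U} \<subseteq> Pow (PiE {..<d} I)"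
    using openin_subset[of "box_topology d I"] by (auto simp: topspace_box_topology)
  show "g \<in> space M \<rightarrow> PiE {..<d} I" by (rule g)
  fix U assume "U \<in> {U. openin (box_topology d I) U}"
  then have U: "openin (box_topology d I) U" by simp
  define B where "B = (\<lambda>(p, q). {u \<in> PiE {..<d} I. \<forall>i\<in>{..<d}. p i < u i \<and> u i < q i})"
  define Q where "Q = {pq \<in> PiE {..<d} (\<lambda>_. \<rat>) \<times> PiE {..<d} (\<lambda>_. \<rat> :: real set). B pq \<subseteq> U}"
  have "countable (PiE {..<d} (\<lambda>_. \<rat> :: real set))" by (intro countable_PiE) (auto simp: countable_rat)
  then have "countable Q" unfolding Q_def by (intro countable_Collect countable_SIGMA) auto
  have "U \<subseteq> (\<Union>pq\<in>Q. B pq)"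
  proof
    fix x assume x: "x \<in> U"
    then have xI: "x \<in> PiE {..<d} I" using openin_subset[OF U] by (auto simp: topspace_box_topology)
    have "\<exists>V. (\<forall>i\<in>{..<d}. openin (top_of_set (I i)) (V i)) \<and> x \<in> PiE {..<d} V \<and> PiE {..<d} V \<subseteq> U"
      using U x unfolding box_topology_def openin_product_topology_alt by auto
    then obtain V where "\<forall>i\<in>{..<d}. openin (top_of_set (I i)) (V i)"
      and V': "x \<in> PiE {..<d} V" "PiE {..<d} V \<subseteq> U" by blast
    then have V: "\<And>i. i < d \<Longrightarrow> openin (top_of_set (I i)) (V i)" "x \<in> PiE {..<d} V" "PiE {..<d} V \<subseteq> U"
      by simp_all
    have "\<exists>p q. p \<in> \<rat> \<and> q \<in> \<rat> \<and> p < x i \<and> x i < q \<and> {p..q} \<subseteq> V i" if i: "i < d" for i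
    proof -
      have "open (V i)" using V(1)[OF i] openin_open_trans I[OF i] by blast
      moreover have "x i \<in> V i" using V(2) i by auto
      ultimately show ?thesis using rational_bracket by metis
    qed
    then obtain p q where pq: "\<And>i. i < d \<Longrightarrow> p i \<in> \<rat> \<and> q i \<in> \<rat> \<and> p i < x i \<and> x i < q i \<and> {p i..q i} \<subseteq> V i"
      by metis
    let ?pq = "(restrict p {..<d}, restrict q {..<d})"
    have "B ?pq \<subseteq> PiE {..<d} V"
    proof
      fix u assume u: "u \<in> B ?pq"
      show "u \<in> PiE {..<d} V"
      proof (rule PiE_I)
        fix i assume i: "i \<in> {..<d}"
        then have "u i \<in> {p i..q i}" using u by (auto simp: B_def less_imp_le)
        then show "u i \<in> V i" using pq[of i] i by blast
      next
        fix i assume "i \<notin> {..<d}"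
        then show "u i = undefined" using u by (auto simp: B_def PiE_def extensional_def)
      qed
    qed
    then have "B ?pq \<subseteq> U" using V(3) by blast
    moreover have "?pq \<in> PiE {..<d} (\<lambda>_. \<rat>) \<times> PiE {..<d} (\<lambda>_. \<rat>)" using pq by auto
    ultimately have "?pq \<in> Q" by (simp add: Q_def)
    moreover have "x \<in> B ?pq" using xI pq by (auto simp: B_def)
    ultimately show "x \<in> (\<Union>pq\<in>Q. B pq)" by blast
  qed
  moreover have "(\<Union>pq\<in>Q. B pq) \<subseteq> U" unfolding Q_def by blast
  ultimately have "U = (\<Union>pq\<in>Q. B pq)" by (rule subset_antisym)
  then have "g -` U \<inter> space M = g -` (\<Union>pq\<in>Q. B pq) \<inter> space M" by (rule arg_cong)
  also have "\<dots> = (\<Union>pq\<in>Q. g -` B pq \<inter> space M)" by auto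
  finally have eq: "g -` U \<inter> space M = (\<Union>pq\<in>Q. g -` B pq \<inter> space M)" .
  have "g -` B pq \<inter> space M \<in> sets M" for pq
  proof -
    obtain p q where pq: "pq = (p, q)" by fastforce
    have "g -` B pq \<inter> space M = {\<omega> \<in> space M. \<forall>i\<in>{..<d}. p i < g \<omega> i \<and> g \<omega> i < q i}"
      using g by (auto simp: pq B_def)
    also have "\<dots> \<in> sets M"
    proof (intro sets.sets_Collect_finite_All finite_lessThan sets.sets_Collect_conj)
      fix i assume "i \<in> {..<d}"
      then have [measurable]: "(\<lambda>\<omega>. g \<omega> i) \<in> borel_measurable M" using m by simp
      show "{\<omega> \<in> space M. p i < g \<omega> i} \<in> sets M" "{\<omega> \<in> space M. g \<omega> i < q i} \<in> sets M" by measurable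
    qed
    finally show ?thesis .
  qed
  then show "g -` U \<inter> space M \<in> sets M" unfolding eq using \<open>countable Q\<close> by (intro sets.countable_UN') auto
qed

text \<open>For s \<le> t the indicator of this set within the box is the product of the functions
  \<open>chi (b i) (s i) (t i)\<close>.\<close>

definition half_open_box :: "nat \<Rightarrow> (nat \<Rightarrow> real set) \<Rightarrow> (nat \<Rightarrow> side) \<Rightarrow> (nat \<Rightarrow> real) \<Rightarrow> (nat \<Rightarrow> real) \<Rightarrow> (nat \<Rightarrow> real) set" where
  "half_open_box d I b s t = {u \<in> PiE {..<d} I.
     \<forall>i\<in>{..<d}. if b i = SideL then s i \<le> u i \<and> u i < t i else s i < u i \<and> u i \<le> t i}"

lemma half_open_box_sets: "half_open_box d I b s t \<in> sets (box_borel d I)"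
proof -
  have "half_open_box d I b s t = {u \<in> space (box_borel d I).
     \<forall>i\<in>{..<d}. if b i = SideL then s i \<le> u i \<and> u i < t i else s i < u i \<and> u i \<le> t i}"
    by (simp add: half_open_box_def)
  also have "\<dots> \<in> sets (box_borel d I)"
  proof (intro sets.sets_Collect_finite_All finite_lessThan)
    fix i assume "i \<in> {..<d}"
    then have [measurable]: "(\<lambda>u. u i) \<in> borel_measurable (box_borel d I)" by simp
    show "{u \<in> space (box_borel d I). if b i = SideL then s i \<le> u i \<and> u i < t i else s i < u i \<and> u i \<le> t i}
      \<in> sets (box_borel d I)"
      by (cases "b i = SideL") (simp_all del: space_box_borel, measurable)
  qed
  finally show ?thesis .
qed

section \<open>Limits of cells and the image measures\<close>

context box_split
begin

abbreviation "cs k \<omega> \<equiv> fst (cell k \<omega>)"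
abbreviation "ct k \<omega> \<equiv> fst (snd (cell k \<omega>))"

lemma cell_step:
  assumes "i < d" "cs k \<omega> i < ct k \<omega> i"
  shows "cs k \<omega> i \<le> cs (Suc k) \<omega> i" "ct (Suc k) \<omega> i \<le> ct k \<omega> i" "cs (Suc k) \<omega> i < ct (Suc k) \<omega> i"
    "\<sigma> k = (i, e) \<Longrightarrow> \<not> (cs (Suc k) \<omega> i < e \<and> e < ct (Suc k) \<omega> i)"
    "cs k \<omega> i \<in> insert (\<alpha> i) (E i) \<Longrightarrow> cs (Suc k) \<omega> i \<in> insert (\<alpha> i) (E i)"
proof -
  obtain s t r where c: "cell k \<omega> = (s, t, r)" by (metis prod.exhaust)
  obtain j e' where x: "\<sigma> k = (j, e')" by fastforce
  have e': "e' \<in> E j" using \<sigma>_mem(2)[of k] x by simp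
  show "cs k \<omega> i \<le> cs (Suc k) \<omega> i" "ct (Suc k) \<omega> i \<le> ct k \<omega> i" "cs (Suc k) \<omega> i < ct (Suc k) \<omega> i"
    "\<sigma> k = (i, e) \<Longrightarrow> \<not> (cs (Suc k) \<omega> i < e \<and> e < ct (Suc k) \<omega> i)"
    "cs k \<omega> i \<in> insert (\<alpha> i) (E i) \<Longrightarrow> cs (Suc k) \<omega> i \<in> insert (\<alpha> i) (E i)"
    using assms(2) e' unfolding cell_Suc c x by (auto simp: step_def Let_def)
qed

text \<open>A degenerate peel has content 0 and thus an empty interval on the line, so no valid
  \<omega> belongs to it.\<close>

lemma cell_start:
  assumes "\<omega> \<in> valid" "i < d"
  shows "cs 0 \<omega> i < ct 0 \<omega> i"
proof -
  let ?q = "shell \<omega>"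
  have "C ?q < C (Suc ?q)" using valid_shell[OF assms(1)] by linarith
  then have "c (lo' ?q) (hi' ?q) \<noteq> 0" using C_Suc[of ?q] by auto
  then have "lo' ?q i \<noteq> hi' ?q i" using c_degenerate[OF assms(2)] by blast
  then show ?thesis using peel_mem[OF assms(2), of ?q] by (auto simp: cell_0)
qed

lemma cell_lt: "\<omega> \<in> valid \<Longrightarrow> i < d \<Longrightarrow> cs k \<omega> i < ct k \<omega> i"
  by (induction k) (use cell_start cell_step(3) in auto)

lemma cell_incseq: "\<omega> \<in> valid \<Longrightarrow> i < d \<Longrightarrow> incseq (\<lambda>k. cs k \<omega> i)"
  by (rule incseq_SucI) (rule cell_step(1)[OF _ cell_lt])

lemma cell_decseq: "\<omega> \<in> valid \<Longrightarrow> i < d \<Longrightarrow> decseq (\<lambda>k. ct k \<omega> i)"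
  by (rule decseq_SucI) (rule cell_step(2)[OF _ cell_lt])

lemma cell_grid: "\<omega> \<in> valid \<Longrightarrow> i < d \<Longrightarrow> cs k \<omega> i \<in> insert (\<alpha> i) (E i)"
proof (induction k)
  case 0
  then show ?case using peel_mem[of i "shell \<omega>"] by (simp add: cell_0)
next
  case (Suc k)
  then show ?case using cell_step(5)[OF _ cell_lt] by blast
qed

lemma cell_start_I: "i < d \<Longrightarrow> cs 0 \<omega> i \<in> I i \<and> ct 0 \<omega> i \<in> I i"
  using peel_subbox[of "shell \<omega>"] by (simp add: subbox_def cell_0)

definition tip :: "real \<Rightarrow> nat \<Rightarrow> real" where
  "tip \<omega> i = lim (\<lambda>k. cs k \<omega> i)"

lemma tip:
  assumes "\<omega> \<in> valid" "i < d"
  shows "(\<lambda>k. cs k \<omega> i) \<longlonglongrightarrow> tip \<omega> i" "cs k \<omega> i \<le> tip \<omega> i" "tip \<omega> i \<le> ct k \<omega> i"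
proof -
  obtain T where T: "(\<lambda>k. cs k \<omega> i) \<longlonglongrightarrow> T" "\<And>k. cs k \<omega> i \<le> T" "\<And>k. T \<le> ct k \<omega> i"
  proof (rule nested_intervals_limit[OF cell_incseq[OF assms] cell_decseq[OF assms] cell_lt[OF assms]])
    fix x y :: real assume xy: "cs 0 \<omega> i \<le> x" "x < y" "y \<le> ct 0 \<omega> i"
    obtain e where e: "e \<in> \<rat>" "x < e" "e < y" using Rats_dense_in_real[OF xy(2)] by blast
    then have "e \<in> I i" using between[OF assms(2)] cell_start_I[OF assms(2), of \<omega>] xy
      by (meson less_imp_le order_trans)
    then have "e \<in> E i" using E[OF assms(2)] e by blast
    then have "(i, e) \<in> range \<sigma>" unfolding \<sigma> using assms by simp
    then obtain k where k: "(i, e) = \<sigma> k" by (elim rangeE)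
    from cell_step(4)[OF assms(2) cell_lt[OF assms] k[symmetric]] e
    show "\<exists>e k. x < e \<and> e < y \<and> \<not> (cs k \<omega> i < e \<and> e < ct k \<omega> i)" by blast
  qed blast
  then have "tip \<omega> i = T" unfolding tip_def by (intro limI)
  then show "(\<lambda>k. cs k \<omega> i) \<longlonglongrightarrow> tip \<omega> i" "cs k \<omega> i \<le> tip \<omega> i" "tip \<omega> i \<le> ct k \<omega> i"
    using T by auto
qed

lemma tip_in_I: "\<omega> \<in> valid \<Longrightarrow> i < d \<Longrightarrow> tip \<omega> i \<in> I i"
  using between[of i "cs 0 \<omega> i" "ct 0 \<omega> i"] cell_start_I[of i \<omega>] tip(2,3)[of \<omega> i 0] by blast

definition side_of :: "real \<Rightarrow> nat \<Rightarrow> side" where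
  "side_of \<omega> = restrict (\<lambda>i. if \<exists>k. cs k \<omega> i = tip \<omega> i then SideL else SideR) {..<d}"

lemma side_of_mem: "side_of \<omega> \<in> sides d"
  by (auto simp: side_of_def sides_def)

definition tip_point :: "real \<Rightarrow> nat \<Rightarrow> real" where
  "tip_point \<omega> = restrict (tip \<omega>) {..<d}"

lemma tip_point_mem: "\<omega> \<in> valid \<Longrightarrow> tip_point \<omega> \<in> PiE {..<d} I"
  using tip_in_I by (auto simp: tip_point_def)

text \<open>\<open>nested_intervals_side\<close> in each coordinate, once all faces have been used
  as cuts. The right-hand side does not mention the stage k: membership can be read off the limit
  point and its side.\<close>

lemma inside_iff_tip:
  assumes \<omega>: "\<omega> \<in> valid"
    and k: "\<And>i. i < d \<Longrightarrow> (i, a i) \<in> \<sigma> ` {..<k} \<and> (i, b i) \<in> \<sigma> ` {..<k}"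
  shows "inside a b (cell k \<omega>) \<longleftrightarrow> tip_point \<omega> \<in> half_open_box d I (side_of \<omega>) a b"
proof -
  have "a i \<le> cs k \<omega> i \<and> ct k \<omega> i \<le> b i \<longleftrightarrow>
    (if side_of \<omega> i = SideL then a i \<le> tip_point \<omega> i \<and> tip_point \<omega> i < b i
     else a i < tip_point \<omega> i \<and> tip_point \<omega> i \<le> b i)" if i: "i < d" for i
  proof -
    have un: "\<not> (cs k \<omega> i < e \<and> e < ct k \<omega> i)" if "(i, e) \<in> \<sigma> ` {..<k}" for e
    proof -
      obtain l where l: "(i, e) = \<sigma> l" "l < k" using \<open>(i, e) \<in> \<sigma> ` {..<k}\<close> by auto
      have "\<not> (cs (Suc l) \<omega> i < e \<and> e < ct (Suc l) \<omega> i)"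
        by (rule cell_step(4)[OF i cell_lt[OF \<omega> i] l(1)[symmetric]])
      moreover have "cs (Suc l) \<omega> i \<le> cs k \<omega> i" "ct k \<omega> i \<le> ct (Suc l) \<omega> i"
        using incseqD[OF cell_incseq[OF \<omega> i], of "Suc l" k] decseqD[OF cell_decseq[OF \<omega> i], of "Suc l" k] l(2)
        by auto
      ultimately show ?thesis by linarith
    qed
    note side = nested_intervals_side[OF cell_incseq[OF \<omega> i] cell_decseq[OF \<omega> i] cell_lt[OF \<omega> i] tip(2,3)[OF \<omega> i] un]
    show ?thesis
      using side(1)[of "a i"] side(2)[of "b i"] k[OF i] i by (simp add: side_of_def tip_point_def)
  qed
  moreover have "inside a b (cell k \<omega>) \<longleftrightarrow> (\<forall>i<d. a i \<le> cs k \<omega> i \<and> ct k \<omega> i \<le> b i)"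
    by (simp add: inside_def case_prod_beta)
  ultimately show ?thesis
    using tip_point_mem[OF \<omega>] by (auto simp: half_open_box_def)
qed

lemma valid_measurable: "valid \<in> sets lborel"
  using valid_sets[of "\<lambda>_. True" 0] by simp

definition M\<^sub>0 :: "real measure" where
  "M\<^sub>0 = restrict_space lborel valid"

lemma space_M0: "space M\<^sub>0 = valid"
  by (simp add: M\<^sub>0_def space_restrict_space)

lemma sets_M0: "X \<in> sets M\<^sub>0 \<longleftrightarrow> X \<subseteq> valid \<and> X \<in> sets lborel"
  unfolding M\<^sub>0_def using valid_measurable by (subst sets_restrict_space_iff) auto

text \<open>At a fixed stage the cell depends on \<omega> in a piecewise constant way, so even
  preimages of arbitrary sets are measurable.\<close>

lemma measurable_cs: "(\<lambda>\<omega>. cs k \<omega> i) \<in> borel_measurable M\<^sub>0"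
proof (rule borel_measurableI)
  fix S :: "real set"
  have "(\<lambda>\<omega>. cs k \<omega> i) -` S \<inter> space M\<^sub>0 = {\<omega> \<in> valid. fst (cell k \<omega>) i \<in> S}" by (auto simp: space_M0)
  then show "(\<lambda>\<omega>. cs k \<omega> i) -` S \<inter> space M\<^sub>0 \<in> sets M\<^sub>0"
    using valid_sets[of "\<lambda>z. fst z i \<in> S" k] by (auto simp: sets_M0)
qed

lemma measurable_tip: "i < d \<Longrightarrow> (\<lambda>\<omega>. tip \<omega> i) \<in> borel_measurable M\<^sub>0"
  by (rule borel_measurable_LIMSEQ_real[OF _ measurable_cs]) (rule tip(1), auto simp: space_M0)

lemma side_sets:
  assumes "b \<in> sides d"
  shows "{\<omega> \<in> valid. side_of \<omega> = b} \<in> sets lborel"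
proof -
  have ex: "{\<omega> \<in> space M\<^sub>0. \<exists>k. cs k \<omega> i = tip \<omega> i} \<in> sets M\<^sub>0" if "i < d" for i
  proof -
    have [measurable]: "(\<lambda>\<omega>. tip \<omega> i) \<in> borel_measurable M\<^sub>0" "\<And>k. (\<lambda>\<omega>. cs k \<omega> i) \<in> borel_measurable M\<^sub>0"
      using measurable_tip[OF that] measurable_cs by auto
    show ?thesis by measurable
  qed
  have "{\<omega> \<in> space M\<^sub>0. \<forall>i\<in>{..<d}. b i = SideL \<longleftrightarrow> (\<exists>k. cs k \<omega> i = tip \<omega> i)} \<in> sets M\<^sub>0"
  proof (intro sets.sets_Collect_finite_All finite_lessThan)
    fix i assume "i \<in> {..<d}"
    then have "{\<omega> \<in> space M\<^sub>0. \<exists>k. cs k \<omega> i = tip \<omega> i} \<in> sets M\<^sub>0" using ex by simp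
    then show "{\<omega> \<in> space M\<^sub>0. b i = SideL \<longleftrightarrow> (\<exists>k. cs k \<omega> i = tip \<omega> i)} \<in> sets M\<^sub>0"
      by (cases "b i = SideL") (simp_all add: sets.sets_Collect_neg del: not_ex)
  qed
  moreover have "side_of \<omega> = b \<longleftrightarrow> (\<forall>i\<in>{..<d}. b i = SideL \<longleftrightarrow> (\<exists>k. cs k \<omega> i = tip \<omega> i))" for \<omega>
  proof -
    have "side_of \<omega> = b \<longleftrightarrow> (\<forall>i\<in>{..<d}. side_of \<omega> i = b i)"
      using side_of_mem[of \<omega>] assms unfolding sides_def by (auto intro: PiE_ext)
    also have "\<dots> \<longleftrightarrow> (\<forall>i\<in>{..<d}. b i = SideL \<longleftrightarrow> (\<exists>k. cs k \<omega> i = tip \<omega> i))"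
    proof (rule ball_cong[OF refl])
      fix i assume i: "i \<in> {..<d}"
      have "b i = SideL \<or> b i = SideR" by (cases "b i") auto
      then show "side_of \<omega> i = b i \<longleftrightarrow> (b i = SideL \<longleftrightarrow> (\<exists>k. cs k \<omega> i = tip \<omega> i))"
        using i by (auto simp: side_of_def)
    qed
    finally show ?thesis .
  qed
  ultimately show ?thesis by (simp add: space_M0 sets_M0)
qed

definition meas :: "(nat \<Rightarrow> side) \<Rightarrow> (nat \<Rightarrow> real) measure" where
  "meas b = distr (restrict_space lborel {\<omega> \<in> valid. side_of \<omega> = b}) (box_borel d I) tip_point"

lemma measurable_tip_point:
  assumes "b \<in> sides d"
  shows "tip_point \<in> measurable (restrict_space lborel {\<omega> \<in> valid. side_of \<omega> = b}) (box_borel d I)"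
proof (rule measurable_box_borel)
  show "tip_point \<in> space (restrict_space lborel {\<omega> \<in> valid. side_of \<omega> = b}) \<rightarrow> PiE {..<d} I"
    using tip_point_mem by (auto simp: space_restrict_space)
  fix i assume i: "i < d"
  have "(\<lambda>\<omega>. tip \<omega> i) \<in> borel_measurable (restrict_space M\<^sub>0 {\<omega> \<in> valid. side_of \<omega> = b})"
    by (rule measurable_restrict_space1[OF measurable_tip[OF i]])
  also have "restrict_space M\<^sub>0 {\<omega> \<in> valid. side_of \<omega> = b} = restrict_space lborel {\<omega> \<in> valid. side_of \<omega> = b}"
    unfolding M\<^sub>0_def using side_sets[OF assms] valid_measurable
    by (subst restrict_restrict_space) (auto intro: arg_cong[where f = "restrict_space lborel"])
  finally show "(\<lambda>\<omega>. tip_point \<omega> i) \<in> borel_measurable (restrict_space lborel {\<omega> \<in> valid. side_of \<omega> = b})"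
    using i by (simp add: tip_point_def)
qed (use I in auto)

lemma emeasure_meas:
  assumes b: "b \<in> sides d" and X: "X \<in> sets (box_borel d I)"
  shows "emeasure (meas b) X = emeasure lborel {\<omega> \<in> valid. side_of \<omega> = b \<and> tip_point \<omega> \<in> X}"
    and "{\<omega> \<in> valid. side_of \<omega> = b \<and> tip_point \<omega> \<in> X} \<in> sets lborel"
proof -
  let ?W = "{\<omega> \<in> valid. side_of \<omega> = b}"
  have W: "?W \<in> sets lborel" by (rule side_sets[OF b])
  have eq: "tip_point -` X \<inter> space (restrict_space lborel ?W) = {\<omega> \<in> valid. side_of \<omega> = b \<and> tip_point \<omega> \<in> X}"
    by (auto simp: space_restrict_space)
  have "tip_point -` X \<inter> space (restrict_space lborel ?W) \<in> sets (restrict_space lborel ?W)"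
    by (rule measurable_sets[OF measurable_tip_point[OF b] X])
  then show s: "{\<omega> \<in> valid. side_of \<omega> = b \<and> tip_point \<omega> \<in> X} \<in> sets lborel"
    unfolding eq using W by (subst (asm) sets_restrict_space_iff) auto
  have "emeasure (meas b) X = emeasure (restrict_space lborel ?W) {\<omega> \<in> valid. side_of \<omega> = b \<and> tip_point \<omega> \<in> X}"
    unfolding meas_def by (subst emeasure_distr[OF measurable_tip_point[OF b] X]) (simp only: eq)
  also have "\<dots> = emeasure lborel {\<omega> \<in> valid. side_of \<omega> = b \<and> tip_point \<omega> \<in> X}"
    using W by (intro emeasure_restrict_space) auto
  finally show "emeasure (meas b) X = emeasure lborel {\<omega> \<in> valid. side_of \<omega> = b \<and> tip_point \<omega> \<in> X}" .
qed

text \<open>Each valid \<omega> has exactly one side, so the sum over the sides counts every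
  \<omega> whose cell lies in the box exactly once.\<close>

lemma sum_emeasure_meas:
  assumes ab: "subbox a a'" and E': "\<And>i. i < d \<Longrightarrow> a i \<in> E i \<and> a' i \<in> E i"
  shows "(\<Sum>b\<in>sides d. emeasure (meas b) (half_open_box d I b a a')) = ennreal (c a a')"
proof -
  have "\<exists>k. \<forall>i<d. (i, a i) \<in> \<sigma> ` {..<k} \<and> (i, a' i) \<in> \<sigma> ` {..<k}"
  proof -
    have "\<exists>l. (i, e) = \<sigma> l" if "i < d" "e \<in> E i" for i e
    proof -
      have "(i, e) \<in> range \<sigma>" unfolding \<sigma> using that by simp
      then show ?thesis by (elim rangeE) blast
    qed
    then have "\<forall>i. \<exists>l. i < d \<longrightarrow> (i, a i) = \<sigma> l" "\<forall>i. \<exists>l. i < d \<longrightarrow> (i, a' i) = \<sigma> l"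
      using E' by auto
    from choice[OF this(1)] choice[OF this(2)]
    obtain l l' where l: "\<And>i. i < d \<Longrightarrow> (i, a i) = \<sigma> (l i)" "\<And>i. i < d \<Longrightarrow> (i, a' i) = \<sigma> (l' i)"
      by blast
    \<comment> \<open>A stage by which all faces have been used as cuts: the sum of their indices
      bounds each index, and Suc makes the bound strict.\<close>
    define k where "k = Suc (\<Sum>i<d. l i + l' i)"
    have "l i < k \<and> l' i < k" if "i < d" for i
    proof -
      have "l i + l' i \<le> (\<Sum>i<d. l i + l' i)" using that by (intro member_le_sum) auto
      then show ?thesis by (simp add: k_def)
    qed
    then show ?thesis using l by (intro exI[of _ k]) auto
  qed
  then obtain k where k: "\<And>i. i < d \<Longrightarrow> (i, a i) \<in> \<sigma> ` {..<k} \<and> (i, a' i) \<in> \<sigma> ` {..<k}" by blast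
  let ?F = "\<lambda>b. {\<omega> \<in> valid. side_of \<omega> = b \<and> tip_point \<omega> \<in> half_open_box d I b a a'}"
  have "(\<Sum>b\<in>sides d. emeasure (meas b) (half_open_box d I b a a')) = (\<Sum>b\<in>sides d. emeasure lborel (?F b))"
    using emeasure_meas(1) half_open_box_sets by (intro sum.cong) auto
  also have "\<dots> = emeasure lborel (\<Union>b\<in>sides d. ?F b)"
  proof (rule sum_emeasure)
    show "?F ` sides d \<subseteq> sets lborel" using emeasure_meas(2)[OF _ half_open_box_sets] by auto
    show "disjoint_family_on ?F (sides d)" by (auto simp: disjoint_family_on_def)
  qed (rule finite_sides)
  also have "(\<Union>b\<in>sides d. ?F b) = {\<omega> \<in> valid. inside a a' (cell k \<omega>)}"
  proof (intro set_eqI iffI)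
    fix \<omega> assume "\<omega> \<in> (\<Union>b\<in>sides d. ?F b)"
    then show "\<omega> \<in> {\<omega> \<in> valid. inside a a' (cell k \<omega>)}" using inside_iff_tip[OF _ k] by auto
  next
    fix \<omega> assume "\<omega> \<in> {\<omega> \<in> valid. inside a a' (cell k \<omega>)}"
    then show "\<omega> \<in> (\<Union>b\<in>sides d. ?F b)" using inside_iff_tip[OF _ k] side_of_mem by auto
  qed
  also have "emeasure lborel \<dots> = ennreal (c a a')" by (rule valid_emeasure[OF ab E' k])
  finally show ?thesis .
qed

end

section \<open>Local finiteness, discreteness and agreement with the content\<close>

context box_split
begin

lemma emeasure_meas_finite:
  assumes "b \<in> sides d" "subbox a a'" "\<And>i. i < d \<Longrightarrow> a i \<in> E i \<and> a' i \<in> E i"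
  shows "emeasure (meas b) (half_open_box d I b a a') < \<infinity>"
proof -
  have "emeasure (meas b) (half_open_box d I b a a') \<le> (\<Sum>b\<in>sides d. emeasure (meas b) (half_open_box d I b a a'))"
    by (rule member_le_sum[OF assms(1)]) (auto intro: finite_sides)
  also have "\<dots> = ennreal (c a a')" by (rule sum_emeasure_meas[OF assms(2,3)])
  finally show ?thesis using ennreal_less_top le_less_trans unfolding infinity_ennreal_def by blast
qed

text \<open>The projections of K are compact and can be bracketed strictly by rationals; strictness
  lets one box serve for every choice of sides.\<close>

lemma compact_in_half_open_box:
  assumes K: "compactin (box_topology d I) K" "K \<noteq> {}"
  obtains a a' where "subbox a a'" "\<And>i. i < d \<Longrightarrow> a i \<in> E i \<and> a' i \<in> E i"
    "\<And>b. K \<subseteq> half_open_box d I b a a'"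
proof -
  have KI: "K \<subseteq> PiE {..<d} I" using compactin_subset_topspace[OF K(1)] by (simp add: topspace_box_topology)
  have "\<exists>p q. p \<in> E i \<and> q \<in> E i \<and> (\<forall>u\<in>K. p < u i \<and> u i < q)" if i: "i < d" for i
  proof -
    have "compactin euclidean ((\<lambda>u. u i) ` K)" by (rule image_compactin[OF K(1) continuous_map_box_coordinate[OF i]])
    then have cpt: "compact ((\<lambda>u. u i) ` K)" by simp
    have ne: "(\<lambda>u. u i) ` K \<noteq> {}" using K(2) by simp
    have sub: "(\<lambda>u. u i) ` K \<subseteq> I i" using KI i by auto
    obtain m where m: "m \<in> (\<lambda>u. u i) ` K" "\<forall>y\<in>(\<lambda>u. u i) ` K. m \<le> y" using compact_attains_inf[OF cpt ne] by blast
    obtain m' where m': "m' \<in> (\<lambda>u. u i) ` K" "\<forall>y\<in>(\<lambda>u. u i) ` K. y \<le> m'" using compact_attains_sup[OF cpt ne] by blast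
    have mI: "m \<in> I i" "m' \<in> I i" using m(1) m'(1) sub by blast+
    have op: "open (I i)" using I[OF i] by simp
    obtain p p2 where p: "p \<in> \<rat>" "p < m" "m < p2" "{p..p2} \<subseteq> I i"
      using rational_bracket[OF op mI(1)] by metis
    obtain q2 q where q: "q \<in> \<rat>" "q2 < m'" "m' < q" "{q2..q} \<subseteq> I i"
      using rational_bracket[OF op mI(2)] by metis
    have "p \<in> {p..p2}" "q \<in> {q2..q}" using p q by auto
    then have "p \<in> E i" "q \<in> E i" using p q E[OF i] by blast+
    moreover have "p < u i \<and> u i < q" if "u \<in> K" for u
    proof -
      have "m \<le> u i" "u i \<le> m'" using m(2) m'(2) that by auto
      then show ?thesis using p q by linarith
    qed
    ultimately show ?thesis by blast
  qed
  then obtain a a' where aa: "\<And>i. i < d \<Longrightarrow> a i \<in> E i \<and> a' i \<in> E i \<and> (\<forall>u\<in>K. a i < u i \<and> u i < a' i)" by metis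
  obtain u where u: "u \<in> K" using K(2) by blast
  show thesis
  proof (rule that[of a a'])
    show "subbox a a'" unfolding subbox_def
    proof (intro allI impI)
      fix i assume i: "i < d"
      have "a i < u i" "u i < a' i" using aa[OF i] u by blast+
      then show "a i \<in> I i \<and> a' i \<in> I i \<and> a i \<le> a' i" using aa[OF i] E[OF i] by auto
    qed
    show "a i \<in> E i \<and> a' i \<in> E i" if "i < d" for i using aa[OF that] by blast
    show "K \<subseteq> half_open_box d I b a a'" for b
    proof
      fix v assume v: "v \<in> K"
      then have "v \<in> PiE {..<d} I" using KI by blast
      moreover have "a i < v i \<and> v i < a' i" if "i < d" for i using aa[OF that] v by blast
      ultimately show "v \<in> half_open_box d I b a a'" by (auto simp: half_open_box_def less_imp_le)
    qed
  qed
qed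

lemma meas_admissible: "admissible d I meas"
  unfolding admissible_def
proof (intro ballI conjI allI impI)
  fix b assume b: "b \<in> sides d"
  have sp: "space (meas b) = PiE {..<d} I" and st: "sets (meas b) = sets (box_borel d I)"
    by (simp_all add: meas_def)
  show "loc_finite_on d I (meas b)"
    unfolding loc_finite_on_def
  proof (intro conjI sp st allI impI)
    fix K assume K: "compactin (box_topology d I) K"
    show "emeasure (meas b) K < \<infinity>"
    proof (cases "K = {}")
      case False
      then obtain a a' where a: "subbox a a'" "\<And>i. i < d \<Longrightarrow> a i \<in> E i \<and> a' i \<in> E i"
        "\<And>b. K \<subseteq> half_open_box d I b a a'"
        using compact_in_half_open_box[OF K] by metis
      have "emeasure (meas b) K \<le> emeasure (meas b) (half_open_box d I b a a')"
        by (rule emeasure_mono[OF a(3)]) (simp add: st half_open_box_sets)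
      then show ?thesis using emeasure_meas_finite[OF b a(1,2)] by (rule le_less_trans)
    qed simp
  qed
  fix i assume i: "i < d" and bi: "b i = SideL"
  \<comment> \<open>The envelopes start from \<alpha>, which need not lie on the grid, so cells may
    have \<alpha> i as an end point.\<close>
  define D where "D = insert (\<alpha> i) (E i)"
  have D: "countable D" using E[OF i] by (simp add: D_def)
  then have "D \<in> sets borel" by (rule sets.countable[rotated]) auto
  then have UD: "UNIV - D \<in> sets borel" by auto
  have meas: "(\<lambda>u. u i) \<in> borel_measurable (meas b)"
    using measurable_box_coordinate[OF i, of I] by (simp add: measurable_cong_sets[OF st refl])
  let ?X = "(\<lambda>u. u i) -` (UNIV - D) \<inter> space (meas b)"
  have X: "?X \<in> sets (box_borel d I)" using measurable_sets[OF meas UD] st by simp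
  have none: "{\<omega> \<in> valid. side_of \<omega> = b \<and> tip_point \<omega> \<in> ?X} = {}"
  proof -
    have False if \<omega>: "\<omega> \<in> valid" "side_of \<omega> = b" "tip_point \<omega> \<in> ?X" for \<omega>
    proof -
      have "side_of \<omega> i = SideL" using \<omega>(2) bi by simp
      then obtain k where "cs k \<omega> i = tip \<omega> i" using i by (auto simp: side_of_def split: if_splits)
      then have "tip_point \<omega> i \<in> D" using cell_grid[OF \<omega>(1) i, of k] i by (simp add: D_def tip_point_def)
      then show False using \<omega>(3) by simp
    qed
    then show ?thesis by blast
  qed
  have "emeasure (meas b) ?X = 0" unfolding emeasure_meas(1)[OF b X] none by (rule emeasure_empty)
  then have "emeasure (distr (meas b) borel (\<lambda>u. u i)) (UNIV - D) = 0"
    by (simp add: emeasure_distr[OF meas UD])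
  then show "discrete_measure (marginal i (meas b))"
    unfolding discrete_measure_def marginal_def using D by auto
qed

definition total :: "(nat \<Rightarrow> real) \<Rightarrow> (nat \<Rightarrow> real) \<Rightarrow> real" where
  "total s t = (\<Sum>b\<in>sides d. measure (meas b) (half_open_box d I b s t))"

lemma total_grid:
  assumes "subbox a a'" "\<And>i. i < d \<Longrightarrow> a i \<in> E i \<and> a' i \<in> E i"
  shows "total a a' = c a a'"
proof -
  have "ennreal (total a a') = (\<Sum>b\<in>sides d. ennreal (measure (meas b) (half_open_box d I b a a')))"
    unfolding total_def by (rule sum_ennreal[symmetric]) simp
  also have "\<dots> = (\<Sum>b\<in>sides d. emeasure (meas b) (half_open_box d I b a a'))"
    using emeasure_meas_finite[OF _ assms]
    by (intro sum.cong refl emeasure_eq_ennreal_measure[symmetric]) (auto simp: less_top)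
  also have "\<dots> = ennreal (c a a')" by (rule sum_emeasure_meas[OF assms])
  finally show ?thesis
    using subbox_nonneg[OF assms(1)] by (subst (asm) ennreal_inj) (auto simp: total_def intro: sum_nonneg)
qed

lemma total_mono:
  assumes pq: "\<And>i. i < d \<Longrightarrow> p i \<in> I i \<and> q i \<in> I i \<and> p i \<le> s i \<and> t i \<le> q i"
  shows "total s t \<le> total p q"
  unfolding total_def
proof (rule sum_mono)
  fix b assume b: "b \<in> sides d"
  have M: "loc_finite_on d I (meas b)" using meas_admissible b by (simp add: admissible_def)
  have st: "sets (meas b) = sets (box_borel d I)" by (simp add: meas_def)
  have sub: "{p i..q i} \<subseteq> I i" if "i < d" for i
    using interval_segment I[OF that] pq[OF that] by blast
  note box = box_measure_finite[OF M sub]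
  have "half_open_box d I b p q \<subseteq> PiE {..<d} (\<lambda>i. {p i..q i})"
  proof
    fix u assume u: "u \<in> half_open_box d I b p q"
    have "u i \<in> {p i..q i}" if "i < d" for i
    proof -
      have "if b i = SideL then p i \<le> u i \<and> u i < q i else p i < u i \<and> u i \<le> q i"
        using u that by (simp add: half_open_box_def)
      then show ?thesis by (auto split: if_splits)
    qed
    then show "u \<in> PiE {..<d} (\<lambda>i. {p i..q i})" using u by (auto simp: half_open_box_def PiE_def)
  qed
  then have "half_open_box d I b p q \<in> fmeasurable (meas b)"
    using box half_open_box_sets[of d I b p q] st by (intro fmeasurableI2[OF fmeasurableI[OF box]]) auto
  moreover have "half_open_box d I b s t \<subseteq> half_open_box d I b p q"
    unfolding half_open_box_def
  proof (intro Collect_mono impI conjI ballI, elim conjE, assumption, elim conjE)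
    fix u i assume i: "i \<in> {..<d}" and u: "\<forall>i\<in>{..<d}. if b i = SideL then s i \<le> u i \<and> u i < t i else s i < u i \<and> u i \<le> t i"
    have "p i \<le> s i" "t i \<le> q i" using pq i by auto
    then show "if b i = SideL then p i \<le> u i \<and> u i < q i else p i < u i \<and> u i \<le> q i"
      using bspec[OF u i] by (auto split: if_splits)
  qed
  ultimately show "measure (meas b) (half_open_box d I b s t) \<le> measure (meas b) (half_open_box d I b p q)"
    using half_open_box_sets[of d I b s t] st by (intro measure_mono_fmeasurable) auto
qed

text \<open>Off the grid both sides are monotone set functions, so agreement follows by squeezing, one
  coordinate at a time: \<open>m\<close> counts the coordinates that are already unrestricted.\<close>

lemma content_eq_total:
  assumes cont: "\<And>i v p q \<delta> \<eta>. i < d \<Longrightarrow> v \<in> I i - E i \<Longrightarrow> subbox p q \<Longrightarrow> 0 < \<delta> \<Longrightarrow> 0 < \<eta> \<Longrightarrow>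
      \<exists>e e'. e \<in> E i \<and> e' \<in> E i \<and> v - \<eta> < e \<and> e < v \<and> v < e' \<and> e' < v + \<eta> \<and> c (p(i := e)) (q(i := e')) < \<delta>"
    and st: "\<And>i. i < d \<Longrightarrow> s i \<in> I i \<and> t i \<in> I i \<and> s i < t i"
  shows "c s t = total s t"
proof -
  have "c s t = total s t"
    if "m \<le> d" "\<And>i. i < d \<Longrightarrow> s i \<in> I i \<and> t i \<in> I i \<and> s i < t i"
      "\<And>i. m \<le> i \<Longrightarrow> i < d \<Longrightarrow> s i \<in> E i \<and> t i \<in> E i" for m s t
    using that
  proof (induction m arbitrary: s t)
    case 0
    have "total s t = c s t"
      by (rule total_grid) (use 0 in \<open>auto simp: subbox_def less_imp_le\<close>)
    then show ?case by simp
  next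
    case (Suc m)
    have m: "m < d" using Suc.prems by simp
    have sb: "subbox s t" using Suc.prems(2) by (simp add: subbox_def less_imp_le)
    have le: "\<bar>c s t - total s t\<bar> \<le> 2 * \<delta>" if \<delta>: "\<delta> > 0" for \<delta>
    proof -
      \<comment> \<open>A third of the side length keeps the brackets around s m and t m
        apart.\<close>
      define \<eta> where "\<eta> = (t m - s m) / 3"
      have \<eta>: "\<eta> > 0" using Suc.prems(2)[OF m] by (simp add: \<eta>_def)
      \<comment> \<open>On the grid v brackets itself with a degenerate slab; off the grid
        \<open>cont\<close> provides a slab of small content.\<close>
      have br: "\<exists>e e'. e \<in> E m \<and> e' \<in> E m \<and> v - \<eta> < e \<and> e \<le> v \<and> v \<le> e' \<and> e' < v + \<eta> \<and> c (s(m := e)) (t(m := e')) \<le> \<delta>"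
        if v: "v \<in> I m" for v
      proof (cases "v \<in> E m")
        case True
        have "c (s(m := v)) (t(m := v)) = 0" by (rule c_degenerate[OF m]) simp
        then show ?thesis using True \<eta> \<delta> by (intro exI[of _ v]) auto
      next
        case False
        then show ?thesis using cont[OF m _ sb \<delta> \<eta>, of v] v by (meson DiffI less_imp_le)
      qed
      have sm: "s m \<in> I m" "t m \<in> I m" using Suc.prems(2)[OF m] by auto
      obtain e e' where e: "e \<in> E m" "e' \<in> E m" "e \<le> s m" "s m \<le> e'" "e' < s m + \<eta>"
        "c (s(m := e)) (t(m := e')) \<le> \<delta>"
        using br[OF sm(1)] by blast
      obtain g g' where g: "g \<in> E m" "g' \<in> E m" "t m - \<eta> < g" "g \<le> t m" "t m \<le> g'"
        "c (s(m := g)) (t(m := g')) \<le> \<delta>"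
        using br[OF sm(2)] by blast
      have eg: "e' < g" using e g \<eta> by (simp add: \<eta>_def field_simps)
      have GI: "e \<in> I m" "e' \<in> I m" "g \<in> I m" "g' \<in> I m" using e g E[OF m] by auto
      have grid_eq: "c (s(m := x)) (t(m := y)) = total (s(m := x)) (t(m := y))"
        if xy: "x \<in> E m" "y \<in> E m" "x < y" for x y
      proof (rule Suc.IH)
        show "m \<le> d" using m by simp
        fix i assume i: "i < d"
        show "(s(m := x)) i \<in> I i \<and> (t(m := y)) i \<in> I i \<and> (s(m := x)) i < (t(m := y)) i"
          using Suc.prems(2)[OF i] xy E[OF m] by (cases "i = m") auto
        assume "m \<le> i"
        then show "(s(m := x)) i \<in> E i \<and> (t(m := y)) i \<in> E i"
          using Suc.prems(3)[of i] i xy by (cases "i = m") auto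
      qed
      have in1: "c (s(m := e')) (t(m := g)) = total (s(m := e')) (t(m := g))"
        by (rule grid_eq[OF e(2) g(1) eg])
      have out1: "c (s(m := e)) (t(m := g')) = total (s(m := e)) (t(m := g'))"
        by (rule grid_eq[OF e(1) g(2)]) (use e g eg in linarith)
      \<comment> \<open>The outer box consists of the inner one and two slabs, each of content at
        most \<delta>.\<close>
      have "c (s(m := e)) (t(m := g')) = c (s(m := e)) (t(m := e')) + c (s(m := e')) (t(m := g'))"
        using c_add[OF m, of "s(m := e)" "t(m := g')" e'] by simp
      also have "c (s(m := e')) (t(m := g')) = c (s(m := e')) (t(m := g)) + c (s(m := g)) (t(m := g'))"
        using c_add[OF m, of "s(m := e')" "t(m := g')" g] by simp
      finally have diff: "c (s(m := e)) (t(m := g')) \<le> c (s(m := e')) (t(m := g)) + 2 * \<delta>"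
        using e g by linarith
      have sI: "s i \<in> I i \<and> t i \<in> I i \<and> s i \<le> t i" if "i < d" for i using sb that by (simp add: subbox_def)
      have inner: "s i \<in> I i \<and> t i \<in> I i \<and> s i \<le> (s(m := e')) i \<and> (t(m := g)) i \<le> t i" if i: "i < d" for i
        using sI[OF i] e(4) g(4) by (cases "i = m") auto
      have outer: "(s(m := e)) i \<in> I i \<and> (t(m := g')) i \<in> I i \<and> (s(m := e)) i \<le> s i \<and> t i \<le> (t(m := g')) i"
        if i: "i < d" for i
        using sI[OF i] e(3) g(5) GI(1,4) by (cases "i = m") auto
      have "subbox (s(m := e')) (t(m := g))"
        unfolding subbox_def
      proof (intro allI impI)
        fix i assume i: "i < d"
        show "(s(m := e')) i \<in> I i \<and> (t(m := g)) i \<in> I i \<and> (s(m := e')) i \<le> (t(m := g)) i"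
          using sI[OF i] GI(2,3) eg by (cases "i = m") auto
      qed
      then have "c (s(m := e')) (t(m := g)) \<le> c s t" by (rule c_mono) (rule inner)
      moreover have "c s t \<le> c (s(m := e)) (t(m := g'))" by (rule c_mono[OF sb]) (rule outer)
      moreover have "total (s(m := e')) (t(m := g)) \<le> total s t" by (rule total_mono) (rule inner)
      moreover have "total s t \<le> total (s(m := e)) (t(m := g'))" by (rule total_mono) (rule outer)
      ultimately show ?thesis using in1 out1 diff by linarith
    qed
    have "\<bar>c s t - total s t\<bar> \<le> 0"
    proof (rule field_le_epsilon)
      fix \<epsilon> :: real assume "\<epsilon> > 0"
      then show "\<bar>c s t - total s t\<bar> \<le> 0 + \<epsilon>" using le[of "\<epsilon> / 2"] by simp
    qed
    then show ?case by simp
  qed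
  from this[of d] show ?thesis using st by simp
qed

end

section \<open>The grid of discontinuities\<close>

context box_content
begin

text \<open>The content as a function of one upper face. Its increments are contents of slabs, so it
  is increasing, and continuity at v means that thin slabs around v have small content. The base
  \<alpha> i affects it by a constant only.\<close>

definition profile :: "nat \<Rightarrow> (nat \<Rightarrow> real) \<Rightarrow> (nat \<Rightarrow> real) \<Rightarrow> real \<Rightarrow> real" where
  "profile i p q v = c (p(i := \<alpha> i)) (q(i := v))"

lemma profile_diff: "i < d \<Longrightarrow> profile i p q w - profile i p q v = c (p(i := v)) (q(i := w))"
  unfolding profile_def using c_add[of i "p(i := \<alpha> i)" "q(i := w)" v] by simp

lemma profile_mono:
  assumes "i < d" "subbox p q"
  shows "mono_on (I i) (profile i p q)"
proof (rule mono_onI)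
  fix v w assume "v \<in> I i" "w \<in> I i" "v \<le> w"
  then have "0 \<le> c (p(i := v)) (q(i := w))"
    using assms by (intro subbox_nonneg) (auto simp: subbox_def)
  then show "profile i p q v \<le> profile i p q w" using profile_diff[OF assms(1), of p q w v] by linarith
qed

text \<open>Taking discontinuities for rational boxes alone keeps the grid countable. It is enough,
  because every subbox lies in a rational one and the content is monotone.\<close>

definition grid :: "nat \<Rightarrow> real set" where
  "grid i = (I i \<inter> \<rat>) \<union> (\<Union>(p, q)\<in>{(p, q) \<in> PiE {..<d} (\<lambda>_. \<rat>) \<times> PiE {..<d} (\<lambda>_. \<rat>). subbox p q}.
     {v \<in> I i. \<not> continuous (at v within I i) (profile i p q)})"

lemma grid_countable:
  assumes "i < d"
  shows "countable (grid i)"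
proof -
  have "countable (PiE {..<d} (\<lambda>_. \<rat> :: real set))" by (intro countable_PiE) (auto simp: countable_rat)
  then have "countable {(p, q) \<in> PiE {..<d} (\<lambda>_. \<rat>) \<times> PiE {..<d} (\<lambda>_. \<rat>). subbox p q}"
    by (intro countable_subset[OF _ countable_SIGMA[of "PiE {..<d} (\<lambda>_. \<rat>)" "\<lambda>_. PiE {..<d} (\<lambda>_. \<rat>)"]]) auto
  then show ?thesis unfolding grid_def
    using mono_on_ctble_discont[OF profile_mono[OF assms]]
    by (intro countable_Un countable_UN) (auto simp: countable_rat intro: countable_Int2)
qed

text \<open>Enlarge (p, q) to a rational box. Its profile is continuous at v, as v is off the grid,
  and the slab of the larger box controls that of the smaller one.\<close>

lemma small_slabs:
  assumes i: "i < d" and v: "v \<in> I i - grid i" and pq: "subbox p q" and \<delta>: "0 < \<delta>" and \<eta>: "0 < \<eta>"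
  shows "\<exists>e e'. e \<in> grid i \<and> e' \<in> grid i \<and> v - \<eta> < e \<and> e < v \<and> v < e' \<and> e' < v + \<eta> \<and> c (p(i := e)) (q(i := e')) < \<delta>"
proof -
  have "\<exists>x y. x \<in> \<rat> \<and> y \<in> \<rat> \<and> x \<in> I j \<and> y \<in> I j \<and> x \<le> p j \<and> q j \<le> y" if j: "j < d" for j
  proof -
    have op: "open (I j)" and pj: "p j \<in> I j" "q j \<in> I j" using I[OF j] pq j by (auto simp: subbox_def)
    obtain x x2 where x: "x \<in> \<rat>" "x < p j" "p j < x2" "{x..x2} \<subseteq> I j" using rational_bracket[OF op pj(1)] by metis
    obtain y2 y where y: "y \<in> \<rat>" "y2 < q j" "q j < y" "{y2..y} \<subseteq> I j" using rational_bracket[OF op pj(2)] by metis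
    have "x \<in> {x..x2}" "y \<in> {y2..y}" using x y by auto
    then have "x \<in> I j" "y \<in> I j" using x y by blast+
    then show ?thesis using x y by (intro exI[of _ x] exI[of _ y]) simp
  qed
  then obtain p0 q0 where pq0: "\<And>j. j < d \<Longrightarrow> p0 j \<in> \<rat> \<and> q0 j \<in> \<rat> \<and> p0 j \<in> I j \<and> q0 j \<in> I j \<and> p0 j \<le> p j \<and> q j \<le> q0 j"
    by metis
  define p' q' where "p' = restrict p0 {..<d}" and "q' = restrict q0 {..<d}"
  have pqr: "p' \<in> PiE {..<d} (\<lambda>_. \<rat>)" "q' \<in> PiE {..<d} (\<lambda>_. \<rat>)" using pq0 by (auto simp: p'_def q'_def)
  have pq': "p' j \<in> I j \<and> q' j \<in> I j \<and> p' j \<le> p j \<and> q j \<le> q' j" if "j < d" for j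
    using pq0[OF that] that by (simp add: p'_def q'_def)
  have sb': "subbox p' q'" unfolding subbox_def
  proof (intro allI impI)
    fix j assume j: "j < d"
    have "p j \<le> q j" using pq j by (simp add: subbox_def)
    then show "p' j \<in> I j \<and> q' j \<in> I j \<and> p' j \<le> q' j" using pq'[OF j] by linarith
  qed
  have "continuous (at v within I i) (profile i p' q')"
  proof (rule ccontr)
    assume "\<not> ?thesis"
    then have "v \<in> grid i" using v pqr sb' unfolding grid_def by blast
    then show False using v by blast
  qed
  then obtain r where r: "r > 0" "\<And>x. x \<in> I i \<Longrightarrow> dist x v < r \<Longrightarrow> dist (profile i p' q' x) (profile i p' q' v) < \<delta> / 2"
    using \<delta> unfolding continuous_within_eps_delta by (metis half_gt_zero)
  obtain z where z: "z > 0" "{v - z..v + z} \<subseteq> I i" using open_interval_cball I[OF i] v by (metis DiffD1)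
  define \<rho> where "\<rho> = min r (min z \<eta>)"
  have \<rho>: "\<rho> > 0" "\<rho> \<le> r" "\<rho> \<le> z" "\<rho> \<le> \<eta>" using r z \<eta> by (auto simp: \<rho>_def)
  obtain e where e: "e \<in> \<rat>" "v - \<rho> < e" "e < v" using Rats_dense_in_real[of "v - \<rho>" v] \<rho> by auto
  obtain e' where e': "e' \<in> \<rat>" "v < e'" "e' < v + \<rho>" using Rats_dense_in_real[of v "v + \<rho>"] \<rho> by auto
  have "e \<in> {v - z..v + z}" "e' \<in> {v - z..v + z}" using e e' \<rho> by auto
  then have eI: "e \<in> I i" "e' \<in> I i" using z by blast+
  then have eg: "e \<in> grid i" "e' \<in> grid i" using e e' by (auto simp: grid_def)
  have "c (p(i := e)) (q(i := e')) \<le> c (p'(i := e)) (q'(i := e'))"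
    by (rule c_mono) (use pq pq' eI e e' in \<open>auto simp: subbox_def\<close>)
  also have "\<dots> = profile i p' q' e' - profile i p' q' e" by (rule profile_diff[OF i, symmetric])
  also have "\<dots> < \<delta>"
  proof -
    have "dist e v < r" "dist e' v < r" using e e' \<rho> by (auto simp: dist_real_def)
    from r(2)[OF eI(1) this(1)] r(2)[OF eI(2) this(2)]
    show ?thesis unfolding dist_real_def by linarith
  qed
  finally have "c (p(i := e)) (q(i := e')) < \<delta>" .
  then show ?thesis using eg e e' \<rho> by (intro exI[of _ e] exI[of _ e']) auto
qed

lemma content_representation:
  "\<exists>\<mu>. admissible d I \<mu> \<and> (\<forall>s t. (\<forall>i<d. s i \<in> I i \<and> t i \<in> I i \<and> s i < t i) \<longrightarrow>
     c s t = (\<Sum>b\<in>sides d. measure (\<mu> b) (half_open_box d I b s t)))"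
proof -
  have ne: "Sigma {..<d} grid \<noteq> {}"
  proof -
    have "0 < d" using d by simp
    then have "open (I 0)" "\<alpha> 0 \<in> I 0" using I[of 0] PiE_mem[OF \<alpha>, of 0] by simp_all
    then obtain p q where p: "p \<in> \<rat>" "p < \<alpha> 0" "\<alpha> 0 < q" "{p..q} \<subseteq> I 0" by (rule rational_bracket)
    have "p \<in> {p..q}" using p by simp
    then have "p \<in> I 0 \<inter> \<rat>" using p by blast
    then have "p \<in> grid 0" by (simp add: grid_def)
    then show ?thesis using \<open>0 < d\<close> by blast
  qed
  have cn: "countable (Sigma {..<d} grid)" using grid_countable by (intro countable_SIGMA) auto
  interpret box_split d I \<alpha> c grid "from_nat_into (Sigma {..<d} grid)"
  proof
    show "range (from_nat_into (Sigma {..<d} grid)) = Sigma {..<d} grid" by (rule range_from_nat_into[OF ne cn])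
    show "countable (grid i) \<and> grid i \<subseteq> I i \<and> I i \<inter> \<rat> \<subseteq> grid i" if "i < d" for i
      using grid_countable[OF that] by (auto simp: grid_def)
  qed
  show ?thesis
  proof (intro exI[of _ meas] conjI meas_admissible allI impI)
    fix s t assume "\<forall>i<d. s i \<in> I i \<and> t i \<in> I i \<and> s i < t i"
    then show "c s t = (\<Sum>b\<in>sides d. measure (meas b) (half_open_box d I b s t))"
      using content_eq_total[OF small_slabs, of s t] by (simp add: total_def)
  qed
qed

end

section \<open>The representation theorem\<close>

text \<open>The alternating sum over the vertices of the box, without division by the side lengths,
  so that it is defined and additive for degenerate boxes too.\<close>

definition bdiff :: "nat set \<Rightarrow> (nat \<Rightarrow> real) \<Rightarrow> (nat \<Rightarrow> real) \<Rightarrow> ((nat \<Rightarrow> real) \<Rightarrow> real) \<Rightarrow> (nat \<Rightarrow> real) \<Rightarrow> real" where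
  "bdiff S s t = mop S (\<lambda>_. UNIV) (\<lambda>_ k. if k then 1 else -1) (\<lambda>i k. if k then t i else s i)"

lemma bdiff_insert:
  "finite S \<Longrightarrow> i \<notin> S \<Longrightarrow> bdiff (insert i S) s t f x = bdiff S s t f (x(i := t i)) - bdiff S s t f (x(i := s i))"
  unfolding bdiff_def by (subst mop_insert) (simp_all add: UNIV_bool)

lemma bdiff_cong:
  assumes "\<And>i. i \<in> S \<Longrightarrow> s i = s' i \<and> t i = t' i"
  shows "bdiff S s t f x = bdiff S s' t' f x"
proof -
  have "(\<lambda>j. if j \<in> S then if k j then t j else s j else x j) = (\<lambda>j. if j \<in> S then if k j then t' j else s' j else x j)" for k
    using assms by auto
  then show ?thesis unfolding bdiff_def mop_def by simp
qed

lemma bdiff_eq_mdd: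
  assumes "finite S" "\<And>i. i \<in> S \<Longrightarrow> s i \<noteq> t i"
  shows "bdiff S s t f x = (\<Prod>i\<in>S. t i - s i) * mdd S (\<lambda>i. {s i, t i}) f x"
  using assms
proof (induction S arbitrary: x rule: finite_induct)
  case empty
  show ?case by (simp add: bdiff_def)
next
  case (insert i S)
  have ne: "t i \<noteq> s i" using insert.prems[of i] by simp
  have IH: "bdiff S s t f y = (\<Prod>i\<in>S. t i - s i) * mdd S (\<lambda>i. {s i, t i}) f y" for y
    using insert.prems by (intro insert.IH) auto
  have "mdd (insert i S) (\<lambda>i. {s i, t i}) f x = dd {t i, s i} (\<lambda>v. mdd S (\<lambda>i. {s i, t i}) f (x(i := v)))"
    using mdd_insert[OF insert.hyps, of "\<lambda>i. {s i, t i}" f x] by (simp add: insert_commute)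
  also have "\<dots> = (mdd S (\<lambda>i. {s i, t i}) f (x(i := t i)) - mdd S (\<lambda>i. {s i, t i}) f (x(i := s i))) / (t i - s i)"
    by (rule dd_pair[OF ne])
  finally have m: "mdd (insert i S) (\<lambda>i. {s i, t i}) f x =
    (mdd S (\<lambda>i. {s i, t i}) f (x(i := t i)) - mdd S (\<lambda>i. {s i, t i}) f (x(i := s i))) / (t i - s i)" .
  show ?case
    unfolding bdiff_insert[OF insert.hyps] IH m prod.insert[OF insert.hyps] using ne
    by (simp add: right_diff_distrib[symmetric])
qed

lemma dd_kern_0:
  assumes "s < t"
  shows "dd {s, t} (\<lambda>x. kern b 0 a x u)
    = (if (if b = SideL then s \<le> u \<and> u < t else s < u \<and> u \<le> t) then 1 else 0) / (t - s)"
proof -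
  have "dd {s, t} (\<lambda>x. kern b 0 a x u) = (kern b 0 a t u - kern b 0 a s u) / (t - s)"
    using assms dd_pair[of t s "\<lambda>x. kern b 0 a x u"] by (simp add: insert_commute)
  also have "kern b 0 a t u - kern b 0 a s u = (if (if b = SideL then s \<le> u \<and> u < t else s < u \<and> u \<le> t) then 1 else 0)"
    using assms by (cases b) (auto simp: kern_def chi_eq)
  finally show ?thesis .
qed

text \<open>For order 1 the divided difference of the kernel in each coordinate is an indicator over
  the side length, so each integral is the measure of a half-open box divided by the volume.\<close>

lemma mdd_hrep_order_1:
  assumes I: "\<And>i. i < d \<Longrightarrow> open (I i) \<and> is_interval (I i)"
    and \<alpha>: "\<alpha> \<in> PiE {..<d} I" and adm: "admissible d I \<mu>" and n: "\<And>i. i < d \<Longrightarrow> n i = 1"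
    and st: "\<And>i. i < d \<Longrightarrow> s i \<in> I i \<and> t i \<in> I i \<and> s i < t i"
  shows "mdd {..<d} (\<lambda>i. {s i, t i}) (hrep d n \<alpha> \<mu>) pt
    = (\<Sum>b\<in>sides d. measure (\<mu> b) (half_open_box d I b s t)) / (\<Prod>i<d. t i - s i)"
proof -
  have A: "nodes d I n (\<lambda>i. {s i, t i})"
    unfolding nodes_def
  proof (intro allI impI)
    fix i assume "i < d"
    then show "{s i, t i} \<subseteq> I i \<and> card {s i, t i} = Suc (n i)" using st[of i] n[of i] by auto
  qed
  have "mdd {..<d} (\<lambda>i. {s i, t i}) (hrep d n \<alpha> \<mu>) pt =
      (\<Sum>b\<in>sides d. \<integral>u. (\<Prod>j<d. dd {s j, t j} (\<lambda>x. kern (b j) (n j - 1) (\<alpha> j) x (u j))) \<partial>\<mu> b)"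
    by (rule mdd_hrep[OF I \<alpha> adm A])
  also have "\<dots> = (\<Sum>b\<in>sides d. measure (\<mu> b) (half_open_box d I b s t) / (\<Prod>i<d. t i - s i))"
  proof (rule sum.cong[OF refl])
    fix b assume b: "b \<in> sides d"
    have M: "loc_finite_on d I (\<mu> b)" using adm b by (simp add: admissible_def)
    then have sp: "space (\<mu> b) = PiE {..<d} I" and sets: "sets (\<mu> b) = sets (box_borel d I)"
      by (simp_all add: loc_finite_on_def)
    have "(\<integral>u. (\<Prod>j<d. dd {s j, t j} (\<lambda>x. kern (b j) (n j - 1) (\<alpha> j) x (u j))) \<partial>\<mu> b)
      = (\<integral>u. indicator (half_open_box d I b s t) u / (\<Prod>i<d. t i - s i) \<partial>\<mu> b)"
    proof (rule Bochner_Integration.integral_cong[OF refl])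
      fix u assume u: "u \<in> space (\<mu> b)"
      let ?P = "\<lambda>j. if b j = SideL then s j \<le> u j \<and> u j < t j else s j < u j \<and> u j \<le> t j"
      have "(\<Prod>j<d. dd {s j, t j} (\<lambda>x. kern (b j) (n j - 1) (\<alpha> j) x (u j)))
          = (\<Prod>j<d. (if ?P j then 1 else 0) / (t j - s j))"
      proof (rule prod.cong[OF refl])
        fix j assume "j \<in> {..<d}"
        then have j: "n j - 1 = 0" "s j < t j" using n st by auto
        show "dd {s j, t j} (\<lambda>x. kern (b j) (n j - 1) (\<alpha> j) x (u j)) = (if ?P j then 1 else 0) / (t j - s j)"
          unfolding j(1) by (rule dd_kern_0[OF j(2)])
      qed
      also have "\<dots> = (\<Prod>j<d. if ?P j then 1 else 0) / (\<Prod>j<d. t j - s j)"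
        by (rule prod_dividef)
      also have "(\<Prod>j<d. if ?P j then 1 else 0 :: real) = (if \<forall>j\<in>{..<d}. ?P j then 1 else 0)"
        by (induction d) (auto simp: lessThan_Suc)
      also have "\<dots> = indicator (half_open_box d I b s t) u"
        using u sp by (simp add: half_open_box_def indicator_def)
      finally show "(\<Prod>j<d. dd {s j, t j} (\<lambda>x. kern (b j) (n j - 1) (\<alpha> j) x (u j)))
        = indicator (half_open_box d I b s t) u / (\<Prod>i<d. t i - s i)" .
    qed
    also have "\<dots> = measure (\<mu> b) (half_open_box d I b s t) / (\<Prod>i<d. t i - s i)"
    proof -
      have "half_open_box d I b s t \<subseteq> space (\<mu> b)" by (auto simp: sp half_open_box_def)
      then show ?thesis by (simp add: Int_absorb2)
    qed
    finally show "(\<integral>u. (\<Prod>j<d. dd {s j, t j} (\<lambda>x. kern (b j) (n j - 1) (\<alpha> j) x (u j))) \<partial>\<mu> b)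
      = measure (\<mu> b) (half_open_box d I b s t) / (\<Prod>i<d. t i - s i)" .
  qed
  finally show ?thesis by (simp add: sum_divide_distrib)
qed

text \<open>The differences of f over boxes form a content: for s < t they are the volume times a
  mixed difference, which box-convexity makes nonnegative, and degenerate boxes have content 0. The
  measures of this content have the right mixed differences because two nodes per coordinate are the
  vertices of a box.\<close>

lemma representation_order_1:
  assumes d: "1 \<le> d" and I: "\<And>i. i < d \<Longrightarrow> open (I i) \<and> is_interval (I i)"
    and \<alpha>: "\<alpha> \<in> PiE {..<d} I" and n: "\<And>i. i < d \<Longrightarrow> n i = 1" and f: "box_convex d I n f"
  shows "\<exists>\<mu>. admissible d I \<mu> \<and> (\<forall>A. nodes d I n A \<longrightarrow> mdd {..<d} A f pt = mdd {..<d} A (hrep d n \<alpha> \<mu>) pt)"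
proof -
  define c where "c s t = bdiff {..<d} s t f pt" for s t
  have nod: "nodes d I n (\<lambda>i. {s i, t i})" if "\<And>i. i < d \<Longrightarrow> s i \<in> I i \<and> t i \<in> I i \<and> s i < t i" for s t
    unfolding nodes_def
  proof (intro allI impI)
    fix i assume "i < d"
    then show "{s i, t i} \<subseteq> I i \<and> card {s i, t i} = Suc (n i)" using that[of i] n[of i] by auto
  qed
  have slice: "c s t = bdiff ({..<d} - {i}) s t f (pt(i := t i)) - bdiff ({..<d} - {i}) s t f (pt(i := s i))"
    if "i < d" for i s t
  proof -
    have "insert i ({..<d} - {i}) = {..<d}" using that by auto
    then show ?thesis using bdiff_insert[of "{..<d} - {i}" i s t f pt] by (simp add: c_def)
  qed
  interpret box_content d I \<alpha> c
  proof
    show "1 \<le> d" by (rule d)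
    show "open (I i) \<and> is_interval (I i)" if "i < d" for i by (rule I[OF that])
    show "\<alpha> \<in> PiE {..<d} I" by (rule \<alpha>)
    show "c s t = c s' t'" if "\<And>i. i < d \<Longrightarrow> s i = s' i \<and> t i = t' i" for s t s' t'
      unfolding c_def using that by (intro bdiff_cong) simp
    show add: "c s t = c s (t(i := e)) + c (s(i := e)) t" if "i < d" for i s t e
    proof -
      have "bdiff ({..<d} - {i}) s (t(i := e)) f x = bdiff ({..<d} - {i}) s t f x"
        "bdiff ({..<d} - {i}) (s(i := e)) t f x = bdiff ({..<d} - {i}) s t f x" for x
        by (rule bdiff_cong; simp)+
      then show ?thesis using slice[OF that, of s t] slice[OF that, of s "t(i := e)"] slice[OF that, of "s(i := e)" t]
        by simp
    qed
    show "0 \<le> c s t" if st: "\<And>i. i < d \<Longrightarrow> s i \<in> I i \<and> t i \<in> I i \<and> s i \<le> t i" for s t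
    proof (cases "\<exists>i<d. s i = t i")
      case True
      then obtain i where "i < d" "s i = t i" by blast
      then show ?thesis using slice[of i s t] by simp
    next
      case False
      then have lt: "\<And>i. i < d \<Longrightarrow> s i \<in> I i \<and> t i \<in> I i \<and> s i < t i" using st by (metis less_eq_real_def)
      have "c s t = (\<Prod>i<d. t i - s i) * mdd {..<d} (\<lambda>i. {s i, t i}) f pt"
        unfolding c_def by (rule bdiff_eq_mdd) (use False in auto)
      moreover have "0 \<le> mdd {..<d} (\<lambda>i. {s i, t i}) f pt"
        using f nod[OF lt] by (simp add: box_convex_iff_mdd)
      moreover have "0 \<le> (\<Prod>i<d. t i - s i)" using lt by (intro prod_nonneg) (simp add: less_imp_le)
      ultimately show ?thesis by simp
    qed
  qed
  obtain \<mu> where adm: "admissible d I \<mu>" and eq: "\<And>s t. (\<And>i. i < d \<Longrightarrow> s i \<in> I i \<and> t i \<in> I i \<and> s i < t i) \<Longrightarrow>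
      c s t = (\<Sum>b\<in>sides d. measure (\<mu> b) (half_open_box d I b s t))"
    using content_representation by blast
  have "mdd {..<d} A f pt = mdd {..<d} A (hrep d n \<alpha> \<mu>) pt" if A: "nodes d I n A" for A
  proof -
    have "\<exists>s t. A i = {s, t} \<and> s < t \<and> s \<in> I i \<and> t \<in> I i" if i: "i < d" for i
    proof -
      have "card (A i) = 2" "A i \<subseteq> I i" using A n[OF i] i by (simp_all add: nodes_def)
      then obtain x y where xy: "A i = {x, y}" "x \<noteq> y" "x \<in> I i" "y \<in> I i" by (auto simp: card_2_iff)
      then consider "x < y" | "y < x" by linarith
      then show ?thesis
      proof cases
        case 1
        then show ?thesis using xy by blast
      next
        case 2
        then show ?thesis using xy by (intro exI[of _ y] exI[of _ x]) (simp add: insert_commute)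
      qed
    qed
    then obtain s t where st: "\<And>i. i < d \<Longrightarrow> A i = {s i, t i} \<and> s i < t i \<and> s i \<in> I i \<and> t i \<in> I i" by metis
    then have st': "\<And>i. i < d \<Longrightarrow> s i \<in> I i \<and> t i \<in> I i \<and> s i < t i" by blast
    let ?A = "\<lambda>i. {s i, t i}"
    have pos: "(\<Prod>i<d. t i - s i) > 0" using st' by (intro prod_pos) auto
    have cf: "c s t = (\<Prod>i<d. t i - s i) * mdd {..<d} ?A f pt"
      unfolding c_def by (rule bdiff_eq_mdd) (use st' in force)+
    have ch: "c s t = (\<Prod>i<d. t i - s i) * mdd {..<d} ?A (hrep d n \<alpha> \<mu>) pt"
    proof -
      have "mdd {..<d} ?A (hrep d n \<alpha> \<mu>) pt
          = (\<Sum>b\<in>sides d. measure (\<mu> b) (half_open_box d I b s t)) / (\<Prod>i<d. t i - s i)"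
        by (rule mdd_hrep_order_1[OF I \<alpha> adm n st'])
      moreover have "c s t = (\<Sum>b\<in>sides d. measure (\<mu> b) (half_open_box d I b s t))" by (rule eq[OF st'])
      moreover have "P * (X / P) = X" if "0 < P" for P X :: real using that by simp
      ultimately show ?thesis using pos by presburger
    qed
    have "x = y" if "0 < P" "z = P * x" "z = P * y" for P x y z :: real using that by simp
    from this[OF pos cf ch] have "mdd {..<d} ?A f pt = mdd {..<d} ?A (hrep d n \<alpha> \<mu>) pt" .
    moreover have "mdd {..<d} A g pt = mdd {..<d} ?A g pt" for g
      by (rule mdd_cong_sets) (use st in auto)
    ultimately show ?thesis by simp
  qed
  with adm show ?thesis by blast
qed

text \<open>Equality of mixed differences is the statement that survives the induction: it ignores
  the pseudo-polynomial part, which is recovered only once, at the end. Any coordinate of order at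
  least 2 may be lowered.\<close>

lemma representation_modulo_kernel:
  assumes d: "1 \<le> d" and I: "\<And>i. i < d \<Longrightarrow> open (I i) \<and> is_interval (I i)" and \<alpha>: "\<alpha> \<in> PiE {..<d} I"
    and "\<And>i. i < d \<Longrightarrow> 1 \<le> n i" "box_convex d I n f"
  shows "\<exists>\<mu>. admissible d I \<mu> \<and> (\<forall>A. nodes d I n A \<longrightarrow> mdd {..<d} A f pt = mdd {..<d} A (hrep d n \<alpha> \<mu>) pt)"
  using assms(4,5)
proof (induction "\<Sum>i<d. n i" arbitrary: n f rule: less_induct)
  case less
  show ?case
  proof (cases "\<forall>i<d. n i = 1")
    case True
    then show ?thesis by (intro representation_order_1[OF d I \<alpha> _ less.prems(2)]) auto
  next
    case False
    then obtain i where i: "i < d" "n i \<noteq> 1" by blast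
    then have ni: "2 \<le> n i" using less.prems(1)[OF i(1)] by simp
    let ?n = "n(i := n i - 1)"
    have sm: "(\<Sum>j<d. ?n j) < (\<Sum>j<d. n j)"
    proof (rule sum_strict_mono_ex1)
      show "\<forall>j\<in>{..<d}. ?n j \<le> n j" by simp
      show "\<exists>j\<in>{..<d}. ?n j < n j" using i ni by (intro bexI[of _ i]) auto
    qed simp
    have n1: "1 \<le> ?n j" if "j < d" for j using less.prems(1)[OF that] ni by (cases "j = i") auto
    show ?thesis
    proof (rule representation_step[OF I \<alpha> i(1) less.prems(2) less.prems(1) ni])
      fix g assume "box_convex d I ?n g"
      then show "\<exists>\<mu>. admissible d I \<mu> \<and> (\<forall>A. nodes d I ?n A \<longrightarrow> mdd {..<d} A g pt = mdd {..<d} A (hrep d ?n \<alpha> \<mu>) pt)"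
        using less.hyps[OF sm n1] by blast
    qed
  qed
qed

theorem theorem32:
  fixes d :: nat
    and I :: "nat \<Rightarrow> real set"
    and f :: "(nat \<Rightarrow> real) \<Rightarrow> real"
    and \<alpha> :: "nat \<Rightarrow> real"
    and n :: "nat \<Rightarrow> nat"
  assumes "1 \<le> d"
    and "\<And>i. i < d \<Longrightarrow> open (I i) \<and> is_interval (I i)"
    and "\<alpha> \<in> PiE {..<d} I"
    and "\<And>i. i < d \<Longrightarrow> 1 \<le> n i"
  shows "box_convex d I n f \<longleftrightarrow>
    (\<exists>(W :: (nat \<Rightarrow> real) \<Rightarrow> real) (\<mu> :: (nat \<Rightarrow> side) \<Rightarrow> (nat \<Rightarrow> real) measure).
       pseudo_polynomial d I (\<lambda>i. n i - 1) W \<and>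
       (\<forall>b\<in>PiE {..<d} (\<lambda>_. {SideL, SideR}).
          space (\<mu> b) = PiE {..<d} I \<and> sets (\<mu> b) = sets (box_borel d I) \<and>
          (\<forall>K. compactin (box_topology d I) K \<longrightarrow> emeasure (\<mu> b) K < \<infinity>) \<and>
          (\<forall>i<d. b i = SideL \<longrightarrow> discrete_measure (marginal i (\<mu> b)))) \<and>
       (\<forall>x\<in>PiE {..<d} I.
          f x = W x + (\<Sum>b\<in>PiE {..<d} (\<lambda>_. {SideL, SideR}).
            \<integral>u. (\<Prod>j<d. (x j - u j) ^ (n j - 1) / fact (n j - 1) * chi (b j) (\<alpha> j) (x j) (u j)) \<partial>\<mu> b)))"
  (is "_ \<longleftrightarrow> ?R")
proof -
  note I = assms(2) and \<alpha> = assms(3) and n = assms(4)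
  have R: "?R \<longleftrightarrow> (\<exists>W \<mu>. pseudo_polynomial d I (\<lambda>i. n i - 1) W \<and> admissible d I \<mu> \<and>
      (\<forall>x\<in>PiE {..<d} I. f x = W x + hrep d n \<alpha> \<mu> x))"
    by (simp only: admissible_def loc_finite_on_def hrep_def kern_def sides_def conj_assoc)
  show ?thesis
    unfolding R
  proof
    assume f: "box_convex d I n f"
    obtain \<mu> where adm: "admissible d I \<mu>"
      and eq: "\<And>A. nodes d I n A \<Longrightarrow> mdd {..<d} A f pt = mdd {..<d} A (hrep d n \<alpha> \<mu>) pt"
      using representation_modulo_kernel[OF assms(1) I \<alpha> n f] by blast
    have "infinite (I i)" if "i < d" for i
      using infinite_open_real[of "I i" "\<alpha> i"] I[OF that] PiE_mem[OF \<alpha>, of i] that by simp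
    then have "pseudo_polynomial d I (\<lambda>i. n i - 1) (\<lambda>x. f x - hrep d n \<alpha> \<mu> x)"
      by (rule pseudo_polynomial_of_mdd_zero) (simp_all add: mdd_diff eq)
    then show "\<exists>W \<mu>. pseudo_polynomial d I (\<lambda>i. n i - 1) W \<and> admissible d I \<mu> \<and>
        (\<forall>x\<in>PiE {..<d} I. f x = W x + hrep d n \<alpha> \<mu> x)"
      using adm by (intro exI[of _ "\<lambda>x. f x - hrep d n \<alpha> \<mu> x"] exI[of _ \<mu>]) simp
  next
    assume "\<exists>W \<mu>. pseudo_polynomial d I (\<lambda>i. n i - 1) W \<and> admissible d I \<mu> \<and>
        (\<forall>x\<in>PiE {..<d} I. f x = W x + hrep d n \<alpha> \<mu> x)"
    then obtain W \<mu> where W: "pseudo_polynomial d I (\<lambda>i. n i - 1) W" and adm: "admissible d I \<mu>"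
      and eq: "\<And>x. x \<in> PiE {..<d} I \<Longrightarrow> f x = W x + hrep d n \<alpha> \<mu> x" by blast
    show "box_convex d I n f"
      unfolding box_convex_iff_mdd
    proof (intro allI impI)
      fix A assume A: "nodes d I n A"
      have "mdd {..<d} A f pt = mdd {..<d} A (\<lambda>x. W x + hrep d n \<alpha> \<mu> x) pt"
        by (rule mdd_cong_box[OF eq]) (use A in \<open>auto simp: nodes_def\<close>)
      also have "\<dots> = mdd {..<d} A (hrep d n \<alpha> \<mu>) pt"
        using mdd_pseudo_polynomial[OF W A n] by (simp add: mdd_add)
      also have "0 \<le> \<dots>" by (rule mdd_hrep_nonneg[OF I \<alpha> adm A n])
      finally show "0 \<le> mdd {..<d} A f pt" .
    qed
  qed
qed

end
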